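(* Let $\alpha\ge 1$ be an integer and let $\ell$ be an odd prime. Then for all integers $n\ge 0$, $$\ell^3\,\overline{p}(2^\alpha\ell^2 n)+\ell\left(\frac{-2^\alpha n}{\ell}\right)\overline{p}(2^\alpha n)+\overline{p}\left(\frac{2^\alpha n}{\ell^2}\right)\equiv (\ell^3+1)\,\overline{p}(2^\alpha n)\pmod{2^{\alpha+12}}.$$
   Context: For a non-negative integer $n$, $\overline{p}(n)$ denotes the number of overpartitions of $n$, i.e. partitions of $n$ in which the first occurrence of each distinct part may be overlined; equivalently $\sum_{n\ge 0}\overline{p}(n)q^n=\prod_{k\ge 1}\frac{1+q^k}{1-q^k}$. By convention $\overline{p}(x)=0$ if $x$ is not a non-negative integer. $\left(\frac{a}{\ell}\right)$ denotes the Jacobi (here Legendre) symbol, which is $0$ when $\ell\mid a$. *)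

theory Defs
  imports "HOL-Number_Theory.Number_Theory" "HOL-Library.Multiset"
begin

text \<open>
  An overpartition of \<open>n\<close> is a pair \<open>(M, S)\<close>: \<open>M\<close> is the multiset of (positive) parts, with
  sum \<open>n\<close>, and \<open>S\<close> is the set of those distinct parts whose first occurrence is overlined.
\<close>

definition overpartitions :: "nat \<Rightarrow> (nat multiset \<times> nat set) set" where
  "overpartitions n = {(M, S). 0 \<notin># M \<and> sum_mset M = n \<and> S \<subseteq> set_mset M}"

definition pbar_nat :: "nat \<Rightarrow> nat" where
  "pbar_nat n = card (overpartitions n)"

text \<open>The extension to rational arguments, with value 0 off the non-negative integers.\<close>

definition pbar :: "rat \<Rightarrow> nat" where
  "pbar x = (if x \<in> \<nat> then pbar_nat (nat \<lfloor>x\<rfloor>) else 0)"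

lemma pbar_of_nat [simp]: "pbar (of_nat n) = pbar_nat n"
  by (simp add: pbar_def)

lemma size_le_sum_mset: "0 \<notin># M \<Longrightarrow> size M \<le> sum_mset (M :: nat multiset)"
  by (induction M) auto

lemma set_mset_le_sum_mset: "x \<in># M \<Longrightarrow> x \<le> sum_mset (M :: nat multiset)"
  by (metis multi_member_split sum_mset.add_mset le_add1)

text \<open>Finiteness, so that \<open>card\<close> in \<open>pbar_nat_def\<close> is a genuine count.\<close>

lemma finite_overpartitions: "finite (overpartitions n)"
proof -
  have "finite {M :: nat multiset. set_mset M \<subseteq> {..n} \<and> size M \<le> n}"
  proof (rule finite_subset)
    show "{M :: nat multiset. set_mset M \<subseteq> {..n} \<and> size M \<le> n}
            \<subseteq> mset ` {xs. set xs \<subseteq> {..n} \<and> length xs \<le> n}"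
    proof
      fix M :: "nat multiset"
      assume M: "M \<in> {M. set_mset M \<subseteq> {..n} \<and> size M \<le> n}"
      obtain xs where "mset xs = M"
        using ex_mset by blast
      moreover from this have "set_mset M = set xs" "size M = length xs"
        by (simp_all flip: set_mset_mset size_mset)
      ultimately show "M \<in> mset ` {xs. set xs \<subseteq> {..n} \<and> length xs \<le> n}"
        using M by (intro image_eqI[where x = xs]) simp_all
    qed
    show "finite (mset ` {xs. set xs \<subseteq> {..n} \<and> length xs \<le> n})"
      by (intro finite_imageI finite_lists_length_le) simp
  qed
  then have "finite ({M :: nat multiset. set_mset M \<subseteq> {..n} \<and> size M \<le> n} \<times> Pow {..n})"
    by simp
  then show ?thesis
  proof (rule finite_subset[rotated])
    show "overpartitions n \<subseteq> {M. set_mset M \<subseteq> {..n} \<and> size M \<le> n} \<times> Pow {..n}"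
    proof
      fix P
      assume "P \<in> overpartitions n"
      then obtain M S where P: "P = (M, S)" "0 \<notin># M" "sum_mset M = n" "S \<subseteq> set_mset M"
        unfolding overpartitions_def by blast
      have "set_mset M \<subseteq> {..n}"
        using set_mset_le_sum_mset[of _ M] P(3) by (simp add: subset_iff)
      moreover have "size M \<le> n"
        using size_le_sum_mset[of M] P(2,3) by simp
      ultimately show "P \<in> {M. set_mset M \<subseteq> {..n} \<and> size M \<le> n} \<times> Pow {..n}"
        using P(1,4) by blast
    qed
  qed
qed

end

theory Submission
  imports Defs "HOL-Complex_Analysis.Complex_Analysis"
begin

text \<open>
Let \<open>F(q) = \<Sum> pbar(n) q^n\<close> be the generating function of overpartitions. Gauss's identity says
\<open>F(q) = 1 / \<phi>(-q)\<close> with \<open>\<phi>(q) = \<Sum> q^(n^2)\<close>, summed over the integers (\<open>pbar_fps_mult_phim\<close>), so that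
\<open>F\<close> is a modular form of weight \<open>-1/2\<close>. The left side of the congruence is a coefficient of
\<open>T F\<close>, where \<open>T\<close> is the Hecke operator \<open>T(l^2)\<close> in weight \<open>-1/2\<close>, scaled to be integral. The theorem
says that \<open>F\<close> is an eigenform with eigenvalue \<open>l^3 + 1\<close> up to an error
\<open>D = T F - (l^3 + 1) F\<close> whose coefficients at the multiples of \<open>2^\<alpha>\<close> are divisible by \<open>2^(\<alpha>+12)\<close>. The
factor \<open>2^12\<close> comes from modularity and the factor \<open>2^\<alpha>\<close> from a 2-adic argument.

Modularity gives an exact formula (\<open>hecke_pbar_polynomial\<close>):
\<open>D = \<Sum> e_j 2^(12 j) F v^j\<close>, summed over \<open>1 \<le> j \<le> m\<close>, with integers \<open>e_j\<close>, \<open>l^2 = 8 m + 1\<close> and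
\<open>v = \<theta>\<^sub>2^4 \<theta>\<^sub>3^4 / (16 \<theta>\<^sub>4^8)\<close>. Indeed, after \<open>q \<mapsto> -q\<close> the quotient \<open>D / F\<close> is invariant under
\<open>\<tau> \<mapsto> \<tau> + 2\<close> and \<open>\<tau> \<mapsto> -1/\<tau>\<close>, because \<open>T\<close> commutes with the inversion up to the factor of automorphy
(\<open>hecke_inversion\<close>, by Poisson summation in residue classes). The quotient is holomorphic in the upper half-plane and has
a pole of order at most \<open>m\<close> at the second cusp, where in the local variable \<open>x\<close> its expansion is integral. The
function \<open>v\<close> has the same invariance, and there \<open>2^12 v = (1 + ...) / x\<close> with integral coefficients. Hence some
polynomial in \<open>2^12 v\<close> with integral coefficients has the same principal part and constant term as \<open>D / F\<close>; the difference is invariant and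
vanishes at the second cusp, so it is zero by the maximum principle (\<open>modular_vanishing\<close>). Since \<open>D\<close> and \<open>v\<close>
vanish at \<open>q = 0\<close>, the polynomial has no constant term.

For the 2-adic part let \<open>U\<^sub>2\<close> extract the coefficients with even index. Writing \<open>g = \<theta>\<^sub>2^4 / 16\<close>, the series
\<open>2^(j-1) g^j \<phi>^a F^b\<close> with \<open>j \<ge> 1\<close> span a group that \<open>U\<^sub>2\<close> maps into twice a second group of the same
shape, which \<open>U\<^sub>2\<close> maps into twice the first (\<open>U2_theta_span\<close>, \<open>U2_theta_span'\<close>). The reason is the
dissection \<open>\<phi>(q) = \<phi>(q^4) + 2 q \<psi>(q^8)\<close>: an odd factor comes with a factor 2, and \<open>U\<^sub>2\<close>
keeps only an even number of odd factors. By the formula above \<open>D / 2^12\<close> lies in the first group, so \<open>\<alpha>\<close>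
applications of \<open>U\<^sub>2\<close> produce \<open>2^\<alpha>\<close> (\<open>theta_span_coeff_divisible\<close>).
\<close>

unbundle no vec_syntax

section \<open>Overpartitions and the inverse of \<open>\<phi>(-q)\<close>\<close>

definition overpartitions_upto :: "nat \<Rightarrow> nat \<Rightarrow> (nat multiset \<times> nat set) set" where
  "overpartitions_upto m n = {(M, S) \<in> overpartitions n. set_mset M \<subseteq> {..m}}"

lemma finite_overpartitions_upto [simp]: "finite (overpartitions_upto m n)"
  by (rule finite_subset[OF _ finite_overpartitions[of n]]) (auto simp: overpartitions_upto_def)

lemma overpartitions_upto_eq: "n \<le> m \<Longrightarrow> overpartitions_upto m n = overpartitions n"
  unfolding overpartitions_upto_def overpartitions_def
  using set_mset_le_sum_mset by fastforce

lemma overpartitions_upto_0: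
  "overpartitions_upto 0 n = (if n = 0 then {({#}, {})} else {})"
proof -
  have "M = {#}" if "0 \<notin># M" "set_mset M \<subseteq> {..0::nat}" for M
    using that by (metis atMost_0 multiset_nonemptyE singletonD subsetD)
  then have "overpartitions_upto 0 n = {(M, S). M = {#} \<and> S = {} \<and> n = 0}"
    unfolding overpartitions_upto_def overpartitions_def by (auto simp del: atMost_0) 
  then show ?thesis by auto
qed

text \<open>
Remove one copy of the part \<open>m + 1\<close>. The overlining of the rest stays admissible unless the removed copy was the only
one and was overlined; then the rest has parts up to \<open>m\<close>, which gives the last summand.
\<close>

lemma card_overpartitions_upto_Suc:
  defines "P \<equiv> \<lambda>m n. card (overpartitions_upto m n)"
  shows "P (Suc m) n = P m n + (if Suc m \<le> n then P (Suc m) (n - Suc m) + P m (n - Suc m) else 0)"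
proof -
  define k where "k = Suc m"
  define W where "W = {(M, S) \<in> overpartitions_upto k n. k \<in># M}"
  have split: "overpartitions_upto k n = overpartitions_upto m n \<union> W"
    unfolding overpartitions_upto_def W_def k_def using le_Suc_eq by fastforce
  have disj: "overpartitions_upto m n \<inter> W = {}"
    unfolding overpartitions_upto_def W_def k_def by auto
  have fW: "finite W"
    using split finite_overpartitions_upto[of k n] by simp
  have cardk: "P k n = P m n + card W"
    unfolding P_def split by (rule card_Un_disjoint) (use fW disj in auto)
  have cardW: "card W = (if k \<le> n then P k (n - k) + P m (n - k) else 0)"
  proof (cases "k \<le> n")
    case False
    have "W = {}"
      unfolding W_def overpartitions_upto_def overpartitions_def
      using False set_mset_le_sum_mset by fastforce
    then show ?thesis using False by simp
  next
    case True
    \<comment> \<open>\<open>f\<close> adds a copy of \<open>k\<close> without a new overline, \<open>g\<close> adds the only copy and overlines it.\<close>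
    define f where "f = (\<lambda>(M, S :: nat set). (add_mset k M, S))"
    define g where "g = (\<lambda>(M, S :: nat set). (add_mset k M, insert k S))"
    have "W = f ` overpartitions_upto k (n - k) \<union> g ` overpartitions_upto m (n - k)"
    proof (intro equalityI subsetI)
      fix x assume "x \<in> W"
      then obtain M S where x: "x = (M, S)" "0 \<notin># M" "sum_mset M = n" "S \<subseteq> set_mset M"
          "set_mset M \<subseteq> {..k}" "k \<in># M"
        unfolding W_def overpartitions_upto_def overpartitions_def by auto
      then obtain M' where M: "M = add_mset k M'"
        by (meson multi_member_split)
      have M': "0 \<notin># M'" "sum_mset M' = n - k" "set_mset M' \<subseteq> {..k}"
        using x M by auto
      show "x \<in> f ` overpartitions_upto k (n - k) \<union> g ` overpartitions_upto m (n - k)"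
      proof (cases "S \<subseteq> set_mset M'")
        case True
        then have "(M', S) \<in> overpartitions_upto k (n - k)"
          using M' unfolding overpartitions_upto_def overpartitions_def by auto
        then show ?thesis using x M unfolding f_def by force
      next
        case False
        then have k: "k \<in> S" "k \<notin># M'" using x M by auto
        then have "set_mset M' \<subseteq> {..m}"
          using M' unfolding k_def by (metis atMost_Suc subset_insert)
        then have "(M', S - {k}) \<in> overpartitions_upto m (n - k)"
          using M' x M unfolding overpartitions_upto_def overpartitions_def by auto
        moreover have "x = g (M', S - {k})" using k x M unfolding g_def by auto
        ultimately show ?thesis by blast
      qed
    next
      fix x assume "x \<in> f ` overpartitions_upto k (n - k) \<union> g ` overpartitions_upto m (n - k)"
      then show "x \<in> W"
        using True unfolding W_def f_def g_def overpartitions_upto_def overpartitions_def k_def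
        by fastforce
    qed
    moreover have "f ` overpartitions_upto k (n - k) \<inter> g ` overpartitions_upto m (n - k) = {}"
      unfolding f_def g_def overpartitions_upto_def overpartitions_def k_def by fastforce
    moreover have "inj_on f (overpartitions_upto k (n - k))"
      unfolding f_def inj_on_def by auto
    moreover have "inj_on g (overpartitions_upto m (n - k))"
    proof -
      have "k \<notin> S" if "(M, S) \<in> overpartitions_upto m (n - k)" for M S
        using that unfolding overpartitions_upto_def overpartitions_def k_def by fastforce
      note k = this
      show ?thesis
      proof (rule inj_onI)
        fix p p' assume p: "p \<in> overpartitions_upto m (n - k)" "p' \<in> overpartitions_upto m (n - k)"
          and eq: "g p = g p'"
        obtain M S M' S' where M: "p = (M, S)" "p' = (M', S')" by (metis surj_pair)
        have "insert k S = insert k S'" "M = M'" using eq by (simp_all add: M g_def)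
        moreover have "k \<notin> S" "k \<notin> S'" using k p by (simp_all add: M)
        ultimately show "p = p'" unfolding M by (simp add: insert_ident)
      qed
    qed
    ultimately show ?thesis
      using True unfolding P_def by (simp add: card_Un_disjoint card_image)
  qed
  show ?thesis using cardk cardW unfolding k_def by simp
qed

definition op_fps :: "nat \<Rightarrow> int fps" where
  "op_fps m = Abs_fps (\<lambda>n. int (card (overpartitions_upto m n)))"

definition pbar_fps :: "int fps" where
  "pbar_fps = Abs_fps (\<lambda>n. int (pbar_nat n))"

lemma op_fps_0: "op_fps 0 = 1"
  by (rule fps_ext) (simp add: op_fps_def overpartitions_upto_0)

lemma op_fps_Suc: "(1 - fps_X ^ Suc m) * op_fps (Suc m) = (1 + fps_X ^ Suc m) * op_fps m"
proof (rule fps_ext)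
  fix n
  show "((1 - fps_X ^ Suc m) * op_fps (Suc m)) $ n = ((1 + fps_X ^ Suc m) * op_fps m) $ n"
    unfolding ring_distribs mult_1_left fps_sub_nth fps_add_nth fps_X_power_mult_nth
    using card_overpartitions_upto_Suc[of m n] by (simp add: op_fps_def)
qed

lemma op_fps_nth: "n \<le> m \<Longrightarrow> op_fps m $ n = pbar_fps $ n"
  by (simp add: op_fps_def pbar_fps_def pbar_nat_def overpartitions_upto_eq)

text \<open>
Ramanujan's \<open>\<phi>(q) = \<Sum> q^(k^2)\<close>, summed over all integers \<open>k\<close>.
\<close>

definition phi :: "int fps" where
  "phi = Abs_fps (\<lambda>n. if n = 0 then 1 else if \<exists>k. n = k\<^sup>2 then 2 else 0)"

text \<open>
The series \<open>\<phi>(-q)\<close>.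
\<close>

definition phim :: "int fps" where
  "phim = Abs_fps (\<lambda>n. (-1) ^ n * phi $ n)"

definition theta_partial :: "nat \<Rightarrow> int fps" where
  "theta_partial n = 1 + (\<Sum>s=1..n. 2 * (-1) ^ s * fps_X ^ (s ^ 2))"

text \<open>
This and the following three facts are the ring identities behind the inductive step of the finite Gauss identity below. An abstract
integral domain in place of the power series makes them problems about polynomials in a few unknowns.
\<close>

lemma shanks_step1: fixes p :: "'a::idom"
 assumes "(1 - y) * p' = (1 + y) * p"
 shows "(1 - x) * ((p' + p) * (z * y)) - (1 + x) * ((p' + p) * z) = - 2 * z * p - 2 * p' * (z * x)"
  using assms by Groebner_Basis.algebra
lemma shanks_step2: fixes p :: "'a::idom"
  assumes "s = - s'" "(1 - x) * (1 + U) - (1 + x) * (1 + V) = - 2 * s' * p * z"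
         "(1 - x) * ((p' + p) * (z * y)) - (1 + x) * ((p' + p) * z) = - 2 * z * p - 2 * p' * (z * x)"
  shows "(1 - x) * (1 + (U + s * (p' + p) * (z * y))) - (1 + x) * (1 + (V + s * (p' + p) * z))
                = - 2 * s * p' * (z * x)"
 using assms by Groebner_Basis.algebra
lemma shanks_step3: fixes p :: "'a::idom"
  assumes "(1 - x) * U - (1 + x) * V = 2 * s * p * z" "(1 - x) * p' = (1 + x) * p"
  shows "(1 - x) * (U + s * (p' + p) * (z * x)) - (1 + x) * V = (1 - x) * (2 * s * z * p')"
  using assms by Groebner_Basis.algebra
lemma shanks_step4: fixes p :: "'a::idom"
  assumes "(1 - x) * U - (1 + x) * V = (1 - x) * (2 * s * z * p')" "t * p = V"  "(1 - x) * p' = (1 + x) * p"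
     "t' = t + 2 * s * z"
  shows "(1 - x) * (t' * p') = (1 - x) * U"
  using assms by Groebner_Basis.algebra

text \<open>
Shanks's finite form of Gauss's identity: every summand on the right with \<open>s \<ge> 1\<close> is divisible by
\<open>q^(n+1)\<close>, so the product is \<open>1\<close> up to that order. In the inductive step, multiplying by \<open>1 - q^(n+1)\<close> turns
the passage from \<open>n\<close> to \<open>n + 1\<close> on the right into a telescoping sum.
\<close>

lemma shanks_identity:
  "theta_partial n * op_fps n =
     1 + (\<Sum>s=1..n. (-1) ^ s * (op_fps s + op_fps (s - 1)) * fps_X ^ (s * (n + 1)))"
proof (induction n)
  case 0
  then show ?case by (simp add: theta_partial_def op_fps_0)
next
  case (Suc n)
  define k where "k = Suc n"
  define P where "P = op_fps"
  define X where "X = (fps_X :: int fps)"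
  define Y where "Y = (\<lambda>n. 1 + (\<Sum>s=1..n. (-1) ^ s * (P s + P (s - 1)) * X ^ (s * (n + 1))))"
  have rec: "(1 - X ^ s) * P s = (1 + X ^ s) * P (s - 1)" if "s \<ge> 1" for s
    using that op_fps_Suc[of "s - 1"] by (simp add: P_def X_def)
  have telescope: "(1 - X ^ k) * (1 + (\<Sum>s=1..r. (-1) ^ s * (P s + P (s - 1)) * X ^ (s * (k + 1))))
      - (1 + X ^ k) * (1 + (\<Sum>s=1..r. (-1) ^ s * (P s + P (s - 1)) * X ^ (s * k)))
      = - 2 * (-1) ^ r * P r * X ^ ((r + 1) * k)" for r
  proof (induction r)
    case 0
    then show ?case by (simp add: P_def op_fps_0)
  next
    case (Suc r)
    define x where "x = X ^ k" 
    define y where "y = X ^ Suc r"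
    define z where "z = X ^ (Suc r * k)"
    have r: "(1 - y) * P (Suc r) = (1 + y) * P r"
      using rec[of "Suc r"] by (simp add: y_def)
    have e: "X ^ (Suc r * (k + 1)) = z * y" "X ^ ((r + 1) * k) = z" "X ^ ((Suc r + 1) * k) = z * x"
      unfolding x_def y_def z_def power_add[symmetric]
      by (rule arg_cong[where f = "\<lambda>n. X ^ n"]; simp add: algebra_simps)+
    have sum: "(\<Sum>s=1..Suc r. h s) = (\<Sum>s=1..r. h s) + h (Suc r)" for h :: "nat \<Rightarrow> int fps"
      by simp
    show ?case
      unfolding sum e diff_Suc_1 x_def[symmetric] z_def[symmetric]
      by (rule shanks_step2[OF _ Suc.IH[unfolded e x_def[symmetric]] shanks_step1[OF r]]) simp
  qed
  have Yk: "Y k = 1 + (\<Sum>s=1..n. (-1) ^ s * (P s + P (s - 1)) * X ^ (s * (k + 1)))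
        + (-1) ^ k * (P k + P n) * X ^ (k * (k + 1))"
    unfolding Y_def k_def by (simp add: add.assoc)
  have Yn: "Y n = 1 + (\<Sum>s=1..n. (-1) ^ s * (P s + P (s - 1)) * X ^ (s * k))"
    unfolding Y_def k_def by simp
  have Pk: "(1 - X ^ k) * P k = (1 + X ^ k) * P n"
    using rec[of k] by (simp add: k_def)
  have xx: "X ^ (k * (k + 1)) = X ^ (k\<^sup>2) * X ^ k" "X ^ ((n + 1) * k) = X ^ (k\<^sup>2)"
    unfolding power_add[symmetric]
    by (rule arg_cong[where f = "\<lambda>n. X ^ n"]; simp add: k_def power2_eq_square algebra_simps)+
  have sgn: "(-1) ^ k = - ((-1) ^ n :: int fps)"
    by (simp add: k_def)
  have tel: "(1 - X ^ k) * (1 + (\<Sum>s=1..n. (-1) ^ s * (P s + P (s - 1)) * X ^ (s * (k + 1))))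
      - (1 + X ^ k) * Y n = 2 * (-1) ^ k * P n * X ^ (k\<^sup>2)"
    using telescope[of n] unfolding Yn xx sgn by simp
  have a: "(1 - X ^ k) * Y k - (1 + X ^ k) * Y n = (1 - X ^ k) * (2 * (-1) ^ k * X ^ (k\<^sup>2) * P k)"
    unfolding Yk xx by (rule shanks_step3[OF tel Pk])
  have IH: "theta_partial n * P n = Y n"
    using Suc.IH by (simp add: P_def X_def Y_def)
  have Sk: "theta_partial k = theta_partial n + 2 * (-1) ^ k * X ^ (k\<^sup>2)"
    by (simp add: theta_partial_def k_def X_def)
  have "(1 - X ^ k) * (theta_partial k * P k) = (1 - X ^ k) * Y k"
    by (rule shanks_step4[OF a IH Pk Sk])
  moreover have "(1 - X ^ k) \<noteq> 0"
  proof
    assume "1 - X ^ k = 0"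
    then have "(1 - X ^ k) $ 0 = 0" by simp
    then show False by (simp add: X_def k_def)
  qed
  ultimately have "theta_partial k * P k = Y k" by simp
  then show ?case by (simp add: P_def X_def Y_def k_def)
qed

lemma theta_partial_nth: "k \<le> n \<Longrightarrow> theta_partial n $ k = phim $ k"
proof -
  assume kn: "k \<le> n"
  have "(\<Sum>s=1..n. (2 * (-1) ^ s * fps_X ^ (s ^ 2) :: int fps) $ k) =
        (\<Sum>s=1..n. if s ^ 2 = k then 2 * (-1) ^ s else 0)"
  proof (rule sum.cong[OF refl])
    fix s
    have c: "(2 * (-1) ^ s :: int fps) = fps_const (2 * (-1) ^ s)"
      by (metis fps_const_mult fps_const_neg fps_const_power fps_const_1_eq_1 fps_numeral_fps_const)
    show "(2 * (-1) ^ s * fps_X ^ (s ^ 2) :: int fps) $ k = (if s ^ 2 = k then 2 * (-1) ^ s else 0)"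
      unfolding c by (auto simp: fps_X_power_nth)
  qed
  also have "\<dots> = (if k = 0 then 0 else if (\<exists>t. k = t\<^sup>2) then 2 * (-1) ^ k else 0)"
  proof (cases "k \<noteq> 0 \<and> (\<exists>t. k = t\<^sup>2)")
    case False
    then have "s ^ 2 \<noteq> k" if "s \<in> {1..n}" for s
      using that by auto
    then show ?thesis using False by (auto intro!: sum.neutral)
  next
    case True
    then obtain t where t: "k = t ^ 2" "t > 0" by auto
    have "t \<le> k" using t by (simp add: power2_eq_square)
    then have "t \<in> {1..n}" using t kn by auto
    have "(\<Sum>s=1..n. if s ^ 2 = k then 2 * (-1) ^ s else 0) = (\<Sum>s\<in>{t}. 2 * (-1) ^ s :: int)"
      using \<open>t \<in> {1..n}\<close> t by (intro sum.mono_neutral_cong_right) auto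
    then show ?thesis using True t
      by (auto simp: minus_one_power_iff)
  qed
  finally show ?thesis
    by (auto simp: theta_partial_def phim_def phi_def fps_sum_nth)
qed

text \<open>
Gauss's identity. The coefficient of \<open>q^n\<close> only sees the first terms of each series, where the finite
identity applies.
\<close>

theorem pbar_fps_mult_phim: "pbar_fps * phim = 1"
proof (rule fps_ext)
  fix n
  have "(theta_partial n * op_fps n) $ n = (phim * pbar_fps) $ n"
    unfolding fps_mult_nth by (intro sum.cong refl) (simp add: theta_partial_nth op_fps_nth)
  moreover have "(\<Sum>s=1..n. (-1) ^ s * (op_fps s + op_fps (s - 1)) * fps_X ^ (s * (n + 1))) $ n = (0::int)"
    unfolding fps_sum_nth 
  proof (intro sum.neutral ballI)
    fix s assume "s \<in> {1..n}"
    then have "n < s * (n + 1)"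
      using mult_le_mono1[of 1 s "n + 1"] by simp
    then show "((-1) ^ s * (op_fps s + op_fps (s - 1)) * fps_X ^ (s * (n + 1))) $ n = (0::int)"
      by (simp only: fps_X_power_mult_right_nth if_True)
  qed
  ultimately show "(pbar_fps * phim) $ n = 1 $ n"
    using shanks_identity[of n] by (simp add: mult.commute)
qed

text \<open>
The recursion for overpartitions with parts up to \<open>m\<close> becomes an inequality between partial sums, and solving it
bounds them by the finite product. Convergence of \<open>F\<close> in the unit disc follows.
\<close>

lemma pbar_partial_sum_bound:
  fixes x :: real
  assumes "0 \<le> x" "x < 1"
  shows "(\<Sum>n<N. real_of_int (op_fps m $ n) * x ^ n) \<le> (\<Prod>k=1..m. (1 + x ^ k) / (1 - x ^ k))"
proof (induction m arbitrary: N)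
  case 0
  have "(\<Sum>n<N. real_of_int (op_fps 0 $ n) * x ^ n) = (\<Sum>n\<in>{..<N}. if n = 0 then 1 else 0)"
    by (intro sum.cong) (auto simp: op_fps_0)
  then show ?case by simp
next
  case (Suc m)
  define k where "k = Suc m"
  define c where "c = (\<lambda>m n. real_of_int (op_fps m $ n))"
  define B where "B = (\<Prod>k=1..m. (1 + x ^ k) / (1 - x ^ k))"
  have nonneg: "c m n \<ge> 0" for m n by (simp add: c_def op_fps_def)
  have rec: "c k n = c m n + (if k \<le> n then c k (n - k) + c m (n - k) else 0)" for n
    using card_overpartitions_upto_Suc[of m n] by (simp add: c_def op_fps_def k_def)
  have shift: "(\<Sum>n<N. (if k \<le> n then a (n - k) else 0) * x ^ n) \<le> x ^ k * (\<Sum>n<N. a n * x ^ n)"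
    if "\<And>n. a n \<ge> 0" for a :: "nat \<Rightarrow> real"
  proof -
    have "(\<Sum>n<N. (if k \<le> n then a (n - k) else 0) * x ^ n) = (\<Sum>n\<in>{n. n < N \<and> k \<le> n}. a (n - k) * x ^ n)"
      by (intro sum.mono_neutral_cong_right) auto
    also have "\<dots> = (\<Sum>n\<in>{..<N - k}. a n * x ^ (n + k))"
      by (rule sum.reindex_bij_witness[of _ "\<lambda>n. n + k" "\<lambda>n. n - k"]) auto
    also have "\<dots> = x ^ k * (\<Sum>n\<in>{..<N - k}. a n * x ^ n)"
      by (simp add: sum_distrib_left power_add mult_ac)
    also have "(\<Sum>n\<in>{..<N - k}. a n * x ^ n) \<le> (\<Sum>n\<in>{..<N}. a n * x ^ n)"
      using that assms by (intro sum_mono2) auto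
    finally show ?thesis using assms by (simp add: mult_left_mono)
  qed
  define S where "S = (\<lambda>m. \<Sum>n<N. c m n * x ^ n)"
  have "S k = S m + ((\<Sum>n<N. (if k \<le> n then c k (n - k) else 0) * x ^ n)
        + (\<Sum>n<N. (if k \<le> n then c m (n - k) else 0) * x ^ n))"
    unfolding S_def sum.distrib[symmetric]
    by (intro sum.cong refl) (subst rec, simp add: algebra_simps)
  also have "\<dots> \<le> S m + (x ^ k * S k + x ^ k * S m)"
    unfolding S_def by (intro add_mono order.refl shift nonneg)
  finally have "(1 - x ^ k) * S k \<le> (1 + x ^ k) * S m" by (simp add: algebra_simps)
  also have "\<dots> \<le> (1 + x ^ k) * B"
    using Suc.IH[of N] assms by (intro mult_left_mono) (auto simp: S_def c_def B_def)
  finally have le: "(1 - x ^ k) * S k \<le> (1 + x ^ k) * B" .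
  have "1 - x ^ k > 0"
    using assms power_Suc_le_self[of x m] unfolding k_def by linarith
  then have "S k \<le> (1 + x ^ k) * B / (1 - x ^ k)"
    using le by (simp add: pos_le_divide_eq mult.commute)
  then show ?case by (simp add: S_def c_def B_def k_def mult.commute)
qed

lemma summable_pbar:
  fixes x :: real
  assumes "0 \<le> x" "x < 1"
  shows "summable (\<lambda>n. real (pbar_nat n) * x ^ n)"
proof (cases "x = 0")
  case True
  then show ?thesis
    by (auto intro: summable_finite[of "{0}"])
next
  case False
  \<comment> \<open>Each factor is \<open>1 + 2 y / (1 - y) \<le> exp (2 y / (1 - x))\<close> with \<open>y = x^k\<close>, and the exponents form a geometric series.\<close>
  define C where "C = exp (2 / (1 - x) * (1 / (1 - x)))"
  have bound: "(\<Sum>n<N. real (pbar_nat n) * x ^ n) \<le> C" for N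
  proof -
    have "(\<Sum>n<N. real (pbar_nat n) * x ^ n) = (\<Sum>n<N. real_of_int (op_fps N $ n) * x ^ n)"
      by (intro sum.cong refl) (simp add: op_fps_nth pbar_fps_def)
    also have "\<dots> \<le> (\<Prod>k=1..N. (1 + x ^ k) / (1 - x ^ k))"
      by (rule pbar_partial_sum_bound[OF assms])
    also have "\<dots> \<le> (\<Prod>k=1..N. exp (2 / (1 - x) * x ^ k))"
    proof (rule prod_mono)
      fix k assume k: "k \<in> {1..N}"
      have xk: "x ^ k \<le> x" "0 \<le> x ^ k"
        using assms k power_decreasing[of 1 k x] by auto
      have "(1 + x ^ k) / (1 - x ^ k) = 1 + 2 * x ^ k / (1 - x ^ k)"
        using xk assms by (simp add: field_simps)
      also have "2 * x ^ k / (1 - x ^ k) \<le> 2 * x ^ k / (1 - x)"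
        using xk assms by (intro divide_left_mono) auto
      also have "1 + 2 * x ^ k / (1 - x) \<le> exp (2 * x ^ k / (1 - x))"
        by (rule exp_ge_add_one_self)
      finally show "0 \<le> (1 + x ^ k) / (1 - x ^ k) \<and> (1 + x ^ k) / (1 - x ^ k) \<le> exp (2 / (1 - x) * x ^ k)"
        using xk assms by (auto intro!: divide_nonneg_nonneg)
    qed
    also have "\<dots> = exp (2 / (1 - x) * (\<Sum>k=1..N. x ^ k))"
      by (simp add: exp_sum sum_distrib_left)
    also have "\<dots> \<le> C"
    proof -
      have "(\<Sum>k=1..N. x ^ k) \<le> (\<Sum>k<Suc N. x ^ k)"
        using assms by (intro sum_mono2) auto
      also have "(\<Sum>k<Suc N. x ^ k) = (1 - x ^ Suc N) / (1 - x)"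
        using assms by (subst geometric_sum) (auto simp: field_simps)
      also have "\<dots> \<le> 1 / (1 - x)"
        using assms by (intro divide_right_mono) auto
      finally show ?thesis
        unfolding C_def using assms by (intro exp_le_cancel_iff[THEN iffD2] mult_left_mono) auto
    qed
    finally show ?thesis .
  qed
  show ?thesis
    using assms bound by (intro summableI_nonneg_bounded[of _ C]) auto
qed

section \<open>Dissections of formal theta series\<close>

text \<open>
Ramanujan's \<open>\<psi>(q) = \<Sum> q^(k(k+1)/2)\<close>, summed over \<open>k \<ge> 0\<close>.
\<close>

definition psi :: "int fps" where
  "psi = Abs_fps (\<lambda>n. if \<exists>k. 2 * n = k * (k + 1) then 1 else 0)"

abbreviation dil :: "nat \<Rightarrow> int fps \<Rightarrow> int fps" where
  "dil k f \<equiv> f oo (fps_X ^ k)"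

lemma dil_mult: "k > 0 \<Longrightarrow> dil k (f * g) = dil k f * dil k g"
  by (intro fps_compose_mult_distrib) simp

lemma dil_power: "k > 0 \<Longrightarrow> dil k (f ^ n) = dil k f ^ n"
  by (induction n) (simp_all add: dil_mult)

lemma dil_dil: "j > 0 \<Longrightarrow> k > 0 \<Longrightarrow> dil j (dil k f) = dil (j * k) f"
  by (rule fps_ext) (auto simp: fps_nth_compose_X_power dvd_div_iff_mult div_mult2_eq
      intro: dvd_mult_left dvd_mult_right)

lemma dil_inject: "k > 0 \<Longrightarrow> dil k f = dil k g \<Longrightarrow> f = g"
proof (rule fps_ext)
  fix n assume k: "k > 0" and eq: "dil k f = dil k g"
  have "dil k f $ (k * n) = dil k g $ (k * n)" using eq by simp
  then show "f $ n = g $ n" using k by (simp add: fps_nth_compose_X_power)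
qed

definition even_fps :: "int fps \<Rightarrow> bool" where "even_fps f \<longleftrightarrow> (\<forall>n. odd n \<longrightarrow> f $ n = 0)"
definition odd_fps :: "int fps \<Rightarrow> bool" where "odd_fps f \<longleftrightarrow> (\<forall>n. even n \<longrightarrow> f $ n = 0)"

lemma even_fps_dil: "even k \<Longrightarrow> even_fps (dil k f)"
  by (auto simp: even_fps_def fps_nth_compose_X_power)

lemma even_fps_mult: "even_fps f \<Longrightarrow> even_fps g \<Longrightarrow> even_fps (f * g)"
  unfolding even_fps_def fps_mult_nth
proof (intro allI impI sum.neutral ballI)
  fix n i :: nat assume a: "\<forall>n. odd n \<longrightarrow> f $ n = 0" "\<forall>n. odd n \<longrightarrow> g $ n = 0" "odd n" "i \<in> {0..n}"
  have le: "i \<le> n" using a(4) by simp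
  have "odd i \<or> odd (n - i)" using a(3) le by (metis even_add le_add_diff_inverse)
  then show "f $ i * g $ (n - i) = 0" using a(1,2) by (metis mult_zero_left mult_zero_right)
qed

lemma odd_fps_mult: "odd_fps f \<Longrightarrow> even_fps g \<Longrightarrow> odd_fps (f * g)"
  unfolding even_fps_def odd_fps_def fps_mult_nth
proof (intro allI impI sum.neutral ballI)
  fix n i :: nat assume a: "\<forall>n. even n \<longrightarrow> f $ n = 0" "\<forall>n. odd n \<longrightarrow> g $ n = 0" "even n" "i \<in> {0..n}"
  have le: "i \<le> n" using a(4) by simp
  have "even i \<or> odd (n - i)" using a(3) le by (metis even_add le_add_diff_inverse)
  then show "f $ i * g $ (n - i) = 0" using a(1,2) by (metis mult_zero_left mult_zero_right)
qed

lemma odd_fps_X_mult: "even_fps f \<Longrightarrow> odd_fps (fps_X * f)"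
  by (auto simp: even_fps_def odd_fps_def)

lemma even_odd_unique:
  assumes "even_fps a" "even_fps b" "odd_fps c" "odd_fps d" "a + c = b + d"
  shows "a = b" "c = d"
proof -
  have "a $ n + c $ n = b $ n + d $ n" for n using assms(5) by (metis fps_add_nth)
  then have *: "a $ n = b $ n \<and> c $ n = d $ n" for n
    using assms(1-4) unfolding even_fps_def odd_fps_def
    by (cases "even n") (metis add_0_left add_0_right)+
  then show "a = b" "c = d" by (auto intro: fps_ext)
qed

text \<open>
The generating function of the values of \<open>u\<close>. A product of two such series counts pairs, which turns identities
between theta series into bijections between sets of integer pairs.
\<close>

definition rep_fps :: "(int \<Rightarrow> nat) \<Rightarrow> int fps" where
  "rep_fps u = Abs_fps (\<lambda>n. int (card {a. u a = n}))"

lemma rep_fps_mult_nth: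
  assumes "\<And>n. finite {a. u a = n}" "\<And>n. finite {b. w b = n}"
  shows "(rep_fps u * rep_fps w) $ n = int (card {(a, b). u a + w b = n})"
proof -
  have eq: "{(a, b). u a + w b = n} = (\<Union>k\<in>{0..n}. {a. u a = k} \<times> {b. w b = n - k})"
    by auto
  have "card {(a, b). u a + w b = n} = (\<Sum>k=0..n. card ({a. u a = k} \<times> {b. w b = n - k}))"
    unfolding eq using assms by (intro card_UN_disjoint) auto
  then show ?thesis by (simp add: fps_mult_nth rep_fps_def card_cartesian_product)
qed

lemma dil_rep_fps: "k > 0 \<Longrightarrow> dil k (rep_fps u) = rep_fps (\<lambda>a. k * u a)"
proof (rule fps_ext)
  fix n assume k: "k > 0"
  have "{a. k * u a = n} = (if k dvd n then {a. u a = n div k} else {})"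
    using k by auto
  then show "dil k (rep_fps u) $ n = rep_fps (\<lambda>a. k * u a) $ n"
    by (simp add: fps_nth_compose_X_power rep_fps_def)
qed

lemma square_fibre:
  "{a::int. nat (a\<^sup>2) = k\<^sup>2} = {int k, - int k}"
  "\<nexists>k. n = k\<^sup>2 \<Longrightarrow> {a::int. nat (a\<^sup>2) = n} = {}"
proof -
  have "nat (a\<^sup>2) = k\<^sup>2 \<longleftrightarrow> a\<^sup>2 = (int k)\<^sup>2" for a
    by (metis int_nat_eq of_nat_eq_iff of_nat_power zero_le_power2)
  then show "{a::int. nat (a\<^sup>2) = k\<^sup>2} = {int k, - int k}" by (auto simp: power2_eq_iff)
  have "nat (a\<^sup>2) = (nat \<bar>a\<bar>)\<^sup>2" for a :: int by (simp add: nat_power_eq[symmetric])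
  then show "\<nexists>k. n = k\<^sup>2 \<Longrightarrow> {a::int. nat (a\<^sup>2) = n} = {}" by auto
qed

lemma finite_square_fibre: "finite {a::int. nat (a\<^sup>2) = n}"
  using square_fibre by (cases "\<exists>k. n = k\<^sup>2") auto

lemma phi_eq_rep: "phi = rep_fps (\<lambda>a. nat (a\<^sup>2))"
proof (rule fps_ext)
  fix n
  show "phi $ n = rep_fps (\<lambda>a. nat (a\<^sup>2)) $ n"
  proof (cases "\<exists>k. n = k\<^sup>2")
    case True
    then obtain k where k: "n = k\<^sup>2" by auto
    show ?thesis unfolding k
      by (cases "k = 0") (auto simp: phi_def rep_fps_def square_fibre(1) card_insert_if)
  next
    case False
    then have "n \<noteq> 0" by (metis zero_power2)
    then show ?thesis using False by (simp add: phi_def rep_fps_def square_fibre(2))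
  qed
qed

text \<open>
Summing over all integers instead of \<open>k \<ge> 0\<close> doubles \<open>\<psi>\<close>, since \<open>a \<mapsto> -1 - a\<close> preserves
\<open>a (a + 1)\<close>. With exponents \<open>2 a (a + 1) = 4 (a (a + 1) / 2)\<close> this is the form that appears in sums of two squares.
\<close>

lemma double_psi_eq_rep: "2 * dil 4 psi = rep_fps (\<lambda>a. nat (2 * a * (a + 1)))"
  and finite_pronic_fibre: "finite {a::int. nat (2 * a * (a + 1)) = n}"
proof -
  have nonneg: "0 \<le> 2 * a * (a + 1)" for a :: int
    by (cases "a \<ge> 0") (auto intro: mult_nonpos_nonpos)
  have fibre: "{a::int. nat (2 * a * (a + 1)) = n} = {int k, - 1 - int k}"
    if "n = 2 * (k * (k + 1))" for n k
  proof -
    have "nat (2 * a * (a + 1)) = n \<longleftrightarrow> a = int k \<or> a = - 1 - int k" for a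
    proof -
      have "nat (2 * a * (a + 1)) = n \<longleftrightarrow> 2 * a * (a + 1) = 2 * (int k * (int k + 1))"
      proof -
        have "int n = 2 * (int k * (int k + 1))" unfolding that by (simp add: algebra_simps)
        then show ?thesis using nonneg[of a] by linarith
      qed
      also have "2 * a * (a + 1) - 2 * (int k * (int k + 1)) = 2 * ((a - int k) * (a + 1 + int k))"
        by (simp add: algebra_simps)
      then have "2 * a * (a + 1) = 2 * (int k * (int k + 1)) \<longleftrightarrow> (a - int k) * (a + 1 + int k) = 0"
        by linarith
      finally show ?thesis by auto
    qed
    then show ?thesis by auto
  qed
  have empty: "{a::int. nat (2 * a * (a + 1)) = n} = {}" if "\<nexists>k. n = 2 * (k * (k + 1))" for n
  proof -
    have "nat (2 * a * (a + 1)) \<noteq> n" for a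
    proof
      assume a: "nat (2 * a * (a + 1)) = n"
      show False
      proof (cases "a \<ge> 0")
        case True
        then have "n = 2 * (nat a * (nat a + 1))" using a by (simp flip: a add: nat_mult_distrib nat_add_distrib)
        then show False using that by blast
      next
        case False
        define b where "b = nat (- 1 - a)"
        have "a = - 1 - int b" using False by (simp add: b_def)
        then have "2 * a * (a + 1) = int (2 * (b * (b + 1)))"
          by (simp only:) (simp add: algebra_simps)
        then have "n = 2 * (b * (b + 1))" using a by linarith
        then show False using that by blast
      qed
    qed
    then show ?thesis by auto
  qed
  show "finite {a::int. nat (2 * a * (a + 1)) = n}"
    using fibre[of n] empty[of n] by (cases "\<exists>k. n = 2 * (k * (k + 1))") auto
  show "2 * dil 4 psi = rep_fps (\<lambda>a. nat (2 * a * (a + 1)))"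
  proof (rule fps_ext)
    fix n
    have l: "(2 * dil 4 psi) $ n = 2 * (dil 4 psi $ n)"
      by (metis fps_mult_left_const_nth fps_numeral_fps_const)
    show "(2 * dil 4 psi) $ n = rep_fps (\<lambda>a. nat (2 * a * (a + 1))) $ n"
    proof (cases "\<exists>k. n = 2 * (k * (k + 1))")
      case True
      then obtain k where k: "n = 2 * (k * (k + 1))" by auto
      have "even (k * (k + 1))" by simp
      then obtain t where t: "k * (k + 1) = 2 * t" by blast
      have n4: "n = 4 * t" using k t by simp
      have "dil 4 psi $ n = 1" using t[symmetric] by (auto simp: n4 fps_nth_compose_X_power psi_def)
      then show ?thesis using l fibre[OF k] by (simp add: rep_fps_def card_insert_if)
    next
      case False
      have "dil 4 psi $ n = 0"
      proof (cases "4 dvd n")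
        case True
        then obtain r where r: "n = 4 * r" by blast
        have "2 * (n div 4) \<noteq> k * (k + 1)" for k
        proof
          assume "2 * (n div 4) = k * (k + 1)"
          then have "n = 2 * (k * (k + 1))" using r by simp
          then show False using False by blast
        qed
        then show ?thesis by (simp add: fps_nth_compose_X_power psi_def)
      qed (simp add: fps_nth_compose_X_power)
      then show ?thesis using l empty[OF False] by (simp add: rep_fps_def)
    qed
  qed
qed

text \<open>
Split the pairs \<open>(x, y)\<close> with \<open>x^2 + y^2 = n\<close> by the parity of \<open>x + y\<close>. Even ones are
\<open>(a + b, a - b)\<close>, with \<open>n = 2 a^2 + 2 b^2\<close>; odd ones are \<open>(a + b + 1, a - b)\<close>, with
\<open>n - 1 = 2 a (a + 1) + 2 b (b + 1)\<close>.
\<close>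

lemma two_squares_parity:
  "int (card {(a::int, b::int). nat (a\<^sup>2) + nat (b\<^sup>2) = n}) =
   int (card {(a::int, b::int). 2 * nat (a\<^sup>2) + 2 * nat (b\<^sup>2) = n}) +
   (if n = 0 then 0 else int (card {(a::int, b::int). nat (2 * a * (a + 1)) + nat (2 * b * (b + 1)) = n - 1}))"
proof -
  define S where "S = {(a::int, b::int). nat (a\<^sup>2) + nat (b\<^sup>2) = n}"
  have S: "S = {(a, b). a\<^sup>2 + b\<^sup>2 = int n}"
    unfolding S_def by (auto simp flip: nat_add_distrib simp: nat_eq_iff)
  have nonneg: "0 \<le> 2 * a * (a + 1)" for a :: int
    by (cases "a \<ge> 0") (auto intro: mult_nonpos_nonpos)
  define S0 where "S0 = {(a, b) \<in> S. even (a + b)}"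
  define S1 where "S1 = {(a, b) \<in> S. odd (a + b)}"
  define T0 where "T0 = {(a::int, b::int). 2 * nat (a\<^sup>2) + 2 * nat (b\<^sup>2) = n}"
  define T1 where "T1 = {(a::int, b::int). 2 * a * (a + 1) + 2 * b * (b + 1) = int n - 1}"
  have T0: "T0 = {(a, b). 2 * a\<^sup>2 + 2 * b\<^sup>2 = int n}"
  proof -
    have "2 * nat (a\<^sup>2) + 2 * nat (b\<^sup>2) = n \<longleftrightarrow> 2 * a\<^sup>2 + 2 * b\<^sup>2 = int n" for a b :: int
      using zero_le_power2[of a] zero_le_power2[of b] by linarith
    then show ?thesis unfolding T0_def by auto
  qed
  have fin: "finite S"
  proof (rule finite_subset)
    have "\<bar>x\<bar> \<le> x\<^sup>2" for x :: int
      by (metis abs_le_square_iff abs_power2 self_le_ge2_pow abs_ge_zero order_refl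
            int_one_le_iff_zero_less mult_left_le_one_le nat_le_linear not_less power2_abs
            power2_eq_square zero_less_abs_iff mult_le_cancel_left1 abs_not_less_zero)
    then show "S \<subseteq> {- int n..int n} \<times> {- int n..int n}"
      unfolding S by (smt (verit) SigmaI atLeastAtMost_iff mem_Collect_eq split_cong subrelI case_prodE zero_le_power2)
  qed auto
  have b0: "bij_betw (\<lambda>(a, b). (a + b, a - b)) T0 S0"
  proof (rule bij_betw_byWitness[where f' = "\<lambda>(a, b). ((a + b) div 2, (a - b) div 2)"])
    show "(\<lambda>(a, b). (a + b, a - b)) ` T0 \<subseteq> S0"
      unfolding T0 S0_def S by (auto simp: power2_eq_square algebra_simps)
    show "(\<lambda>(a, b). ((a + b) div 2, (a - b) div 2)) ` S0 \<subseteq> T0"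
    proof clarify
      fix a b assume "(a, b) \<in> S0"
      then have ab: "a\<^sup>2 + b\<^sup>2 = int n" "even (a + b)" unfolding S0_def S by auto
      obtain x where x: "a + b = 2 * x" using ab(2) by blast
      have e: "a - b = 2 * (x - b)" "a = 2 * x - b" using x by simp_all
      show "((a + b) div 2, (a - b) div 2) \<in> T0"
        using ab(1) unfolding T0 x e(1) unfolding e(2) by (simp add: power2_eq_square algebra_simps)
    qed
    show "\<forall>p\<in>S0. (\<lambda>(a, b). (a + b, a - b)) ((\<lambda>(a, b). ((a + b) div 2, (a - b) div 2)) p) = p"
      unfolding S0_def by (auto, presburger+)
  qed auto
  have b1: "bij_betw (\<lambda>(a, b). (a + b + 1, a - b)) T1 S1"
  proof (rule bij_betw_byWitness[where f' = "\<lambda>(a, b). ((a + b - 1) div 2, (a - b - 1) div 2)"])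
    show "(\<lambda>(a, b). (a + b + 1, a - b)) ` T1 \<subseteq> S1"
      unfolding T1_def S1_def S by (auto simp: power2_eq_square algebra_simps)
    show "(\<lambda>(a, b). ((a + b - 1) div 2, (a - b - 1) div 2)) ` S1 \<subseteq> T1"
    proof clarify
      fix a b assume "(a, b) \<in> S1"
      then have ab: "a\<^sup>2 + b\<^sup>2 = int n" "odd (a + b)" unfolding S1_def S by auto
      obtain x where x: "a + b = 2 * x + 1" using ab(2) by (metis oddE)
      have e: "a + b - 1 = 2 * x" "a - b - 1 = 2 * (x - b)" "a = 2 * x + 1 - b" using x by simp_all
      show "((a + b - 1) div 2, (a - b - 1) div 2) \<in> T1"
        using ab(1) unfolding T1_def e(1,2) unfolding e(3) by (simp add: power2_eq_square algebra_simps)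
    qed
    show "\<forall>p\<in>S1. (\<lambda>(a, b). (a + b + 1, a - b)) ((\<lambda>(a, b). ((a + b - 1) div 2, (a - b - 1) div 2)) p) = p"
      unfolding S1_def by (auto, presburger+)
  qed auto
  have "S = S0 \<union> S1" "S0 \<inter> S1 = {}" unfolding S0_def S1_def by auto
  then have "card S = card S0 + card S1"
    using fin by (metis card_Un_disjoint finite_Un)
  also have "card S0 = card T0" by (rule bij_betw_same_card[OF b0, symmetric])
  also have "card S1 = card T1" by (rule bij_betw_same_card[OF b1, symmetric])
  also have "int (card T0 + card T1) = int (card T0) +
     (if n = 0 then 0 else int (card {(a::int, b::int). nat (2 * a * (a + 1)) + nat (2 * b * (b + 1)) = n - 1}))"
  proof (cases "n = 0")
    case True
    have "T1 = {}" unfolding T1_def True using nonneg by (smt (verit) Collect_empty_eq case_prodE of_nat_0)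
    then show ?thesis using True by simp
  next
    case False
    have "nat (2 * a * (a + 1)) + nat (2 * b * (b + 1)) = n - 1 \<longleftrightarrow>
          2 * a * (a + 1) + 2 * b * (b + 1) = int n - 1" for a b
      using nonneg[of a] nonneg[of b] False by linarith
    then show ?thesis using False unfolding T1_def by simp
  qed
  finally show ?thesis unfolding S_def T0_def .
qed

lemma phi_square: "phi ^ 2 = dil 2 phi ^ 2 + 4 * (fps_X * dil 4 psi ^ 2)"
proof -
  define u where "u = (\<lambda>a::int. nat (a\<^sup>2))"
  define w where "w = (\<lambda>a::int. nat (2 * a * (a + 1)))"
  have fin: "finite {a. u a = n}" "finite {a. w a = n}" "finite {a. 2 * u a = n}" for n
  proof -
    show "finite {a. u a = n}" "finite {a. w a = n}"
      unfolding u_def w_def by (rule finite_square_fibre finite_pronic_fibre)+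
    show "finite {a. 2 * u a = n}"
      by (rule finite_subset[OF _ finite_square_fibre[of "n div 2"]]) (auto simp: u_def)
  qed
  have "rep_fps u * rep_fps u = rep_fps (\<lambda>a. 2 * u a) * rep_fps (\<lambda>a. 2 * u a)
          + fps_X * (rep_fps w * rep_fps w)"
    by (rule fps_ext)
       (use two_squares_parity fin in \<open>simp add: rep_fps_mult_nth u_def w_def fps_X_mult_nth\<close>)
  moreover have "phi = rep_fps u" "2 * dil 4 psi = rep_fps w"
    unfolding u_def w_def by (rule phi_eq_rep double_psi_eq_rep)+
  moreover have "dil 2 phi = rep_fps (\<lambda>a. 2 * u a)"
    unfolding \<open>phi = _\<close> by (rule dil_rep_fps) simp
  ultimately have "phi * phi = dil 2 phi * dil 2 phi + fps_X * ((2 * dil 4 psi) * (2 * dil 4 psi))"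
    by simp
  then show ?thesis by (simp add: power2_eq_square mult_ac)
qed

text \<open>
Even squares are \<open>4 k^2\<close> and odd squares are \<open>8 (k (k + 1) / 2) + 1\<close>.
\<close>

lemma phi_dissection: "phi = dil 4 phi + 2 * (fps_X * dil 8 psi)"
proof (rule fps_ext)
  fix n
  have l: "(2 * (fps_X * dil 8 psi)) $ n = 2 * (fps_X * dil 8 psi) $ n"
    by (metis fps_mult_left_const_nth fps_numeral_fps_const)
  show "phi $ n = (dil 4 phi + 2 * (fps_X * dil 8 psi)) $ n"
  proof (cases "even n")
    case True
    have "(fps_X * dil 8 psi) $ n = 0"
      using True by (auto simp: fps_X_mult_nth fps_nth_compose_X_power dest: dvd_trans[of 2 8, rotated])
    moreover have "phi $ n = dil 4 phi $ n"
    proof (cases "4 dvd n")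
      case 4: True
      then obtain m where m: "n = 4 * m" by blast
      have "(\<exists>k. n = k\<^sup>2) \<longleftrightarrow> (\<exists>k. m = k\<^sup>2)"
      proof
        assume "\<exists>k. n = k\<^sup>2"
        then obtain k where k: "n = k\<^sup>2" by auto
        then have "even k" using True by simp
        then obtain t where "k = 2 * t" by blast
        then show "\<exists>k. m = k\<^sup>2" using k m by (auto simp: power_mult_distrib)
      next
        assume "\<exists>k. m = k\<^sup>2"
        then obtain k where "m = k\<^sup>2" by auto
        then have "n = (2 * k)\<^sup>2" using m by (simp add: power_mult_distrib)
        then show "\<exists>k. n = k\<^sup>2" by blast
      qed
      then show ?thesis using m by (simp add: fps_nth_compose_X_power phi_def)
    next
      case False
      have "n \<noteq> k\<^sup>2" for k
      proof
        assume k: "n = k\<^sup>2"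
        then have "even k" using True by simp
        then show False using False k by (auto simp: power2_eq_square elim!: evenE)
      qed
      moreover have "n \<noteq> 0" using False by (metis dvd_0_right)
      ultimately show ?thesis using False by (simp add: fps_nth_compose_X_power phi_def)
    qed
    ultimately show ?thesis using l by simp
  next
    case False
    then obtain m where m: "n = 2 * m + 1" by (metis oddE)
    have "dil 4 phi $ n = 0" using False by (auto simp: fps_nth_compose_X_power dest: dvd_trans[of 2 4, rotated])
    moreover have "(\<exists>k. n = k\<^sup>2) \<longleftrightarrow> (\<exists>k. m = 2 * (k * (k + 1)))"
    proof
      assume "\<exists>k. n = k\<^sup>2"
      then obtain k where k: "n = k\<^sup>2" by auto
      then have "odd k" using False by simp
      then obtain t where "k = 2 * t + 1" by (metis oddE)
      then have "m = 2 * (t * (t + 1))" using k m by (simp add: power2_eq_square)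
      then show "\<exists>k. m = 2 * (k * (k + 1))" by blast
    next
      assume "\<exists>k. m = 2 * (k * (k + 1))"
      then obtain k where "m = 2 * (k * (k + 1))" by auto
      then have "n = (2 * k + 1)\<^sup>2" using m by (simp add: power2_eq_square)
      then show "\<exists>k. n = k\<^sup>2" by blast
    qed
    moreover have "dil 8 psi $ (2 * m) = (if \<exists>k. m = 2 * (k * (k + 1)) then 1 else 0)"
    proof (cases "4 dvd m")
      case True
      then obtain r where r: "m = 4 * r" by blast
      have "(2 * r = k * (k + 1)) \<longleftrightarrow> (m = 2 * (k * (k + 1)))" for k using r by auto
      then show ?thesis using r by (simp add: fps_nth_compose_X_power psi_def)
    next
      case False
      have "m \<noteq> 2 * (k * (k + 1))" for k
      proof
        assume "m = 2 * (k * (k + 1))"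
        moreover have "even (k * (k + 1))" by simp
        ultimately show False using False by (metis mult_dvd_mono dvd_refl mult_2 numeral_Bit0)
      qed
      moreover have "\<not> 8 dvd 2 * m" using False by presburger
      ultimately show ?thesis by (simp add: fps_nth_compose_X_power)
    qed
    ultimately show ?thesis using l m by (auto simp: phi_def)
  qed
qed

lemma even_fps_dil_power: "even k \<Longrightarrow> k > 0 \<Longrightarrow> even_fps (dil k f ^ n)"
  unfolding dil_power[symmetric] by (rule even_fps_dil)

text \<open>
Insert the dissection \<open>\<phi> = A + 2 \<beta>\<close>, with \<open>A\<close> even and \<open>\<beta>\<close> odd, into the formula for
\<open>\<phi>^2\<close> and compare even and odd parts.
\<close>

lemma phi_square_even_odd:
  defines "A \<equiv> dil 4 phi" and "\<beta> \<equiv> fps_X * dil 8 psi"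
  shows "A\<^sup>2 + 4 * \<beta>\<^sup>2 = dil 2 phi ^ 2" and "A * \<beta> = fps_X * dil 4 psi ^ 2"
proof -
  have A: "even_fps (A ^ 2)"
    unfolding A_def by (rule even_fps_dil_power) simp_all
  have "\<beta>\<^sup>2 = fps_X ^ 2 * dil 8 psi ^ 2" by (simp add: \<beta>_def power_mult_distrib)
  also have "\<dots> = dil 2 (fps_X * dil 4 psi ^ 2)"
    by (simp add: dil_mult dil_power dil_dil)
  finally have B: "even_fps (\<beta>\<^sup>2)" using even_fps_dil by simp
  have four: "even_fps (4 * f)" if "even_fps f" for f
    using that unfolding even_fps_def by (metis fps_mult_left_const_nth fps_numeral_fps_const mult_zero_right)
  have four': "odd_fps (4 * f)" if "odd_fps f" for f
    using that unfolding odd_fps_def by (metis fps_mult_left_const_nth fps_numeral_fps_const mult_zero_right)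
  have "even_fps (dil 8 psi * A)" unfolding A_def by (intro even_fps_mult even_fps_dil) auto
  then have AB: "odd_fps (A * \<beta>)"
    using odd_fps_X_mult[of "dil 8 psi * A"] by (simp add: \<beta>_def mult_ac)
  have C: "even_fps (dil 2 phi ^ 2)"
    by (rule even_fps_dil_power) simp_all
  have "even_fps (dil 4 psi ^ 2)"
    by (rule even_fps_dil_power) simp_all
  then have K: "odd_fps (fps_X * dil 4 psi ^ 2)" by (rule odd_fps_X_mult)
  have "(A + 2 * \<beta>)\<^sup>2 = dil 2 phi ^ 2 + 4 * (fps_X * dil 4 psi ^ 2)"
    using phi_square phi_dissection by (simp add: A_def \<beta>_def)
  moreover have "(A + 2 * \<beta>)\<^sup>2 = (A\<^sup>2 + 4 * \<beta>\<^sup>2) + 4 * (A * \<beta>)"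
    by (simp add: power2_eq_square algebra_simps)
  ultimately have eq: "(A\<^sup>2 + 4 * \<beta>\<^sup>2) + 4 * (A * \<beta>) = dil 2 phi ^ 2 + 4 * (fps_X * dil 4 psi ^ 2)" by simp
  have ev: "even_fps (A\<^sup>2 + 4 * \<beta>\<^sup>2)"
    using A four[OF B] by (simp add: even_fps_def)
  note * = even_odd_unique[OF ev C four'[OF AB] four'[OF K] eq]
  show "A\<^sup>2 + 4 * \<beta>\<^sup>2 = dil 2 phi ^ 2" by (rule *(1))
  show "A * \<beta> = fps_X * dil 4 psi ^ 2" using *(2) by simp
qed

lemma psi_square: "psi ^ 2 = phi * dil 2 psi"
proof -
  have "fps_X * dil 4 (psi ^ 2) = fps_X * dil 4 (phi * dil 2 psi)"
    using phi_square_even_odd(2) by (simp add: dil_mult dil_power dil_dil mult_ac)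
  then have "dil 4 (psi ^ 2) = dil 4 (phi * dil 2 psi)"
    by (metis fps_X_neq_zero mult_cancel_left)
  then show ?thesis by (rule dil_inject[rotated]) simp
qed

definition neg_fps :: "int fps \<Rightarrow> int fps" where "neg_fps f = f oo (- fps_X)"

lemma neg_fps_nth: "neg_fps f $ n = (-1) ^ n * f $ n"
  by (simp add: neg_fps_def fps_compose_uminus')

lemma neg_fps_mult: "neg_fps (f * g) = neg_fps f * neg_fps g"
  unfolding neg_fps_def by (rule fps_compose_mult_distrib) simp

lemma neg_fps_even: "even_fps f \<Longrightarrow> neg_fps f = f"
  by (rule fps_ext) (auto simp: neg_fps_nth even_fps_def minus_one_power_iff)

lemma neg_fps_odd: "odd_fps f \<Longrightarrow> neg_fps f = - f"
  by (rule fps_ext) (auto simp: neg_fps_nth odd_fps_def minus_one_power_iff)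

lemma neg_fps_add: "neg_fps (f + g) = neg_fps f + neg_fps g"
  by (rule fps_ext) (simp add: neg_fps_nth algebra_simps)

lemma phim_eq: "phim = neg_fps phi"
  by (rule fps_ext) (simp add: neg_fps_nth phim_def)

lemma phim_dissection: "phim = dil 4 phi - 2 * (fps_X * dil 8 psi)"
proof -
  have "neg_fps (2 * (fps_X * dil 8 psi)) = - (2 * (fps_X * dil 8 psi))"
  proof (rule neg_fps_odd)
    have "odd_fps (fps_X * dil 8 psi)" by (intro odd_fps_X_mult even_fps_dil) simp
    then show "odd_fps (2 * (fps_X * dil 8 psi))"
      unfolding odd_fps_def by (metis fps_mult_left_const_nth fps_numeral_fps_const mult_zero_right)
  qed
  then show ?thesis
    using neg_fps_even[OF even_fps_dil[of 4 phi]]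
    by (subst phim_eq, subst phi_dissection, subst neg_fps_add) simp
qed

text \<open>
With \<open>\<phi>(\<plusminus>q) = A \<plusminus> 2 \<beta>\<close> the product is a difference of two squares.
\<close>

lemma phi_mult_phim: "phi * phim = dil 2 phim ^ 2"
proof -
  define A where "A = dil 4 phi"
  define \<beta> where "\<beta> = fps_X * dil 8 psi"
  have "phi * phim = A\<^sup>2 - 4 * \<beta>\<^sup>2"
    by (subst phi_dissection, subst phim_dissection)
      (simp add: A_def \<beta>_def power2_eq_square algebra_simps)
  also have "\<dots> = dil 2 (phim ^ 2)"
  proof -
    have e: "even_fps (dil 2 phi ^ 2)"
      by (rule even_fps_dil_power) simp_all
    have "even_fps (dil 4 psi ^ 2)"
      by (rule even_fps_dil_power) simp_all
    then have o: "odd_fps (4 * (fps_X * dil 4 psi ^ 2))"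
      using odd_fps_X_mult unfolding odd_fps_def
      by (metis fps_mult_left_const_nth fps_numeral_fps_const mult_zero_right)
    have "phim ^ 2 = neg_fps (phi ^ 2)" by (simp add: phim_eq neg_fps_mult power2_eq_square)
    also have "\<dots> = dil 2 phi ^ 2 - 4 * (fps_X * dil 4 psi ^ 2)"
      unfolding phi_square neg_fps_add neg_fps_even[OF e] neg_fps_odd[OF o] by simp
    finally have *: "phim ^ 2 = dil 2 phi ^ 2 - 4 * (fps_X * dil 4 psi ^ 2)" .
    have "dil 2 (phim ^ 2) = A\<^sup>2 - 4 * (fps_X ^ 2 * dil 8 psi ^ 2)"
      unfolding * by (simp add: fps_compose_sub_distrib dil_mult dil_power dil_dil A_def)
    then show ?thesis by (simp add: \<beta>_def power_mult_distrib)
  qed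
  finally show ?thesis by (simp add: dil_power)
qed

text \<open>
This moves the denominator of \<open>F = 1 / \<phi>(-q)\<close> to \<open>q^2\<close>, where \<open>U\<^sub>2\<close> passes through it and only
removes the dilation.
\<close>

lemma pbar_fps_dissection: "pbar_fps = phi * dil 2 pbar_fps ^ 2"
proof -
  have "dil 2 (pbar_fps * phim) = 1" unfolding pbar_fps_mult_phim by simp
  then have "dil 2 pbar_fps * dil 2 phim = 1" by (simp add: dil_mult)
  then have "dil 2 pbar_fps ^ 2 * dil 2 phim ^ 2 = 1" by (metis power_mult_distrib power_one)
  then have inv: "(phi * dil 2 pbar_fps ^ 2) * phim = 1"
    by (simp only: phi_mult_phim[symmetric] mult_ac)
  have "pbar_fps = pbar_fps * ((phi * dil 2 pbar_fps ^ 2) * phim)" unfolding inv by simp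
  also have "\<dots> = (phi * dil 2 pbar_fps ^ 2) * (pbar_fps * phim)" by (simp only: mult_ac)
  finally show ?thesis unfolding pbar_fps_mult_phim by simp
qed

text \<open>
The series \<open>\<theta>\<^sub>2^4 / 16\<close>, where \<open>\<theta>\<^sub>2 = 2 q^(1/4) \<psi>(q^2)\<close>.
\<close>

definition theta2_fourth :: "int fps" where "theta2_fourth = fps_X * dil 2 psi ^ 4"
text \<open>
The series \<open>\<theta>\<^sub>2(q^2)^2 / 4\<close>.
\<close>

definition theta2_square :: "int fps" where "theta2_square = fps_X * dil 4 psi ^ 2"

lemma theta2_square_eq: "theta2_square = dil 4 phi * (fps_X * dil 8 psi)"
  by (simp add: theta2_square_def phi_square_even_odd(2))

lemma theta2_fourth_eq: "theta2_fourth = theta2_square * ((dil 4 phi)\<^sup>2 + 4 * (fps_X * dil 8 psi)\<^sup>2)"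
proof -
  have "dil 2 (psi ^ 2) = dil 2 (phi * dil 2 psi)"
    by (simp only: psi_square)
  then have "dil 2 psi ^ 2 = dil 2 phi * dil 4 psi"
    by (simp add: dil_power dil_mult dil_dil)
  moreover have "dil 2 psi ^ 4 = (dil 2 psi ^ 2) ^ 2"
    by (simp flip: power_mult)
  ultimately have "dil 2 psi ^ 4 = (dil 2 phi * dil 4 psi) ^ 2" by simp
  then show ?thesis
    unfolding theta2_fourth_def theta2_square_def phi_square_even_odd(1) by (simp add: power_mult_distrib mult_ac)
qed

section \<open>Division by 2 under the operator \<open>U\<^sub>2\<close>\<close>

definition U2 :: "int fps \<Rightarrow> int fps" where "U2 f = Abs_fps (\<lambda>n. f $ (2 * n))"

lemma U2_nth: "U2 f $ n = f $ (2 * n)" by (simp add: U2_def)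

lemma U2_iter_nth: "(U2 ^^ a) f $ n = f $ (2 ^ a * n)"
  by (induction a arbitrary: n) (simp_all add: U2_nth mult_ac)

lemma U2_mult_dil: "U2 (f * dil 2 g) = U2 f * g"
proof (rule fps_ext)
  fix n
  have "U2 (f * dil 2 g) $ n = (\<Sum>i=0..2 * n. f $ i * dil 2 g $ (2 * n - i))"
    by (simp add: U2_nth fps_mult_nth)
  also have "\<dots> = (\<Sum>i\<in>(\<lambda>j. 2 * j) ` {0..n}. f $ i * dil 2 g $ (2 * n - i))"
  proof (rule sum.mono_neutral_right)
    show "\<forall>i\<in>{0..2 * n} - (\<lambda>j. 2 * j) ` {0..n}. f $ i * dil 2 g $ (2 * n - i) = 0"
    proof
      fix i assume i: "i \<in> {0..2 * n} - (\<lambda>j. 2 * j) ` {0..n}"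
      have "odd i" using i by (auto elim!: evenE)
      then have "\<not> 2 dvd (2 * n - i)" using i by auto
      then show "f $ i * dil 2 g $ (2 * n - i) = 0" by (simp add: fps_nth_compose_X_power)
    qed
  qed auto
  also have "\<dots> = (\<Sum>j=0..n. f $ (2 * j) * g $ (n - j))"
    by (subst sum.reindex) (auto simp: inj_on_def fps_nth_compose_X_power simp flip: diff_mult_distrib2)
  finally show "U2 (f * dil 2 g) $ n = (U2 f * g) $ n" by (simp add: fps_mult_nth U2_nth)
qed

lemma U2_odd: "odd_fps f \<Longrightarrow> U2 f = 0"
  by (rule fps_ext) (simp add: U2_nth odd_fps_def)

lemma U2_add: "U2 (f + g) = U2 f + U2 g"
  by (rule fps_ext) (simp add: U2_nth)

lemma two_power_fps: "(2 :: int fps) ^ n = fps_const (2 ^ n)"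
  by (metis fps_const_power fps_numeral_fps_const)

inductive_set zspan :: "int fps set \<Rightarrow> int fps set" for G where
  zspan_0: "0 \<in> zspan G"
| zspan_add: "x \<in> zspan G \<Longrightarrow> b \<in> G \<Longrightarrow> x + fps_const c * b \<in> zspan G"

lemma zspan_base: "b \<in> G \<Longrightarrow> b \<in> zspan G"
  using zspan_add[OF zspan_0, of b G 1] by simp

lemma zspan_plus: "x \<in> zspan G \<Longrightarrow> y \<in> zspan G \<Longrightarrow> x + y \<in> zspan G"
proof -
  assume x: "x \<in> zspan G" and y: "y \<in> zspan G"
  from y show "x + y \<in> zspan G"
    by induction (use x in \<open>auto simp: add.assoc[symmetric] intro: zspan_add\<close>)
qed

lemma zspan_scale: "x \<in> zspan G \<Longrightarrow> fps_const c * x \<in> zspan G"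
proof (induction x rule: zspan.induct)
  case (zspan_add x b d)
  then show ?case using zspan.zspan_add[of "fps_const c * x" G b "c * d"]
    by (simp add: algebra_simps flip: fps_const_mult)
qed (simp add: zspan_0)

lemma zspan_numeral_mult: "x \<in> zspan G \<Longrightarrow> numeral k * x \<in> zspan G"
  unfolding fps_numeral_fps_const by (rule zspan_scale)

lemma zspan_additive:
  assumes "x \<in> zspan G" "h 0 = 0" "\<And>x y. h (x + y) = h x + h y"
    "\<And>c x. h (fps_const c * x) = fps_const c * h x" "\<And>b. b \<in> G \<Longrightarrow> h b \<in> zspan H"
  shows "h x \<in> zspan H"
  using assms(1) by induction (auto simp: assms intro!: zspan_plus zspan_scale zspan_0)

lemma zspan_mult:
  assumes "x \<in> zspan G" "\<And>b. b \<in> G \<Longrightarrow> y * b \<in> zspan H"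
  shows "y * x \<in> zspan H"
  by (rule zspan_additive[OF assms(1)]) (use assms(2) in \<open>auto simp: algebra_simps\<close>)

text \<open>
\<open>E\<close> is meant to be an even series and \<open>Od\<close> an odd one. One factor 2 accompanies each odd factor except the first,
so the span is closed under multiplication by \<open>E\<close> and by \<open>2 Od\<close>, hence by \<open>\<phi>\<close> when \<open>\<phi> = E + 2 Od\<close>.
\<close>

definition weighted_monomials :: "int fps \<Rightarrow> int fps \<Rightarrow> int fps set" where
  "weighted_monomials E Od = {2 ^ (r - 1) * E ^ s * Od ^ r |r s. r \<ge> 1}"

lemma weighted_monomialsI:
  "1 \<le> r \<Longrightarrow> x = 2 ^ (r - 1) * E ^ s * Od ^ r \<Longrightarrow> x \<in> zspan (weighted_monomials E Od)"
  unfolding weighted_monomials_def by (intro zspan_base) blast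

lemma weighted_mult_even:
  assumes "x \<in> zspan (weighted_monomials E Od)"
  shows "E * x \<in> zspan (weighted_monomials E Od)"
proof (rule zspan_mult[OF assms])
  fix b assume "b \<in> weighted_monomials E Od"
  then obtain r s where "r \<ge> 1" "b = 2 ^ (r - 1) * E ^ s * Od ^ r" by (auto simp: weighted_monomials_def)
  then have "r \<ge> 1" "E * b = 2 ^ (r - 1) * E ^ (Suc s) * Od ^ r" by (simp_all add: mult_ac)
  then show "E * b \<in> zspan (weighted_monomials E Od)"
    by (rule weighted_monomialsI)
qed

lemma weighted_mult_odd:
  assumes "x \<in> zspan (weighted_monomials E Od)"
  shows "2 * Od * x \<in> zspan (weighted_monomials E Od)"
proof (rule zspan_mult[OF assms])
  fix b assume "b \<in> weighted_monomials E Od"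
  then obtain r s where r: "r \<ge> 1" "b = 2 ^ (r - 1) * E ^ s * Od ^ r" by (auto simp: weighted_monomials_def)
  then obtain q where "r = Suc q" by (cases r) auto
  then have "2 * Od * b = 2 ^ (Suc r - 1) * E ^ s * Od ^ (Suc r)" using r by (simp add: mult_ac)
  then show "2 * Od * b \<in> zspan (weighted_monomials E Od)"
    by (rule weighted_monomialsI[of "Suc r", rotated]) simp
qed

text \<open>
Only even powers \<open>Od^(2 i)\<close> contribute to even exponents, and \<open>Od^(2 i)\<close> becomes \<open>K^i\<close> under
\<open>U\<^sub>2\<close>. The weight \<open>2^(2 i - 1) = 2 \<sqdot> 2^(i - 1) \<sqdot> 2^(i - 1)\<close> supplies one factor 2, the new
weight \<open>2^(i - 1)\<close>, and a surplus.
\<close>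

lemma weighted_U2:
  assumes x: "x \<in> zspan (weighted_monomials (dil 2 E) Od)"
    and Od: "odd_fps Od" "Od\<^sup>2 = dil 2 K"
  shows "\<exists>y\<in>zspan {2 ^ (i - 1) * K ^ i * E ^ s * D |i s. i \<ge> 1}. U2 (x * dil 2 D) = 2 * y"
proof -
  let ?G = "{2 ^ (i - 1) * K ^ i * E ^ s * D |i s. i \<ge> 1}"
  have gen: "\<exists>y\<in>zspan ?G. U2 (b * dil 2 D) = 2 * y" if "b \<in> weighted_monomials (dil 2 E) Od" for b
  proof -
    obtain r s where r: "r \<ge> 1" "b = 2 ^ (r - 1) * dil 2 E ^ s * Od ^ r"
      using \<open>b \<in> _\<close> by (auto simp: weighted_monomials_def)
    note two = two_power_fps
    show ?thesis
    proof (cases "even r")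
      case True
      then obtain i where i: "r = 2 * i" by blast
      then have i1: "i \<ge> 1" using r by simp
      have "b * dil 2 D = 2 ^ (r - 1) * dil 2 (E ^ s * K ^ i * D)"
      proof -
        have "Od ^ r = dil 2 (K ^ i)" unfolding i power_mult Od(2) by (simp add: dil_power)
        then show ?thesis using r(2) by (simp add: dil_mult dil_power mult_ac)
      qed
      then have "U2 (b * dil 2 D) = 2 ^ (r - 1) * (E ^ s * K ^ i * D)"
        by (simp add: U2_mult_dil two, simp add: fps_eq_iff U2_nth)
      also have "r - 1 = Suc (i - 1 + (i - 1))" using i i1 by simp
      finally have "U2 (b * dil 2 D) = 2 * (fps_const (2 ^ (i - 1)) * (2 ^ (i - 1) * K ^ i * E ^ s * D))"
        by (simp add: power_add mult_ac flip: two)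
      moreover have "fps_const (2 ^ (i - 1)) * (2 ^ (i - 1) * K ^ i * E ^ s * D) \<in> zspan ?G"
        using i1 by (intro zspan_scale zspan_base) blast
      ultimately show ?thesis by blast
    next
      case False
      then obtain i where i: "r = 2 * i + 1" by (metis oddE)
      have "b * dil 2 D = 2 ^ (r - 1) * (Od * dil 2 (E ^ s * K ^ i * D))"
      proof -
        have "Od ^ r = Od * dil 2 (K ^ i)"
          unfolding i power_add power_mult Od(2) by (simp add: dil_power)
        then show ?thesis using r(2) by (simp add: dil_mult dil_power mult_ac)
      qed
      moreover have "odd_fps (2 ^ (r - 1) * (Od * dil 2 (E ^ s * K ^ i * D)))"
        using odd_fps_mult[OF Od(1) even_fps_dil[of 2 "E ^ s * K ^ i * D"]]
        by (simp add: two odd_fps_def)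
      ultimately have "U2 (b * dil 2 D) = 2 * 0" by (simp add: U2_odd)
      then show ?thesis using zspan_0 by blast
    qed
  qed
  show ?thesis using x
  proof induction
    case zspan_0
    then show ?case using zspan.zspan_0[of ?G] by (intro bexI[of _ 0]) (auto simp: fps_eq_iff U2_nth)
  next
    case (zspan_add x b c)
    obtain y where y: "y \<in> zspan ?G" "U2 (x * dil 2 D) = 2 * y" using zspan_add by blast
    obtain z where z: "z \<in> zspan ?G" "U2 (b * dil 2 D) = 2 * z" using gen zspan_add by blast
    have "U2 (fps_const c * (b * dil 2 D)) = fps_const c * U2 (b * dil 2 D)"
      by (rule fps_ext) (simp add: U2_nth)
    then have "U2 ((x + fps_const c * b) * dil 2 D) = 2 * (y + fps_const c * z)"
      using y z by (simp add: distrib_right distrib_left U2_add mult.assoc mult.left_commute)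
    then show ?case using y z zspan_plus zspan_scale by blast
  qed
qed

text \<open>
The weight \<open>2^(j-1)\<close> reproduces itself under \<open>U\<^sub>2\<close>, which exchanges this group with the next one up to a factor 2.
\<close>

definition theta_span :: "int fps set" where
  "theta_span = zspan {2 ^ (j - 1) * theta2_fourth ^ j * phi ^ a * pbar_fps ^ b |j a b. j \<ge> 1}"

definition theta_span' :: "int fps set" where
  "theta_span' = zspan {2 ^ (j - 1) * theta2_square ^ j * dil 2 phi ^ a * pbar_fps ^ (2 * b) |j a b. j \<ge> 1}"

lemma zspan_mono: "x \<in> zspan G \<Longrightarrow> G \<subseteq> H \<Longrightarrow> x \<in> zspan H"
  by (induction x rule: zspan.induct) (auto intro: zspan_0 zspan_add)

lemma U2_lift:
  assumes "x \<in> zspan G" "\<And>b. b \<in> G \<Longrightarrow> \<exists>y\<in>zspan H. U2 b = 2 * y"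
  shows "\<exists>y\<in>zspan H. U2 x = 2 * y"
  using assms(1)
proof induction
  case zspan_0
  then show ?case using zspan.zspan_0[of H] by (intro bexI[of _ 0]) (auto simp: fps_eq_iff U2_nth)
next
  case (zspan_add x b c)
  obtain y where y: "y \<in> zspan H" "U2 x = 2 * y" using zspan_add by blast
  obtain z where z: "z \<in> zspan H" "U2 b = 2 * z" using assms(2) zspan_add by blast
  have "U2 (fps_const c * b) = fps_const c * U2 b"
    by (rule fps_ext) (simp add: U2_nth)
  then have "U2 (x + fps_const c * b) = 2 * (y + fps_const c * z)"
    using y z by (simp add: distrib_left U2_add mult.left_commute)
  then show ?case using y z zspan_plus zspan_scale by blast
qed

lemma weighted_mult_power:
  assumes "\<And>x. x \<in> zspan W \<Longrightarrow> y * x \<in> zspan W" "x \<in> zspan W"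
  shows "y ^ n * x \<in> zspan W"
  using assms(2) by (induction n) (auto simp: mult.assoc intro: assms(1))

text \<open>
With \<open>A = \<phi>(q^4)\<close> and \<open>\<beta> = q \<psi>(q^8)\<close> one has \<open>\<theta>\<^sub>2^4 / 16 = A \<beta> (A^2 + 4 \<beta>^2)\<close> and
\<open>\<phi> = A + 2 \<beta>\<close>. Apart from the factor \<open>F(q^2)^(2 b)\<close>, a generator is therefore a combination of weighted
monomials in \<open>A\<close> and \<open>\<beta>\<close>, and \<open>\<beta>^2\<close> is \<open>\<theta>\<^sub>2(q^2)^2 / 4\<close> at \<open>q^2\<close>.
\<close>

lemma U2_theta_span:
  assumes "x \<in> theta_span" shows "\<exists>y\<in>theta_span'. U2 x = 2 * y"
  using assms unfolding theta_span_def theta_span'_def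
proof (rule U2_lift)
  define A where "A = dil 4 phi"
  define \<beta> where "\<beta> = fps_X * dil 8 psi"
  define W where "W = weighted_monomials A \<beta>"
  have oddb: "odd_fps \<beta>" unfolding \<beta>_def by (intro odd_fps_X_mult even_fps_dil) simp
  have sqb: "\<beta>\<^sup>2 = dil 2 theta2_square"
    by (simp add: \<beta>_def theta2_square_def dil_mult dil_power dil_dil power_mult_distrib)
  have A2: "A = dil 2 (dil 2 phi)" by (simp add: A_def dil_dil)
  fix x assume "x \<in> {2 ^ (j - 1) * theta2_fourth ^ j * phi ^ a * pbar_fps ^ b |j a b. j \<ge> 1}"
  then obtain j a b where j: "j \<ge> 1" "x = 2 ^ (j - 1) * theta2_fourth ^ j * phi ^ a * pbar_fps ^ b" by blast
  have mphi: "phi * x \<in> zspan W" if "x \<in> zspan W" for x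
  proof -
    have "A * x + 2 * \<beta> * x \<in> zspan W"
      using that unfolding W_def by (intro zspan_plus weighted_mult_even weighted_mult_odd)
    then show ?thesis by (subst phi_dissection) (simp add: distrib_right A_def \<beta>_def)
  qed
  have mquad: "(A\<^sup>2 + 4 * \<beta>\<^sup>2) * x \<in> zspan W" if "x \<in> zspan W" for x
  proof -
    have "A * (A * x) + 2 * \<beta> * (2 * \<beta> * x) \<in> zspan W"
      using that unfolding W_def by (intro zspan_plus weighted_mult_even weighted_mult_odd)
    then show ?thesis by (simp add: power2_eq_square algebra_simps)
  qed
  have "2 ^ (j - 1) * A ^ j * \<beta> ^ j \<in> zspan W"
    unfolding W_def by (rule weighted_monomialsI[OF j(1), of _ _ j]) simp
  then have W: "phi ^ (a + b) * ((A\<^sup>2 + 4 * \<beta>\<^sup>2) ^ j * (2 ^ (j - 1) * A ^ j * \<beta> ^ j)) \<in> zspan W"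
    by (intro weighted_mult_power mphi mquad)
  have x: "x = (phi ^ (a + b) * ((A\<^sup>2 + 4 * \<beta>\<^sup>2) ^ j * (2 ^ (j - 1) * A ^ j * \<beta> ^ j))) * dil 2 (pbar_fps ^ (2 * b))"
  proof -
    have "pbar_fps ^ b = phi ^ b * dil 2 (pbar_fps ^ (2 * b))"
      by (subst pbar_fps_dissection) (simp add: power_mult_distrib dil_power power_mult)
    moreover have "theta2_fourth ^ j = (A\<^sup>2 + 4 * \<beta>\<^sup>2) ^ j * (A ^ j * \<beta> ^ j)"
      by (simp add: theta2_fourth_eq theta2_square_eq A_def \<beta>_def power_mult_distrib mult_ac)
    ultimately show ?thesis unfolding j(2) by (simp add: power_add mult_ac)
  qed
  obtain y where "y \<in> zspan {2 ^ (i - 1) * theta2_square ^ i * dil 2 phi ^ s * pbar_fps ^ (2 * b) |i s. i \<ge> 1}" "U2 x = 2 * y"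
    using weighted_U2[OF W[unfolded W_def A2] oddb sqb, of "pbar_fps ^ (2 * b)"] unfolding x A2[symmetric] by blast
  then show "\<exists>y\<in>zspan {2 ^ (j - 1) * theta2_square ^ j * dil 2 phi ^ a * pbar_fps ^ (2 * b) |j a b. j \<ge> 1}. U2 x = 2 * y"
    by (intro bexI[of _ y]) (auto elim!: zspan_mono)
qed

text \<open>
The same argument with the even series \<open>\<phi>(q^2)\<close> and the odd series \<open>k = \<theta>\<^sub>2(q^2)^2 / 4\<close>. The powers of \<open>\<phi>\<close> that come
from the denominators are now even, and \<open>\<phi>^2 = \<phi>(q^2)^2 + 4 k\<close>.
\<close>

lemma U2_theta_span':
  assumes "x \<in> theta_span'" shows "\<exists>y\<in>theta_span. U2 x = 2 * y"
  using assms unfolding theta_span_def theta_span'_def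
proof (rule U2_lift)
  define W where "W = weighted_monomials (dil 2 phi) theta2_square"
  have "even_fps (dil 4 psi ^ 2)"
    by (rule even_fps_dil_power) simp_all
  then have oddk: "odd_fps theta2_square" unfolding theta2_square_def by (rule odd_fps_X_mult)
  have sqk: "theta2_square\<^sup>2 = dil 2 theta2_fourth"
    by (simp add: theta2_fourth_def theta2_square_def dil_mult dil_power dil_dil power_mult_distrib flip: power_mult)
  fix x assume "x \<in> {2 ^ (j - 1) * theta2_square ^ j * dil 2 phi ^ a * pbar_fps ^ (2 * b) |j a b. j \<ge> 1}"
  then obtain j a b where j: "j \<ge> 1" "x = 2 ^ (j - 1) * theta2_square ^ j * dil 2 phi ^ a * pbar_fps ^ (2 * b)" by blast
  have mphi: "phi\<^sup>2 * x \<in> zspan W" if "x \<in> zspan W" for x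
  proof -
    have "dil 2 phi * (dil 2 phi * x) + 2 * (2 * theta2_square * x) \<in> zspan W"
      using that unfolding W_def by (intro zspan_plus weighted_mult_even weighted_mult_odd zspan_numeral_mult)
    moreover have "dil 2 phi * (dil 2 phi * x) + 2 * (2 * theta2_square * x) = (dil 2 phi ^ 2 + 4 * theta2_square) * x"
      by (simp add: power2_eq_square algebra_simps)
    ultimately show ?thesis unfolding phi_square theta2_square_def by simp
  qed
  have "2 ^ (j - 1) * dil 2 phi ^ a * theta2_square ^ j \<in> zspan W"
    unfolding W_def by (rule weighted_monomialsI[OF j(1), of _ _ a]) simp
  then have W: "(phi\<^sup>2) ^ b * (2 ^ (j - 1) * dil 2 phi ^ a * theta2_square ^ j) \<in> zspan W"
    by (intro weighted_mult_power mphi)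
  have x: "x = ((phi\<^sup>2) ^ b * (2 ^ (j - 1) * dil 2 phi ^ a * theta2_square ^ j)) * dil 2 (pbar_fps ^ (4 * b))"
  proof -
    have "pbar_fps ^ (2 * b) = (phi\<^sup>2) ^ b * dil 2 (pbar_fps ^ (4 * b))"
      by (subst pbar_fps_dissection) (simp add: power_mult_distrib dil_power flip: power_mult)
    then show ?thesis unfolding j(2) by (simp add: mult_ac)
  qed
  obtain y where "y \<in> zspan {2 ^ (i - 1) * theta2_fourth ^ i * phi ^ s * pbar_fps ^ (4 * b) |i s. i \<ge> 1}" "U2 x = 2 * y"
    using weighted_U2[OF W[unfolded W_def] oddk sqk, of "pbar_fps ^ (4 * b)"] unfolding x by blast
  then show "\<exists>y\<in>zspan {2 ^ (j - 1) * theta2_fourth ^ j * phi ^ a * pbar_fps ^ b |j a b. j \<ge> 1}. U2 x = 2 * y"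
    by (intro bexI[of _ y]) (auto elim!: zspan_mono)
qed

lemma U2_iter_theta_span: "x \<in> theta_span \<Longrightarrow> \<exists>y\<in>theta_span \<union> theta_span'. (U2 ^^ a) x = 2 ^ a * y"
proof (induction a)
  case (Suc a)
  then obtain y where y: "y \<in> theta_span \<union> theta_span'" "(U2 ^^ a) x = 2 ^ a * y" by blast
  obtain z where z: "z \<in> theta_span \<union> theta_span'" "U2 y = 2 * z" using y U2_theta_span U2_theta_span' by blast
  have "U2 (2 ^ a * y) = 2 ^ a * U2 y" unfolding two_power_fps by (simp add: fps_eq_iff U2_nth)
  then show ?case using y z by auto
qed auto

lemma theta_span_coeff_divisible:
  assumes "x \<in> theta_span" shows "2 ^ a dvd x $ (2 ^ a * n)"
proof -
  obtain y where y: "(U2 ^^ a) x = 2 ^ a * y" using U2_iter_theta_span[OF assms] by blast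
  then have "(U2 ^^ a) x $ n = (2 ^ a * y) $ n" by simp
  then have "x $ (2 ^ a * n) = 2 ^ a * y $ n"
    unfolding U2_iter_nth two_power_fps fps_mult_left_const_nth .
  then show ?thesis by (metis dvd_triv_left)
qed

section \<open>Uniqueness of quasi-periodic entire functions\<close>

abbreviation nome :: "complex \<Rightarrow> complex" where
  "nome \<tau> \<equiv> exp (pi * \<i> * \<tau>)"

abbreviation nome_sq :: "complex \<Rightarrow> complex" where
  "nome_sq \<tau> \<equiv> exp (2 * pi * \<i> * \<tau>)"

text \<open>
Multiplying the unit circle by \<open>c\<close> gives the circle of radius \<open>|c|\<close> with another starting point, which does
not affect the integral.
\<close>

lemma contour_integral_circlepath_rotate:
  assumes "c \<noteq> 0"
  shows "contour_integral (circlepath 0 (norm c)) h = contour_integral (circlepath 0 1) (\<lambda>u. c * h (c * u))"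
proof -
  obtain a where a: "0 \<le> a" "a < 1" "c = of_real (norm c) * exp (2 * of_real pi * \<i> * of_real a)"
  proof
    define b where "b = Arg2pi c / (2 * pi)"
    show "0 \<le> b" "b < 1" using Arg2pi[of c] by (auto simp: b_def field_simps)
    have "2 * of_real pi * \<i> * of_real b = \<i> * of_real (Arg2pi c)" by (simp add: b_def)
    moreover have "c = of_real (norm c) * exp (\<i> * of_real (Arg2pi c))"
      using Arg2pi[of c] is_Arg_def by blast
    ultimately show "c = of_real (norm c) * exp (2 * of_real pi * \<i> * of_real b)" by (simp only:)
  qed
  have "shiftpath a (circlepath 0 (norm c)) = (\<lambda>z. c * z) \<circ> circlepath 0 1"
  proof
    fix x
    have "exp (2 * of_real pi * \<i> * of_real (a + x - 1)) = exp (2 * of_real pi * \<i> * of_real (a + x))"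
      by (simp add: ring_distribs exp_diff exp_add)
    then have "shiftpath a (circlepath 0 (norm c)) x = of_real (norm c) * exp (2 * of_real pi * \<i> * of_real (a + x))"
      by (simp add: shiftpath_def circlepath)
    also have "\<dots> = c * exp (2 * of_real pi * \<i> * of_real x)"
      by (subst (2) a(3)) (simp add: ring_distribs exp_add)
    finally show "shiftpath a (circlepath 0 (norm c)) x = ((\<lambda>z. c * z) \<circ> circlepath 0 1) x"
      by (simp add: circlepath)
  qed
  then have "contour_integral (circlepath 0 (norm c)) h = contour_integral ((\<lambda>z. c * z) \<circ> circlepath 0 1) h"
    using contour_integral_shiftpath[of "circlepath 0 (norm c)" a h] a by simp
  also have "\<dots> = contour_integral (circlepath 0 1) (\<lambda>u. deriv (\<lambda>z. c * z) u * h (c * u))"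
    by (rule contour_integral_comp_analyticW[of _ UNIV]) (auto intro!: analytic_intros)
  also have "(\<lambda>u. deriv (\<lambda>z. c * z) u * h (c * u)) = (\<lambda>u. c * h (c * u))"
    by simp
  finally show ?thesis .
qed

lemma contour_integral_circlepath_indep:
  assumes "h holomorphic_on - {0}" "0 < r" "0 < R"
  shows "contour_integral (circlepath 0 r) h = contour_integral (circlepath 0 R) h"
proof -
  have "contour_integral (circlepath 0 r) h = contour_integral (circlepath 0 R) h"
    if "0 < r" "r \<le> R" for r R
    using contour_integral_circlepath_eq(3)[of UNIV h 0 r R] assms(1) that
    by (simp add: Compl_eq_Diff_UNIV)
  then show ?thesis using assms by (metis linear)
qed

lemma geometric_kernel:
  fixes u w :: complex
  assumes "u \<noteq> 0" "u \<noteq> w"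
  shows "1 / (u - w) = (\<Sum>k<K. w ^ k * u powi (- int k - 1)) + (w / u) ^ K / (u - w)"
proof (induction K)
  case (Suc K)
  have "(w / u) ^ K / (u - w) = w ^ K * u powi (- int K - 1) + (w / u) ^ Suc K / (u - w)"
  proof -
    have p: "u powi (- int K - 1) = 1 / u ^ Suc K"
      using assms by (simp add: power_int_def nat_add_distrib power_inverse divide_inverse)
         (simp add: power_int_diff power_int_minus divide_inverse)?
    show ?thesis
      unfolding p using assms by (simp add: field_simps)
  qed
  then show ?case using Suc.IH by simp
qed simp

text \<open>
A function on the punctured plane all of whose Laurent coefficients vanish is zero. By Cauchy's formula on an annulus around
\<open>w\<close>, the value \<open>G w\<close> is, up to the factor \<open>2 \<pi> i\<close>, the difference of the integrals of \<open>G u / (u - w)\<close> over the outer and the inner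
circle; expanding the kernel in a geometric series reduces each of them to the given moments.
\<close>

lemma annulus_laurent_zero:
  fixes G :: "complex \<Rightarrow> complex"
  assumes hol: "G holomorphic_on - {0}"
    and zero: "\<And>k::int. contour_integral (circlepath 0 1) (\<lambda>u. G u * u powi k) = 0"
    and w: "w \<noteq> 0"
  shows "G w = 0"
proof -
  define r where "r = norm w / 2"
  define R where "R = 2 * norm w"
  have rR: "0 < r" "r < norm w" "norm w < R" "0 < R" using w by (auto simp: r_def R_def)
  have holk: "(\<lambda>u. G u * u powi k) holomorphic_on - {0}" for k
    by (intro holomorphic_intros hol) auto
  have zero': "((\<lambda>u. G u * u powi k) has_contour_integral 0) (circlepath 0 s)" if "s > 0" for s and k
  proof -
    have "(\<lambda>u. G u * u powi k) contour_integrable_on circlepath 0 s"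
      using contour_integral_circlepath_eq(1)[of UNIV "\<lambda>u. G u * u powi k" 0 s s] holk[of k] that
      by (simp add: Compl_eq_Diff_UNIV)
    moreover have "contour_integral (circlepath 0 s) (\<lambda>u. G u * u powi k) = 0"
      using contour_integral_circlepath_indep[OF holk that, of 1 k] zero by simp
    ultimately show ?thesis by (metis has_contour_integral_integral)
  qed
  \<comment> \<open>Over the circles, the integral of \<open>G u / (u - w)\<close> is that of the holomorphic quotient \<open>q\<close> plus \<open>G w\<close> times that of \<open>1 / (u - w)\<close>.\<close>
  define q where "q = (\<lambda>z. if z = w then deriv G w else (G z - G w) / (z - w))"
  have holq: "q holomorphic_on - {0}"
    unfolding q_def by (rule pole_lemma[OF hol]) (use w in \<open>auto simp: interior_open open_Compl\<close>)
  have intq: "(q has_contour_integral I) (circlepath 0 s)" 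
    if "s > 0" "I = contour_integral (circlepath 0 1) q" for s I
  proof -
    have "q contour_integrable_on circlepath 0 s"
      using contour_integral_circlepath_eq(1)[of UNIV q 0 s s] holq that
      by (simp add: Compl_eq_Diff_UNIV)
    then show ?thesis
      using contour_integral_circlepath_indep[OF holq that(1), of 1] that(2)
      by (metis has_contour_integral_integral zero_less_one)
  qed
  have cont: "continuous_on (sphere 0 s) (\<lambda>u. G u / (u - w))" if "s > 0" "norm w \<noteq> s" for s
    using that by (intro continuous_intros holomorphic_on_imp_continuous_on[OF holomorphic_on_subset[OF hol]]) auto
  have intG: "(\<lambda>u. G u / (u - w)) contour_integrable_on circlepath 0 s" if "s > 0" "norm w \<noteq> s" for s
    using cont[OF that] that by (intro contour_integrable_continuous_circlepath) simp
  have bound: "\<exists>B>0. \<forall>u\<in>sphere 0 s. norm (G u / (u - w)) \<le> B" if "s > 0" "norm w \<noteq> s" for s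
  proof -
    have "compact ((\<lambda>u. G u / (u - w)) ` sphere 0 s)"
      by (intro compact_continuous_image cont that) auto
    then show ?thesis by (meson bounded_pos compact_imp_bounded imageI)
  qed
  have squeeze: "I = 0" if "\<And>K. norm I \<le> C * \<rho> ^ K" "0 \<le> \<rho>" "\<rho> < 1" for I :: complex and C \<rho> :: real
  proof -
    have "(\<lambda>K. C * \<rho> ^ K) \<longlonglongrightarrow> C * 0"
      using that by (intro tendsto_mult LIMSEQ_power_zero tendsto_const) auto
    then have "norm I \<le> 0" using that(1) by (intro LIMSEQ_le_const) auto
    then show ?thesis by simp
  qed
  \<comment> \<open>Shared by both circles: a geometric expansion of the kernel with ratio of modulus \<open>\<rho> < 1\<close> makes the integral vanish.\<close>
  have kernel_integral: "((\<lambda>u. G u / (u - w)) has_contour_integral 0) (circlepath 0 s)"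
    if s: "s > 0" "norm w \<noteq> s" and \<rho>: "0 \<le> \<rho>" "\<rho> < 1"
      and expand: "\<And>K u. norm u = s \<Longrightarrow>
        1 / (u - w) = (\<Sum>k<K. c k * u powi p k) + R u ^ K / (u - w) \<and> norm (R u) = \<rho>"
    for s \<rho> and c :: "nat \<Rightarrow> complex" and p :: "nat \<Rightarrow> int" and R
  proof -
    obtain B where B: "B > 0" "\<And>u. u \<in> sphere 0 s \<Longrightarrow> norm (G u / (u - w)) \<le> B"
      using bound[OF s] by auto
    define I where "I = contour_integral (circlepath 0 s) (\<lambda>u. G u / (u - w))"
    have I: "((\<lambda>u. G u / (u - w)) has_contour_integral I) (circlepath 0 s)"
      unfolding I_def using intG[OF s] by (simp add: has_contour_integral_integral)
    have "norm I \<le> (B * 2 * pi * s) * \<rho> ^ K" for K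
    proof -
      have "((\<lambda>u. \<Sum>k<K. c k * (G u * u powi p k)) has_contour_integral (\<Sum>k<K. c k * 0)) (circlepath 0 s)"
        by (intro has_contour_integral_sum has_contour_integral_lmul zero' s) auto
      from has_contour_integral_diff[OF I this]
      have "((\<lambda>u. G u / (u - w) - (\<Sum>k<K. c k * (G u * u powi p k))) has_contour_integral I) (circlepath 0 s)"
        by simp
      then have "norm I \<le> (B * \<rho> ^ K) * (2 * pi * s)"
      proof (rule has_contour_integral_bound_circlepath)
        fix u :: complex assume "norm (u - 0) = s"
        then have u: "norm u = s" by simp
        have "G u / (u - w) - (\<Sum>k<K. c k * (G u * u powi p k)) =
              G u * (1 / (u - w) - (\<Sum>k<K. c k * u powi p k))"
          by (simp add: sum_distrib_left algebra_simps)
        also have "\<dots> = (G u / (u - w)) * R u ^ K"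
          using expand[OF u, of K] by simp
        also have "norm \<dots> \<le> B * \<rho> ^ K"
          unfolding norm_mult norm_power[of "R u"] using B(1) B(2)[of u] u expand[OF u] \<rho>(1)
          by (intro mult_mono) auto
        finally show "norm (G u / (u - w) - (\<Sum>k<K. c k * (G u * u powi p k))) \<le> B * \<rho> ^ K" .
      qed (use B s \<rho> in auto)
      then show ?thesis by (simp add: mult_ac)
    qed
    then have "I = 0" by (rule squeeze) (use \<rho> in auto)
    then show ?thesis using I by simp
  qed
  have outer: "((\<lambda>u. G u / (u - w)) has_contour_integral 0) (circlepath 0 R)"
  proof (rule kernel_integral[where R = "\<lambda>u. w / u" and \<rho> = "norm w / R"])
    fix K and u :: complex assume u: "norm u = R"
    then have "u \<noteq> 0" "u \<noteq> w" using rR by auto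
    then show "1 / (u - w) = (\<Sum>k<K. w ^ k * u powi (- int k - 1)) + (w / u) ^ K / (u - w)
        \<and> norm (w / u) = norm w / R"
      using geometric_kernel u by (auto simp: norm_divide)
  qed (use rR in auto)
  have inner: "((\<lambda>u. G u / (u - w)) has_contour_integral 0) (circlepath 0 r)"
  proof (rule kernel_integral[where R = "\<lambda>u. u / w" and \<rho> = "r / norm w"])
    fix K and u :: complex assume u: "norm u = r"
    then have uw: "u \<noteq> 0" "u \<noteq> w" using rR by auto
    have "1 / (w - u) = (\<Sum>k<K. u ^ k * w powi (- int k - 1)) + (u / w) ^ K / (w - u)"
      using geometric_kernel[OF w uw(2)[symmetric], of K] .
    moreover have "1 / (w - u) = - (1 / (u - w))" "(u / w) ^ K / (w - u) = - ((u / w) ^ K / (u - w))"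
      by (metis minus_diff_eq minus_divide_right)+
    ultimately have "1 / (u - w) = - (\<Sum>k<K. u ^ k * w powi (- int k - 1)) + (u / w) ^ K / (u - w)"
      by Groebner_Basis.algebra
    then show "1 / (u - w) = (\<Sum>k<K. - (w powi (- int k - 1)) * u powi (int k)) + (u / w) ^ K / (u - w)
        \<and> norm (u / w) = r / norm w"
      using u by (simp add: sum_negf mult.commute norm_divide)
  qed (use rR w in \<open>auto simp: divide_simps\<close>)
  have eq: "((\<lambda>u. G w * (1 / (u - w))) has_contour_integral (0 - contour_integral (circlepath 0 1) q)) (circlepath 0 s)"
    if s: "s = R \<or> s = r" for s
  proof -
    have "((\<lambda>u. G u / (u - w) - q u) has_contour_integral (0 - contour_integral (circlepath 0 1) q)) (circlepath 0 s)"
      using s outer inner by (intro has_contour_integral_diff intq) (use rR in auto)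
    then show ?thesis
    proof (rule has_contour_integral_eq)
      fix u assume "u \<in> path_image (circlepath 0 s)"
      then have "norm u = s" using s rR by auto
      then have "u \<noteq> w" using s rR by auto
      then show "G u / (u - w) - q u = G w * (1 / (u - w))"
        by (simp add: q_def diff_divide_distrib)
    qed
  qed
  have "((\<lambda>u. G w * (1 / (u - w))) has_contour_integral G w * (2 * pi * \<i>)) (circlepath 0 R)"
    using Cauchy_integral_circlepath_simple[of "\<lambda>_. 1" 0 R w] rR
    by (intro has_contour_integral_lmul) (auto simp: mult_ac)
  then have "G w * (2 * pi * \<i>) = 0 - contour_integral (circlepath 0 1) q"
    using eq[of R] has_contour_integral_unique by blast
  moreover have "((\<lambda>u. G w * (1 / (u - w))) has_contour_integral 0) (circlepath 0 r)"
    by (rule Cauchy_theorem_disc_simple[of _ 0 "norm w"])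
       (use rR in \<open>auto intro!: holomorphic_intros\<close>)
  then have "0 = 0 - contour_integral (circlepath 0 1) q"
    using eq[of r] has_contour_integral_unique by blast
  ultimately show "G w = 0" by simp
qed

lemma periodic_int:
  fixes f :: "complex \<Rightarrow> 'a"
  assumes "\<And>z. f (z + 1) = f z"
  shows "f (z + of_int k) = f z"
proof (induction k rule: int_induct[where k = 0])
  case (step1 i)
  then show ?case using assms[of "z + of_int i"] by (simp add: add.assoc)
next
  case (step2 i)
  then show ?case using assms[of "z + of_int (i - 1)"] by (simp add: add.assoc)
qed simp

text \<open>
A function with period 1 is a function of \<open>exp (2 \<pi> i z)\<close>. Near a point of the cut of the logarithm another branch
gives the same value, so the lift is holomorphic there too.
\<close>

lemma periodic_lift:
  fixes f :: "complex \<Rightarrow> complex"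
  assumes hol: "f holomorphic_on UNIV" and per: "\<And>z. f (z + 1) = f z"
  defines "G \<equiv> \<lambda>w. f (Ln w / (2 * pi * \<i>))"
  shows "G holomorphic_on - {0}" "G (nome_sq z) = f z"
proof -
  have Gexp: "G (nome_sq z) = f z" for z
  proof -
    have "exp (Ln (nome_sq z)) = nome_sq z" by simp
    then obtain k :: int where "Ln (nome_sq z) = 2 * pi * \<i> * z + (of_int (2 * k) * pi) * \<i>"
      unfolding exp_eq by blast
    then have "Ln (nome_sq z) / (2 * pi * \<i>) = z + of_int k"
      by (simp add: field_simps)
    then show ?thesis unfolding G_def using periodic_int[of f z k] per by simp
  qed
  show holG: "G holomorphic_on - {0}"
    unfolding holomorphic_on_def
  proof
    fix w0 :: complex assume "w0 \<in> - {0}"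
    then have w0: "w0 \<noteq> 0" by simp
    have "(\<lambda>w. f ((Ln w0 + Ln (w / w0)) / (2 * pi * \<i>))) holomorphic_on ball w0 (norm w0)"
    proof -
      have "w / w0 \<notin> \<real>\<^sub>\<le>\<^sub>0" if "w \<in> ball w0 (norm w0)" for w
      proof -
        have "norm (1 - w / w0) = norm (w0 - w) / norm w0"
          using w0 by (simp add: field_simps flip: norm_divide)
        also have "\<dots> < 1" using that w0 by (simp add: dist_norm)
        finally have *: "norm (1 - w / w0) < 1" .
        have "Re (1 - w / w0) < 1" using * complex_Re_le_cmod[of "1 - w / w0"] by linarith
        then show ?thesis by (auto simp: complex_nonpos_Reals_iff)
      qed
      then have "(\<lambda>w. (Ln w0 + Ln (w / w0)) / (2 * pi * \<i>)) holomorphic_on ball w0 (norm w0)"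
        using w0 by (intro holomorphic_intros) auto
      from holomorphic_on_compose[OF this holomorphic_on_subset[OF hol]] show ?thesis
        by (simp add: o_def)
    qed
    moreover have "f ((Ln w0 + Ln (w / w0)) / (2 * pi * \<i>)) = G w" if "w \<in> ball w0 (norm w0)" for w
    proof -
      have "w \<noteq> 0" using that by (auto simp: dist_norm)
      then have "exp (2 * pi * \<i> * ((Ln w0 + Ln (w / w0)) / (2 * pi * \<i>))) = w"
        using w0 by (simp add: exp_add)
      then show ?thesis using Gexp[of "(Ln w0 + Ln (w / w0)) / (2 * pi * \<i>)"] by simp
    qed
    ultimately have "G holomorphic_on ball w0 (norm w0)"
      using holomorphic_transform by blast
    then have "G field_differentiable at w0"
      using w0 by (intro holomorphic_on_imp_differentiable_at) auto
    then show "G field_differentiable at w0 within - {0}"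
      by (rule field_differentiable_at_within)
  qed
  show "G (nome_sq z) = f z" by (rule Gexp)
qed

text \<open>
Quasi-periodicity reads \<open>G (Q w) = s G(w) / w\<close> for the lift \<open>G\<close>, which ties each Laurent coefficient to the
next one by a nonzero factor. If one of them vanishes, all of them do.
\<close>

lemma quasi_periodic_zero:
  fixes f :: "complex \<Rightarrow> complex"
  assumes hol: "f holomorphic_on UNIV"
    and per: "\<And>z. f (z + 1) = f z"
    and quasi: "\<And>z. f (z + \<tau>) = exp (- (pi * \<i> * \<tau>) - 2 * pi * \<i> * z) * f z"
  defines "G \<equiv> \<lambda>w. f (Ln w / (2 * pi * \<i>))"
  assumes zero: "contour_integral (circlepath 0 1) (\<lambda>u. G u / u) = 0"
  shows "f z = 0"
proof -
  have Gexp: "G (nome_sq z) = f z" for z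
    unfolding G_def by (rule periodic_lift(2)[OF hol per])
  have holG: "G holomorphic_on - {0}"
    unfolding G_def by (rule periodic_lift(1)[OF hol per])
  define Q where "Q = nome_sq \<tau>"
  have Q0: "Q \<noteq> 0" by (simp add: Q_def)
  define s where "s = exp (- (pi * \<i> * \<tau>))"
  have s0: "s \<noteq> 0" by (simp add: s_def)
  have GQ: "G (Q * w) = s * G w / w" if "w \<noteq> 0" for w
  proof -
    define z where "z = Ln w / (2 * pi * \<i>)"
    have "2 * pi * \<i> * z = Ln w" by (simp add: z_def)
    then have z: "nome_sq z = w" using that by (metis exp_Ln)
    have "exp (2 * pi * \<i> * (z + \<tau>)) = Q * w"
      by (simp add: ring_distribs exp_add z[simplified] Q_def)
    then have "G (Q * w) = f (z + \<tau>)" using Gexp[of "z + \<tau>"] by simp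
    also have "\<dots> = s / w * f z"
      by (simp add: quasi exp_diff s_def z[simplified])
    also have "f z = G w" using Gexp[of z] z by simp
    finally show ?thesis by simp
  qed
  define I where "I = (\<lambda>k::int. contour_integral (circlepath 0 1) (\<lambda>u. G u * u powi k))"
  \<comment> \<open>Move the circle of integration to radius \<open>|Q|\<close> and substitute \<open>Q u\<close>.\<close>
  have rec: "I k = Q powi (k + 1) * s * I (k - 1)" for k
  proof -
    have holk: "(\<lambda>u. G u * u powi k) holomorphic_on - {0}" for k
      by (intro holomorphic_intros holG) auto
    have "I k = contour_integral (circlepath 0 (norm Q)) (\<lambda>u. G u * u powi k)"
      unfolding I_def by (rule contour_integral_circlepath_indep[OF holk]) (use Q0 in auto)
    also have "\<dots> = contour_integral (circlepath 0 1) (\<lambda>u. Q * (G (Q * u) * (Q * u) powi k))"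
      by (rule contour_integral_circlepath_rotate[OF Q0])
    also have "\<dots> = contour_integral (circlepath 0 1) (\<lambda>u. (Q powi (k + 1) * s) * (G u * u powi (k - 1)))"
    proof (rule contour_integral_eq)
      fix u :: complex assume "u \<in> path_image (circlepath 0 1)"
      then have u: "u \<noteq> 0" by auto
      show "Q * (G (Q * u) * (Q * u) powi k) = (Q powi (k + 1) * s) * (G u * u powi (k - 1))"
        using u Q0 by (simp add: GQ power_int_mult_distrib power_int_add power_int_diff)
    qed
    also have "\<dots> = (Q powi (k + 1) * s) * I (k - 1)"
    proof -
      have "(\<lambda>u. G u * u powi (k - 1)) contour_integrable_on circlepath 0 1"
        using contour_integral_circlepath_eq(1)[of UNIV "\<lambda>u. G u * u powi (k - 1)" 0 1 1] holk[of "k - 1"]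
        by (simp add: Compl_eq_Diff_UNIV)
      then show ?thesis unfolding I_def by (rule contour_integral_lmul)
    qed
    finally show ?thesis .
  qed
  have "I (-1) = 0" using zero by (simp add: I_def power_int_minus divide_inverse)
  then have "I k = 0" for k
  proof (induction k rule: int_induct[where k = "-1"])
    case (step1 i)
    then show ?case using rec[of "i + 1"] by simp
  next
    case (step2 i)
    then show ?case using rec[of i] Q0 s0 by simp
  qed simp
  then have "G w = 0" if "w \<noteq> 0" for w
    using annulus_laurent_zero[OF holG _ that] unfolding I_def by blast
  then show ?thesis using Gexp[of z] by (metis exp_not_eq_zero)
qed

text \<open>
The functions with these two periodicity properties form a space on which a single Laurent coefficient is injective, so its
dimension is at most one.
\<close>

lemma quasi_periodic_proportional:
  fixes f g :: "complex \<Rightarrow> complex"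
  assumes hol: "f holomorphic_on UNIV" "g holomorphic_on UNIV"
    and per: "\<And>z. f (z + 1) = f z" "\<And>z. g (z + 1) = g z"
    and quasi: "\<And>z. f (z + \<tau>) = exp (- (pi * \<i> * \<tau>) - 2 * pi * \<i> * z) * f z"
       "\<And>z. g (z + \<tau>) = exp (- (pi * \<i> * \<tau>) - 2 * pi * \<i> * z) * g z"
    and g: "g z0 \<noteq> 0"
  shows "f z = f z0 / g z0 * g z"
proof -
  define J where "J = (\<lambda>f. contour_integral (circlepath 0 1) (\<lambda>u. f (Ln u / (2 * pi * \<i>)) / u))"
  define Hf where "Hf = (\<lambda>f::complex\<Rightarrow>complex. f holomorphic_on UNIV \<and> (\<forall>z. f (z + 1) = f z) \<and>
     (\<forall>z. f (z + \<tau>) = exp (- (pi * \<i> * \<tau>) - 2 * pi * \<i> * z) * f z))"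
  have zero: "h z = 0" if "Hf h" "J h = 0" for h z
    using that quasi_periodic_zero[of h \<tau>] unfolding Hf_def J_def by blast
  have comb: "Hf (\<lambda>z. a * f z + b * g z)" for a b
    unfolding Hf_def using hol per quasi
    by (auto intro!: holomorphic_intros simp: algebra_simps)
  have int: "(\<lambda>u. h (Ln u / (2 * pi * \<i>)) / u) contour_integrable_on circlepath 0 1" if "Hf h" for h
  proof -
    have "(\<lambda>u. h (Ln u / (2 * pi * \<i>)) / u) holomorphic_on - {0}"
      by (intro holomorphic_on_divide periodic_lift(1)) (use that in \<open>auto simp: Hf_def\<close>)
    then show ?thesis
      using contour_integral_circlepath_eq(1)[of UNIV _ 0 1 1] by (simp add: Compl_eq_Diff_UNIV)
  qed
  have Hfg: "Hf f" "Hf g" using comb[of 1 0] comb[of 0 1] by simp_all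
  have J: "J (\<lambda>z. a * f z + b * g z) = a * J f + b * J g" for a b
  proof -
    have "J (\<lambda>z. a * f z + b * g z) = contour_integral (circlepath 0 1)
        (\<lambda>u. a * (f (Ln u / (2 * pi * \<i>)) / u) + b * (g (Ln u / (2 * pi * \<i>)) / u))"
      unfolding J_def by (simp add: add_divide_distrib)
    also have "\<dots> = a * J f + b * J g"
      unfolding J_def using int[OF Hfg(1)] int[OF Hfg(2)]
      by (subst contour_integral_add) (auto simp only: contour_integral_lmul intro: contour_integrable_lmul)
    finally show ?thesis .
  qed
  have "J g \<noteq> 0"
    using zero[OF comb[of 0 1]] g by fastforce
  define c where "c = J f / J g"
  have "J (\<lambda>z. 1 * f z + (- c) * g z) = 0"
    unfolding J using \<open>J g \<noteq> 0\<close> by (simp add: c_def)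
  then have "1 * f z + (- c) * g z = 0" for z
    by (rule zero[OF comb])
  then have "f z = c * g z" for z by simp
  then show ?thesis using g by simp
qed

section \<open>The inversion formula of the Jacobi theta function\<close>

definition theta_term :: "complex \<Rightarrow> complex \<Rightarrow> int \<Rightarrow> complex" where
  "theta_term \<tau> z n = exp (pi * \<i> * (of_int n ^ 2 * \<tau> + 2 * of_int n * z))"

definition jtheta :: "complex \<Rightarrow> complex \<Rightarrow> complex" where
  "jtheta \<tau> z = infsum (theta_term \<tau> z) UNIV"

lemma summable_gaussian:
  fixes r R :: real
  assumes "0 \<le> r" "r < 1" "0 \<le> R"
  shows "summable (\<lambda>n. r ^ (n\<^sup>2) * R ^ n)"
proof -
  have "(\<lambda>n. r ^ n * R) \<longlonglongrightarrow> 0 * R"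
    using assms by (intro tendsto_mult LIMSEQ_power_zero tendsto_const) auto
  then have "eventually (\<lambda>n. r ^ n * R < 1 / 2) sequentially"
    by (rule order_tendstoD) auto
  then obtain N where N: "\<And>n. n \<ge> N \<Longrightarrow> r ^ n * R < 1 / 2"
    unfolding eventually_sequentially by blast
  show ?thesis
  proof (rule summable_comparison_test')
    show "summable (\<lambda>n. (1 / 2 :: real) ^ n)" by (rule summable_geometric) simp
    fix n assume "n \<ge> N"
    have "r ^ (n\<^sup>2) * R ^ n = (r ^ n * R) ^ n"
      by (simp add: power_mult_distrib power2_eq_square power_mult)
    also have "\<dots> \<le> (1 / 2) ^ n"
      using N[OF \<open>n \<ge> N\<close>] assms by (intro power_mono) auto
    finally show "norm (r ^ (n\<^sup>2) * R ^ n) \<le> (1 / 2) ^ n" using assms by simp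
  qed
qed

lemma has_sum_int_split:
  fixes f :: "int \<Rightarrow> complex"
  assumes "summable (\<lambda>n. norm (f (int n)))" "summable (\<lambda>n. norm (f (- int n)))"
  shows "(f has_sum ((\<Sum>n. f (int n)) + (\<Sum>n. f (- int n)) - f 0)) UNIV"
proof -
  have p: "(f has_sum (\<Sum>n. f (int n))) (range int)"
    unfolding has_sum_reindex[OF inj_of_nat] o_def
    using assms(1) by (intro norm_summable_imp_has_sum summable_sums summable_norm_cancel[OF assms(1)])
  have "(\<lambda>n. f (- int n)) sums (\<Sum>n. f (- int n))"
    by (intro summable_sums summable_norm_cancel[OF assms(2)])
  then have "(\<lambda>n. f (- int (Suc n))) sums ((\<Sum>n. f (- int n)) - f 0)"
    using sums_Suc_iff[of "\<lambda>n. f (- int n)"] by simp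
  moreover have "summable (\<lambda>n. norm (f (- int (Suc n))))"
    using assms(2) summable_Suc_iff[of "\<lambda>n. norm (f (- int n))"] by simp
  ultimately have "((\<lambda>n. f (- int (Suc n))) has_sum ((\<Sum>n. f (- int n)) - f 0)) UNIV"
    by (intro norm_summable_imp_has_sum)
  moreover have "inj (\<lambda>n. - int (Suc n))" by (auto simp: inj_def)
  ultimately have m: "(f has_sum ((\<Sum>n. f (- int n)) - f 0)) (range (\<lambda>n. - int (Suc n)))"
    by (simp add: has_sum_reindex o_def)
  have "range int \<union> range (\<lambda>n. - int (Suc n)) = UNIV"
  proof -
    have "x \<in> range int \<union> range (\<lambda>n. - int (Suc n))" for x
      by (cases x) (auto simp del: of_nat_Suc)
    then show ?thesis by auto
  qed
  moreover have "range int \<inter> range (\<lambda>n. - int (Suc n)) = {}" by auto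
  ultimately show ?thesis
    using has_sum_Un_disjoint[OF p m] by (simp add: algebra_simps)
qed

text \<open>
The half \<open>n \<ge> 0\<close> of the theta series, as a power series in \<open>exp (2 \<pi> i z)\<close>. Its infinite radius of
convergence makes \<open>\<theta>\<close> entire in \<open>z\<close>.
\<close>

definition theta_series :: "complex \<Rightarrow> complex fps" where
  "theta_series \<tau> = Abs_fps (\<lambda>n. exp (pi * \<i> * (of_nat n ^ 2 * \<tau>)))"

lemma norm_theta_coeff:
  "norm (exp (pi * \<i> * (of_nat n ^ 2 * \<tau>))) = exp (- pi * Im \<tau>) ^ (n\<^sup>2)"
  by (simp add: exp_of_nat_mult[symmetric] mult_ac flip: of_nat_power)

lemma theta_series_radius:
  assumes "Im \<tau> > 0"
  shows "fps_conv_radius (theta_series \<tau>) = \<infinity>"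
proof -
  have "conv_radius (fps_nth (theta_series \<tau>)) \<ge> \<infinity>"
  proof (rule conv_radius_geI_ex')
    fix r :: real assume "0 < r"
    have "summable (\<lambda>n. norm (fps_nth (theta_series \<tau>) n * of_real r ^ n))"
      using summable_gaussian[of "exp (- pi * Im \<tau>)" r] assms \<open>0 < r\<close>
      unfolding theta_series_def fps_nth_Abs_fps norm_mult norm_theta_coeff
      by (simp add: norm_power)
    then show "summable (\<lambda>n. fps_nth (theta_series \<tau>) n * of_real r ^ n)"
      by (rule summable_norm_cancel)
  qed
  then show ?thesis by (simp add: fps_conv_radius_def)
qed

lemma theta_term_nat:
  "theta_term \<tau> z (int n) = fps_nth (theta_series \<tau>) n * nome_sq z ^ n"
  "theta_term \<tau> z (- int n) = fps_nth (theta_series \<tau>) n * exp (- (2 * pi * \<i> * z)) ^ n"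
  by (simp_all add: theta_term_def theta_series_def exp_of_nat_mult[symmetric] exp_add[symmetric] algebra_simps)

lemma theta_term_has_sum:
  assumes "Im \<tau> > 0"
  shows "(theta_term \<tau> z has_sum (eval_fps (theta_series \<tau>) (nome_sq z)
          + eval_fps (theta_series \<tau>) (exp (- (2 * pi * \<i> * z))) - 1)) UNIV"
proof -
  have s: "summable (\<lambda>n. norm (fps_nth (theta_series \<tau>) n * w ^ n))" for w
    by (rule norm_summable_fps) (simp add: theta_series_radius[OF assms])
  have "(theta_term \<tau> z has_sum ((\<Sum>n. theta_term \<tau> z (int n)) + (\<Sum>n. theta_term \<tau> z (- int n)) - theta_term \<tau> z 0)) UNIV"
    by (rule has_sum_int_split; unfold theta_term_nat; rule s)
  then show ?thesis unfolding theta_term_nat by (simp add: eval_fps_def theta_term_def)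
qed

lemma jtheta_has_sum: "Im \<tau> > 0 \<Longrightarrow> (theta_term \<tau> z has_sum jtheta \<tau> z) UNIV"
  unfolding jtheta_def using theta_term_has_sum by (metis has_sum_infsum summable_on_def)

lemma jtheta_eq_eval:
  "Im \<tau> > 0 \<Longrightarrow> jtheta \<tau> z = eval_fps (theta_series \<tau>) (nome_sq z)
          + eval_fps (theta_series \<tau>) (exp (- (2 * pi * \<i> * z))) - 1"
  using theta_term_has_sum jtheta_has_sum has_sum_unique by blast

lemma jtheta_holomorphic: "Im \<tau> > 0 \<Longrightarrow> jtheta \<tau> holomorphic_on UNIV"
proof -
  assume \<tau>: "Im \<tau> > 0"
  have e: "eval_fps (theta_series \<tau>) holomorphic_on UNIV"
    by (rule holomorphic_on_eval_fps) (simp add: theta_series_radius[OF \<tau>])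
  have "(\<lambda>z. eval_fps (theta_series \<tau>) (h z)) holomorphic_on UNIV" if "h holomorphic_on UNIV" for h
    using holomorphic_on_compose[OF that holomorphic_on_subset[OF e]] by (simp add: o_def)
  note that = this
  have "(\<lambda>z. eval_fps (theta_series \<tau>) (nome_sq z)
          + eval_fps (theta_series \<tau>) (exp (- (2 * pi * \<i> * z))) - 1) holomorphic_on UNIV"
    by (intro holomorphic_on_add holomorphic_on_diff that holomorphic_intros)
  then show ?thesis using jtheta_eq_eval[OF \<tau>] by presburger
qed

lemma exp_2pi_int [simp]: "exp (2 * of_real pi * \<i> * of_int n) = 1"
  by (simp add: exp_eq_1 mult_ac)

lemma jtheta_add_int: "jtheta \<tau> (z + of_int k) = jtheta \<tau> z"
proof -
  have "theta_term \<tau> (z + of_int k) n = theta_term \<tau> z n" for n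
  proof -
    have "theta_term \<tau> (z + of_int k) n = theta_term \<tau> z n * exp (2 * of_real pi * \<i> * of_int (n * k))"
      by (simp add: theta_term_def exp_add[symmetric] algebra_simps)
    then show ?thesis by (simp only: exp_2pi_int mult_1_right)
  qed
  then have "theta_term \<tau> (z + of_int k) = theta_term \<tau> z" by (rule ext)
  then show ?thesis by (simp only: jtheta_def)
qed

lemma jtheta_add_tau:
  assumes "Im \<tau> > 0"
  shows "jtheta \<tau> (z + \<tau>) = exp (- (pi * \<i> * \<tau>) - 2 * pi * \<i> * z) * jtheta \<tau> z"
proof -
  have "((\<lambda>n. theta_term \<tau> z (n + 1)) has_sum jtheta \<tau> z) UNIV"
    using jtheta_has_sum[OF assms, of z]
    by (subst (asm) has_sum_reindex_bij_betw[of "\<lambda>n. n + 1" UNIV UNIV, symmetric])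
       (auto intro!: bij_betwI[where g = "\<lambda>n. n - 1"])
  then have "((\<lambda>n. exp (- (pi * \<i> * \<tau>) - 2 * pi * \<i> * z) * theta_term \<tau> z (n + 1)) has_sum
       exp (- (pi * \<i> * \<tau>) - 2 * pi * \<i> * z) * jtheta \<tau> z) UNIV"
    by (rule has_sum_cmult_right)
  also have "(\<lambda>n. exp (- (pi * \<i> * \<tau>) - 2 * pi * \<i> * z) * theta_term \<tau> z (n + 1)) = theta_term \<tau> (z + \<tau>)"
    by (rule ext) (simp add: theta_term_def exp_add[symmetric] algebra_simps power2_eq_square)
  finally show ?thesis using jtheta_has_sum[OF assms] has_sum_unique by blast
qed

lemma Im_minus_inverse: "Im \<tau> > 0 \<Longrightarrow> Im (- 1 / \<tau>) > 0"
  by (auto simp: Im_divide intro!: divide_pos_pos add_nonneg_pos)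

text \<open>
The value is \<open>sqrt (- i \<tau>)\<close>. The quotient of theta constants avoids choosing a branch of the root, and its reciprocity under
\<open>\<tau> \<mapsto> -1/\<tau>\<close> is immediate.
\<close>

definition inv_factor :: "complex \<Rightarrow> complex" where
  "inv_factor \<tau> = jtheta (- 1 / \<tau>) 0 / jtheta \<tau> 0"

text \<open>
Both sides are quasi-periodic in \<open>z\<close> with the same factors, hence proportional; \<open>z = 0\<close> gives the constant.
\<close>

lemma jtheta_inversion:
  assumes \<tau>: "Im \<tau> > 0" and nz: "jtheta \<tau> 0 \<noteq> 0"
  shows "exp (- (pi * \<i> * z\<^sup>2 / \<tau>)) * jtheta (- 1 / \<tau>) (- z / \<tau>) = inv_factor \<tau> * jtheta \<tau> z"
proof -
  have \<tau>0: "\<tau> \<noteq> 0" using \<tau> by auto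
  define f where "f = (\<lambda>z. exp (- (pi * \<i> * z\<^sup>2 / \<tau>)) * jtheta (- 1 / \<tau>) (- z / \<tau>))"
  note \<tau>' = Im_minus_inverse[OF \<tau>]
  have "f z = f 0 / jtheta \<tau> 0 * jtheta \<tau> z"
  proof (rule quasi_periodic_proportional)
    have "(\<lambda>z. jtheta (- 1 / \<tau>) (- z / \<tau>)) holomorphic_on UNIV"
    proof -
      have "(\<lambda>z. - z / \<tau>) holomorphic_on UNIV" using \<tau>0 by (intro holomorphic_intros) auto
      from holomorphic_on_compose[OF this holomorphic_on_subset[OF jtheta_holomorphic[OF \<tau>']]]
      show ?thesis by (simp add: o_def)
    qed
    then show "f holomorphic_on UNIV"
      unfolding f_def using \<tau>0 by (intro holomorphic_intros) auto
    show "jtheta \<tau> holomorphic_on UNIV" by (rule jtheta_holomorphic[OF \<tau>])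
    show "jtheta \<tau> (z + 1) = jtheta \<tau> z" for z using jtheta_add_int[of \<tau> z 1] by simp
    show "jtheta \<tau> (z + \<tau>) = exp (- (pi * \<i> * \<tau>) - 2 * pi * \<i> * z) * jtheta \<tau> z" for z
      by (rule jtheta_add_tau[OF \<tau>])
    show "f (z + 1) = f z" for z
    proof -
      have "- (z + 1) / \<tau> = - z / \<tau> + - 1 / \<tau>" using \<tau>0 by (simp add: field_simps)
      then have "f (z + 1) = exp (- (pi * \<i> * (z + 1)\<^sup>2 / \<tau>)) *
          (exp (- (pi * \<i> * (- 1 / \<tau>)) - 2 * pi * \<i> * (- z / \<tau>)) * jtheta (- 1 / \<tau>) (- z / \<tau>))"
        unfolding f_def using jtheta_add_tau[OF \<tau>', of "- z / \<tau>"] by simp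
      also have "\<dots> = f z"
        unfolding f_def mult.assoc[symmetric] exp_add[symmetric] using \<tau>0
        by (simp add: field_simps power2_eq_square)
      finally show ?thesis .
    qed
    show "f (z + \<tau>) = exp (- (pi * \<i> * \<tau>) - 2 * pi * \<i> * z) * f z" for z
    proof -
      have "- (z + \<tau>) / \<tau> = - z / \<tau> + of_int (- 1)" using \<tau>0 by (simp add: field_simps)
      then have "f (z + \<tau>) = exp (- (pi * \<i> * (z + \<tau>)\<^sup>2 / \<tau>)) * jtheta (- 1 / \<tau>) (- z / \<tau>)"
        unfolding f_def using jtheta_add_int[of "- 1 / \<tau>" "- z / \<tau>" "- 1"] by simp
      also have "- (pi * \<i> * (z + \<tau>)\<^sup>2 / \<tau>) =
          (- (pi * \<i> * \<tau>) - 2 * pi * \<i> * z) + - (pi * \<i> * z\<^sup>2 / \<tau>)"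
        using \<tau>0 by (simp add: power2_eq_square) (simp add: field_simps)
      finally show ?thesis unfolding f_def exp_add by (simp only: mult.assoc)
    qed
  qed (rule nz)
  then show ?thesis by (simp add: f_def inv_factor_def)
qed

section \<open>Evaluation of formal series in the unit disc\<close>

definition cfps :: "int fps \<Rightarrow> complex fps" where
  "cfps f = Abs_fps (\<lambda>n. of_int (f $ n))"

lemma cfps_nth [simp]: "cfps f $ n = of_int (f $ n)" by (simp add: cfps_def)

lemma cfps_mult: "cfps (f * g) = cfps f * cfps g"
  by (rule fps_ext) (simp add: fps_mult_nth)

lemma cfps_add: "cfps (f + g) = cfps f + cfps g" by (rule fps_ext) simp
lemma cfps_diff: "cfps (f - g) = cfps f - cfps g" by (rule fps_ext) simp
lemma cfps_1 [simp]: "cfps 1 = 1" by (rule fps_ext) simp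
lemma cfps_const [simp]: "cfps (fps_const c) = fps_const (of_int c)" by (rule fps_ext) simp
lemma cfps_X [simp]: "cfps fps_X = fps_X" by (rule fps_ext) simp
lemma cfps_0 [simp]: "cfps 0 = 0" by (rule fps_ext) simp
lemma cfps_inject: "cfps f = cfps g \<Longrightarrow> f = g"
  by (rule fps_ext) (metis cfps_nth of_int_eq_iff)

definition disc_fps :: "int fps \<Rightarrow> bool" where
  "disc_fps f \<longleftrightarrow> fps_conv_radius (cfps f) \<ge> 1"

definition evl :: "int fps \<Rightarrow> complex \<Rightarrow> complex" where
  "evl f = eval_fps (cfps f)"

lemma disc_fps_less: "disc_fps f \<Longrightarrow> norm z < 1 \<Longrightarrow> ereal (norm z) < fps_conv_radius (cfps f)"
  unfolding disc_fps_def by (metis ereal_less(3) less_le_trans one_ereal_def ereal_less_eq(3) ereal_less(1) less_ereal.simps(1))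

lemma disc_fps_mult [intro]: "disc_fps f \<Longrightarrow> disc_fps g \<Longrightarrow> disc_fps (f * g)"
  unfolding disc_fps_def cfps_mult
  by (rule order_trans[OF _ fps_conv_radius_mult]) simp

lemma disc_fps_add [intro]: "disc_fps f \<Longrightarrow> disc_fps g \<Longrightarrow> disc_fps (f + g)"
  unfolding disc_fps_def cfps_add
  by (rule order_trans[OF _ fps_conv_radius_add]) simp

lemma disc_fps_diff [intro]: "disc_fps f \<Longrightarrow> disc_fps g \<Longrightarrow> disc_fps (f - g)"
  unfolding disc_fps_def cfps_diff
  by (rule order_trans[OF _ fps_conv_radius_diff]) simp

lemma disc_fps_const [intro, simp]: "disc_fps (fps_const c)" by (simp add: disc_fps_def)
lemma disc_fps_1 [intro, simp]: "disc_fps 1" by (simp add: disc_fps_def)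
lemma disc_fps_X [intro, simp]: "disc_fps fps_X" by (simp add: disc_fps_def)

lemma disc_fps_power [intro]: "disc_fps f \<Longrightarrow> disc_fps (f ^ n)"
  by (induction n) auto

lemma disc_fpsI:
  assumes "\<And>x::real. 0 < x \<Longrightarrow> x < 1 \<Longrightarrow> summable (\<lambda>n. \<bar>of_int (f $ n)\<bar> * x ^ n)"
  shows "disc_fps f"
  unfolding disc_fps_def fps_conv_radius_def
proof (rule conv_radius_geI_ex')
  fix r :: real assume r: "0 < r" "ereal r < 1"
  then have "summable (\<lambda>n. norm (fps_nth (cfps f) n * of_real r ^ n))"
    using assms[of r] by (simp add: norm_mult norm_power)
  then show "summable (\<lambda>n. fps_nth (cfps f) n * of_real r ^ n)"
    by (rule summable_norm_cancel)
qed

lemma disc_fps_bounded: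
  assumes "\<And>n. \<bar>f $ n\<bar> \<le> C" shows "disc_fps f"
proof (rule disc_fpsI)
  fix x :: real assume x: "0 < x" "x < 1"
  show "summable (\<lambda>n. \<bar>of_int (f $ n)\<bar> * x ^ n)"
  proof (rule summable_comparison_test')
    show "summable (\<lambda>n. real_of_int C * x ^ n)" using x by (intro summable_mult summable_geometric) simp
    fix n :: nat
    show "norm (\<bar>real_of_int (f $ n)\<bar> * x ^ n) \<le> real_of_int C * x ^ n"
      using assms[of n] x by (simp add: mult_right_mono flip: of_int_abs)
  qed
qed

lemma disc_phi [simp]: "disc_fps phi"
  by (rule disc_fps_bounded[of _ 2]) (auto simp: phi_def)
lemma disc_phim [simp]: "disc_fps phim"
  by (rule disc_fps_bounded[of _ 2]) (auto simp: phim_def phi_def abs_mult)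
lemma disc_psi [simp]: "disc_fps psi"
  by (rule disc_fps_bounded[of _ 1]) (auto simp: psi_def)
lemma disc_pbar [simp]: "disc_fps pbar_fps"
  by (rule disc_fpsI) (use summable_pbar in \<open>auto simp: pbar_fps_def\<close>)

lemma evl_mult: "disc_fps f \<Longrightarrow> disc_fps g \<Longrightarrow> norm z < 1 \<Longrightarrow> evl (f * g) z = evl f z * evl g z"
  unfolding evl_def cfps_mult by (intro eval_fps_mult disc_fps_less)
lemma evl_add: "disc_fps f \<Longrightarrow> disc_fps g \<Longrightarrow> norm z < 1 \<Longrightarrow> evl (f + g) z = evl f z + evl g z"
  unfolding evl_def cfps_add by (intro eval_fps_add disc_fps_less)
lemma evl_diff: "disc_fps f \<Longrightarrow> disc_fps g \<Longrightarrow> norm z < 1 \<Longrightarrow> evl (f - g) z = evl f z - evl g z"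
  unfolding evl_def cfps_diff by (intro eval_fps_diff disc_fps_less)
lemma evl_1 [simp]: "evl 1 z = 1" by (simp add: evl_def)
lemma evl_const [simp]: "evl (fps_const c) z = of_int c" by (simp add: evl_def)
lemma evl_X [simp]: "evl fps_X z = z" by (simp add: evl_def)
lemma evl_power: "disc_fps f \<Longrightarrow> norm z < 1 \<Longrightarrow> evl (f ^ n) z = evl f z ^ n"
  by (induction n) (simp_all add: evl_mult disc_fps_power)
lemma evl_at_0: "evl f 0 = of_int (f $ 0)" by (simp add: evl_def eval_fps_at_0)

lemma evl_holomorphic: "disc_fps f \<Longrightarrow> evl f holomorphic_on ball 0 1"
  unfolding evl_def
  by (rule holomorphic_on_eval_fps) (auto simp: dist_norm intro!: disc_fps_less)

lemma evl_sums:
  assumes "disc_fps f" "norm z < 1"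
  shows "(\<lambda>n. of_int (f $ n) * z ^ n) sums evl f z" "summable (\<lambda>n. norm (of_int (f $ n) * z ^ n))"
  using sums_eval_fps[OF disc_fps_less[OF assms]] norm_summable_fps[OF disc_fps_less[OF assms]]
  by (simp_all add: evl_def)

lemma evl_has_sum:
  assumes "disc_fps f" "norm z < 1"
  shows "((\<lambda>n. of_int (f $ n) * z ^ n) has_sum evl f z) UNIV"
  using evl_sums[OF assms] by (intro norm_summable_imp_has_sum)

lemma evl_eqI: "((\<lambda>n. of_int (f $ n) * z ^ n) has_sum S) UNIV \<Longrightarrow> evl f z = S"
  by (drule has_sum_imp_sums) (simp add: evl_def eval_fps_def sums_iff)

lemma power_less_one_disc: "norm z < 1 \<Longrightarrow> k > 0 \<Longrightarrow> norm (z ^ k :: complex) < 1"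
  by (simp add: norm_power power_less_one_iff)

lemma evl_dil:
  assumes "disc_fps f" "norm z < 1" "k > 0"
  shows "evl (dil k f) z = evl f (z ^ k)"
proof (rule evl_eqI)
  have "((\<lambda>n. of_int (f $ n) * (z ^ k) ^ n) has_sum evl f (z ^ k)) UNIV"
    using assms by (intro evl_has_sum power_less_one_disc)
  also have "(\<lambda>n. of_int (f $ n) * (z ^ k) ^ n) = (\<lambda>n. of_int (dil k f $ n) * z ^ n) \<circ> (\<lambda>n. k * n)"
    using assms by (auto simp: fps_nth_compose_X_power power_mult)
  also have "(\<dots> has_sum evl f (z ^ k)) UNIV \<longleftrightarrow> ((\<lambda>n. of_int (dil k f $ n) * z ^ n) has_sum evl f (z ^ k)) (range (\<lambda>n. k * n))"
    using assms by (subst has_sum_reindex) (auto simp: inj_def)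
  also have "\<dots> \<longleftrightarrow> ((\<lambda>n. of_int (dil k f $ n) * z ^ n) has_sum evl f (z ^ k)) UNIV"
    by (rule has_sum_cong_neutral) (auto simp: fps_nth_compose_X_power elim!: dvdE)
  finally show "((\<lambda>n. of_int (dil k f $ n) * z ^ n) has_sum evl f (z ^ k)) UNIV" .
qed

lemma rep_fps_has_sum:
  assumes S: "((\<lambda>a. x ^ u a) has_sum S) UNIV" and fin: "\<And>n. finite {a. u a = n}"
  shows "evl (rep_fps u) x = S"
proof (rule evl_eqI)
  have "((\<lambda>(n, a). x ^ n) has_sum S) (SIGMA n:UNIV. {a. u a = n})"
    using S by (subst has_sum_reindex_bij_witness[of _ "\<lambda>a. (u a, a)" snd UNIV "\<lambda>a. x ^ u a" _ S]) auto
  then show "((\<lambda>n. of_int (rep_fps u $ n) * x ^ n) has_sum S) UNIV"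
    by (rule has_sum_SigmaD) (auto intro!: has_sum_finiteI simp: fin rep_fps_def)
qed

lemma evl_phi:
  assumes "Im \<tau> > 0" shows "evl phi (nome \<tau>) = jtheta \<tau> 0"
  unfolding phi_eq_rep
proof (rule rep_fps_has_sum)
  have "nome \<tau> ^ nat (a\<^sup>2) = theta_term \<tau> 0 a" for a
  proof -
    have "of_nat (nat (a\<^sup>2)) = (of_int (a\<^sup>2) :: complex)" by simp
    then show ?thesis by (simp add: theta_term_def exp_of_nat_mult[symmetric] mult_ac)
  qed
  then show "((\<lambda>a. nome \<tau> ^ nat (a\<^sup>2)) has_sum jtheta \<tau> 0) UNIV"
    using jtheta_has_sum[OF assms, of 0] by simp
qed (rule finite_square_fibre)

lemma jtheta_add_one: "jtheta (\<tau> + 1) z = jtheta \<tau> (z + 1 / 2)"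
proof -
  have "theta_term (\<tau> + 1) z n = theta_term \<tau> (z + 1 / 2) n" for n
  proof -
    have "even (n\<^sup>2 - n)" by (simp add: power2_eq_square)
    then obtain k where k: "n\<^sup>2 = n + 2 * k" by (metis diff_add_cancel add.commute evenE)
    have "theta_term (\<tau> + 1) z n = theta_term \<tau> z n * exp (pi * \<i> * of_int (n\<^sup>2))"
      by (simp add: theta_term_def exp_add[symmetric] algebra_simps)
    also have "exp (pi * \<i> * of_int (n\<^sup>2)) = exp (pi * \<i> * of_int n) * exp (2 * of_real pi * \<i> * of_int k)"
      unfolding k by (simp add: exp_add[symmetric] algebra_simps)
    also have "theta_term \<tau> z n * \<dots> = theta_term \<tau> (z + 1 / 2) n"
      by (simp add: theta_term_def exp_add[symmetric] algebra_simps)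
    finally show ?thesis .
  qed
  then have "theta_term (\<tau> + 1) z = theta_term \<tau> (z + 1 / 2)" by (rule ext)
  then show ?thesis by (simp only: jtheta_def)
qed

lemma evl_phim_minus: "norm z < 1 \<Longrightarrow> evl phim z = evl phi (- z)"
proof (rule evl_eqI)
  assume z: "norm z < 1"
  have "of_int (phim $ n) * z ^ n = of_int (phi $ n) * (- z) ^ n" for n
    by (simp add: phim_def power_minus[of z])
  then show "((\<lambda>n. of_int (phim $ n) * z ^ n) has_sum evl phi (- z)) UNIV"
    using evl_has_sum[of phi "- z"] z by simp
qed

lemma nome_add_one: "nome (\<tau> + 1) = - nome \<tau>"
  by (simp add: ring_distribs exp_add)

lemma evl_phim:
  assumes "Im \<tau> > 0" shows "evl phim (nome \<tau>) = jtheta \<tau> (1 / 2)"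
proof -
  have "evl phim (nome \<tau>) = evl phi (nome (\<tau> + 1))"
    using assms by (subst evl_phim_minus) (auto simp: nome_add_one)
  also have "\<dots> = jtheta (\<tau> + 1) 0" using assms by (intro evl_phi) simp
  finally show ?thesis by (simp add: jtheta_add_one)
qed

lemma evl_pbar_phim: "norm z < 1 \<Longrightarrow> evl pbar_fps z * evl phim z = 1"
  by (metis disc_pbar disc_phim evl_1 evl_mult pbar_fps_mult_phim)

text \<open>
The reciprocal of \<open>\<theta>\<^sub>3\<close> is \<open>F(-q)\<close>, which converges in the unit disc.
\<close>

lemma jtheta_0_nonzero: 
  assumes "Im \<tau> > 0" shows "jtheta \<tau> 0 \<noteq> 0"
proof -
  have "jtheta \<tau> 0 = evl phim (- nome \<tau>)"
    using assms evl_phi[OF assms] by (simp add: evl_phim_minus)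
  moreover have "evl pbar_fps (- nome \<tau>) * evl phim (- nome \<tau>) = 1"
    using assms by (intro evl_pbar_phim) simp
  ultimately show ?thesis by force
qed

lemma jtheta_half_nonzero: "Im \<tau> > 0 \<Longrightarrow> jtheta \<tau> (1 / 2) \<noteq> 0"
  using jtheta_0_nonzero[of "\<tau> + 1"] by (simp add: jtheta_add_one)

section \<open>Gauss sums and theta functions near rational points\<close>

text \<open>
A point that tends to the rational number \<open>8 c / N\<close> as \<open>\<tau>\<close> tends to infinity. The factor 8 is the
period of \<open>exp (\<pi> i \<tau> / 4)\<close>, the variable in which \<open>\<theta>\<^sub>2\<close> is a power series.
\<close>

abbreviation cusp_point :: "nat \<Rightarrow> int \<Rightarrow> complex \<Rightarrow> complex" where
  "cusp_point N c \<tau> \<equiv> 8 * of_int c / of_nat N - 1 / (of_nat N ^ 2 * \<tau>)"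

text \<open>
The terms of \<open>\<theta>\<^sub>3\<close> for \<open>\<chi> = 0\<close> and of \<open>\<theta>\<^sub>2\<close> for \<open>\<chi> = 1\<close>, written with the summation
variable \<open>k - \<chi> / 2\<close>; the second version has an elliptic variable \<open>x\<close>.
\<close>

abbreviation half_term :: "nat \<Rightarrow> complex \<Rightarrow> int \<Rightarrow> complex" where
  "half_term \<chi> \<tau> k \<equiv> exp (pi * \<i> * (of_int (2 * k - int \<chi>) ^ 2 * \<tau> / 4))"

abbreviation half_term_at :: "nat \<Rightarrow> complex \<Rightarrow> complex \<Rightarrow> int \<Rightarrow> complex" where
  "half_term_at \<chi> \<tau> x k \<equiv>
     exp (pi * \<i> * (of_int (2 * k - int \<chi>) ^ 2 * \<tau> / 4 + of_int (2 * k - int \<chi>) * x))"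

definition zeta :: "nat \<Rightarrow> int \<Rightarrow> complex" where
  "zeta N a = exp (2 * pi * \<i> * of_int a / of_nat N)"

lemma zeta_add: "zeta N (a + b) = zeta N a * zeta N b"
  by (simp add: zeta_def exp_add[symmetric] add_divide_distrib ring_distribs)

lemma zeta_0 [simp]: "zeta N 0 = 1" by (simp add: zeta_def)

lemma zeta_multiple: "N > 0 \<Longrightarrow> zeta N (int N * k) = 1"
proof -
  assume "N > 0"
  then have "2 * pi * \<i> * of_int (int N * k) / of_nat N = 2 * of_real pi * \<i> * of_int k" by simp
  then show ?thesis unfolding zeta_def by (simp only: exp_2pi_int)
qed

lemma zeta_cong: 
  assumes "N > 0" "[a = b] (mod int N)" shows "zeta N a = zeta N b"
proof -
  obtain k where k: "a = b + int N * k" using assms(2) by (metis cong_iff_lin cong_sym)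
  show ?thesis unfolding k zeta_add zeta_multiple[OF assms(1)] by simp
qed

lemma zeta_power: "zeta N (a * int s) = zeta N a ^ s"
  by (induction s) (simp_all add: zeta_add ring_distribs)

lemma zeta_eq_1_iff: "N > 0 \<Longrightarrow> zeta N a = 1 \<longleftrightarrow> int N dvd a"
proof
  assume N: "N > 0" and "zeta N a = 1"
  then obtain n :: int where "2 * pi * of_int a / of_nat N = of_int (2 * n) * pi"
    by (auto simp: zeta_def exp_eq_1)
  then have "real_of_int a = of_int (n * int N)" using N by (simp add: field_simps)
  then have "a = n * int N" by linarith
  then show "int N dvd a" by simp
qed (auto simp: zeta_multiple)

lemma zeta_sum: 
  assumes "N > 0" shows "(\<Sum>s<N. zeta N (a * int s)) = (if int N dvd a then of_nat N else 0)"
proof (cases "int N dvd a")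
  case True
  then have "zeta N a = 1" using zeta_eq_1_iff[OF assms] by blast
  then show ?thesis using True by (simp add: zeta_power)
next
  case False
  then have "zeta N a \<noteq> 1" using zeta_eq_1_iff[OF assms] by blast
  moreover have "zeta N a ^ N = 1"
    using zeta_multiple[OF assms, of a] by (simp add: zeta_power[symmetric] mult.commute)
  ultimately show ?thesis using False by (simp add: zeta_power sum_gp_strict)
qed

lemma residue_sum_reindex:
  fixes f :: "int \<Rightarrow> 'a::comm_monoid_add"
  assumes N: "N > 0" and f: "\<And>x y. [x = y] (mod int N) \<Longrightarrow> f x = f y"
    and gh: "\<And>x. [g (h x) = x] (mod int N)" "\<And>x. [h (g x) = x] (mod int N)"
    and cg: "\<And>x y. [x = y] (mod int N) \<Longrightarrow> [g x = g y] (mod int N)"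
       "\<And>x y. [x = y] (mod int N) \<Longrightarrow> [h x = h y] (mod int N)"
  shows "(\<Sum>s<N. f (g (int s))) = (\<Sum>s<N. f (int s))"
proof (rule sum.reindex_bij_witness[of _ "\<lambda>s. nat (h (int s) mod int N)" "\<lambda>s. nat (g (int s) mod int N)"])
  have m: "int (nat (x mod int N)) = x mod int N" for x using N by simp
  have c: "[x mod int N = x] (mod int N)" for x by (simp add: Cong.cong_def)
  fix s assume s: "s \<in> {..<N}"
  show "nat (g (int s) mod int N) \<in> {..<N}" "nat (h (int s) mod int N) \<in> {..<N}"
    using N by (auto simp: nat_less_iff)
  have "[h (g (int s) mod int N) = int s] (mod int N)"
    using cg(2)[OF c, of "g (int s)"] gh(2)[of "int s"] cong_trans by blast
  then have "h (g (int s) mod int N) mod int N = int s"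
    using s by (metis Cong.cong_def lessThan_iff mod_less of_nat_mod)
  then show "nat (h (int (nat (g (int s) mod int N))) mod int N) = s"
    unfolding m by simp
  have "[g (h (int s) mod int N) = int s] (mod int N)"
    using cg(1)[OF c, of "h (int s)"] gh(1)[of "int s"] cong_trans by blast
  then have "g (h (int s) mod int N) mod int N = int s"
    using s by (metis Cong.cong_def lessThan_iff mod_less of_nat_mod)
  then show "nat (g (int (nat (h (int s) mod int N))) mod int N) = s"
    unfolding m by simp
  show "f (int (nat (g (int s) mod int N))) = f (g (int s))"
    unfolding m by (rule f[OF c])
qed

lemma residue_sum_shift:
  fixes f :: "int \<Rightarrow> 'a::comm_monoid_add"
  assumes N: "N > 0" and f: "\<And>x y. [x = y] (mod int N) \<Longrightarrow> f x = f y"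
  shows "(\<Sum>s<N. f (int s + t)) = (\<Sum>s<N. f (int s))"
  by (rule residue_sum_reindex[OF N f, where h = "\<lambda>x. x - t"]) (auto intro: cong_add cong_diff)

lemma residue_sum_unit:
  fixes f :: "int \<Rightarrow> 'a::comm_monoid_add"
  assumes N: "N > 0" and f: "\<And>x y. [x = y] (mod int N) \<Longrightarrow> f x = f y" and a: "coprime a (int N)"
  shows "(\<Sum>s<N. f (a * int s)) = (\<Sum>s<N. f (int s))"
proof -
  obtain b where b: "[a * b = 1] (mod int N)" using a by (metis cong_solve_coprime_int)
  have "[a * (b * x) = x] (mod int N)" "[b * (a * x) = x] (mod int N)" for x
    using cong_scalar_right[OF b, of x] by (simp_all add: mult_ac)
  then show ?thesis
    by (intro residue_sum_reindex[OF N f, where h = "\<lambda>x. b * x"]) (auto intro: cong_scalar_left)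
qed

definition gauss :: "nat \<Rightarrow> int \<Rightarrow> complex" where
  "gauss N a = (\<Sum>s<N. zeta N (a * int s ^ 2))"

lemma gauss_16:
  assumes "odd N" shows "gauss N (16 * a) = gauss N a"
proof -
  have N: "N > 0" using assms by (simp add: odd_pos)
  have "coprime 4 (int N)" using assms
    by (metis coprime_power_left_iff coprime_left_2_iff_odd even_of_nat num_double numeral_times_numeral power2_eq_square zero_less_numeral)
  from residue_sum_unit[OF N _ this, of "\<lambda>x. zeta N (a * x ^ 2)"]
  have "(\<Sum>s<N. zeta N (a * (4 * int s) ^ 2)) = gauss N a"
    unfolding gauss_def using N by (auto intro!: zeta_cong cong_scalar_left cong_pow)
  then show ?thesis by (simp add: gauss_def power_mult_distrib mult_ac)
qed

text \<open>
Completing the square: as \<open>64 c b \<equiv> -1\<close> modulo \<open>N\<close>, the exponent is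
\<open>16 c (s - 2 b \<kappa>)^2 + b \<kappa>^2\<close> modulo \<open>N\<close>.
\<close>

lemma quadratic_sum:
  assumes N: "N > 0" and b: "int N dvd 64 * c * b + 1"
  shows "(\<Sum>s<N. zeta N (16 * c * int s ^ 2 + \<kappa> * int s)) = zeta N (b * \<kappa>\<^sup>2) * gauss N (16 * c)"
proof -
  obtain r where r: "64 * c * b = int N * r - 1" using b by (metis add_diff_cancel_right' dvdE)
  have "zeta N (16 * c * int s ^ 2 + \<kappa> * int s) = zeta N (b * \<kappa>\<^sup>2) * zeta N (16 * c * (int s + - 2 * b * \<kappa>)\<^sup>2)" for s
  proof -
    have "16 * c * (int s + - 2 * b * \<kappa>)\<^sup>2 + b * \<kappa>\<^sup>2
        = 16 * c * int s ^ 2 - (64 * c * b) * \<kappa> * int s + (64 * c * b) * b * \<kappa>\<^sup>2 + b * \<kappa>\<^sup>2"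
      by (simp add: power2_eq_square algebra_simps)
    also have "\<dots> = (16 * c * int s ^ 2 + \<kappa> * int s) + int N * (r * b * \<kappa>\<^sup>2 - r * \<kappa> * int s)"
      unfolding r by (simp add: algebra_simps)
    finally have "zeta N (16 * c * (int s + - 2 * b * \<kappa>)\<^sup>2 + b * \<kappa>\<^sup>2)
        = zeta N ((16 * c * int s ^ 2 + \<kappa> * int s) + int N * (r * b * \<kappa>\<^sup>2 - r * \<kappa> * int s))"
      by (simp only:)
    then show ?thesis
      unfolding zeta_add[of _ "16 * c * (int s + - 2 * b * \<kappa>)\<^sup>2"]
        zeta_add[of _ "16 * c * int s ^ 2 + \<kappa> * int s"] zeta_multiple[OF N]
      by (simp only: mult_1_right mult.commute[of "zeta N (b * \<kappa>\<^sup>2)"])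
  qed
  then have "(\<Sum>s<N. zeta N (16 * c * int s ^ 2 + \<kappa> * int s)) =
      zeta N (b * \<kappa>\<^sup>2) * (\<Sum>s<N. zeta N (16 * c * (int s + - 2 * b * \<kappa>)\<^sup>2))"
    by (simp add: sum_distrib_left)
  also have "(\<Sum>s<N. zeta N (16 * c * (int s + - 2 * b * \<kappa>)\<^sup>2)) = gauss N (16 * c)"
    unfolding gauss_def using N
    by (intro residue_sum_shift[OF N, of "\<lambda>x. zeta N (16 * c * x\<^sup>2)"])
       (auto intro!: zeta_cong cong_scalar_left cong_pow)
  finally show ?thesis .
qed

text \<open>
Write \<open>s = u + l v\<close>. The sum over \<open>v\<close> kills every \<open>u \<noteq> 0\<close>, and each of the \<open>l\<close> terms with
\<open>u = 0\<close> is 1.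
\<close>

lemma gauss_prime_square:
  assumes l: "prime l" and a: "\<not> int l dvd 2 * a"
  shows "gauss (l\<^sup>2) a = of_nat l"
proof -
  have l0: "l > 0" using l prime_gt_0_nat by blast
  have "gauss (l\<^sup>2) a = (\<Sum>(u, v)\<in>{..<l} \<times> {..<l}. zeta (l\<^sup>2) (a * int (u + l * v) ^ 2))"
    unfolding gauss_def
  proof (rule sum.reindex_bij_witness[of _ "\<lambda>(u, v). u + l * v" "\<lambda>s. (s mod l, s div l)"])
    fix s assume "s \<in> {..<l\<^sup>2}"
    then show "(s mod l, s div l) \<in> {..<l} \<times> {..<l}"
      using l0 by (auto simp: power2_eq_square less_mult_imp_div_less)
    show "(case (s mod l, s div l) of (u, v) \<Rightarrow> u + l * v) = s" by simp
    show "(case (s mod l, s div l) of (u, v) \<Rightarrow> zeta (l\<^sup>2) (a * int (u + l * v) ^ 2)) = zeta (l\<^sup>2) (a * int s ^ 2)"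
      by (simp only: prod.case mod_mult_div_eq)
  next
    fix p assume "p \<in> {..<l} \<times> {..<l}"
    then obtain u v where p: "p = (u, v)" "u < l" "v < l" by auto
    have "u + l * v < l * (v + 1)" using p by simp
    also have "\<dots> \<le> l * l" using p by (intro mult_le_mono2) simp
    finally show "(case p of (u, v) \<Rightarrow> u + l * v) \<in> {..<l\<^sup>2}"
      by (simp add: p power2_eq_square)
    show "((case p of (u, v) \<Rightarrow> u + l * v) mod l, (case p of (u, v) \<Rightarrow> u + l * v) div l) = p"
      using p l0 by simp
  qed
  also have "\<dots> = (\<Sum>u<l. \<Sum>v<l. zeta (l\<^sup>2) (a * int (u + l * v) ^ 2))"
    by (simp add: sum.cartesian_product)
  also have "\<dots> = (\<Sum>u<l. zeta (l\<^sup>2) (a * int u ^ 2) * (\<Sum>v<l. zeta l ((2 * a * int u) * int v)))"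
  proof (rule sum.cong[OF refl])
    fix u
    have "zeta (l\<^sup>2) (a * int (u + l * v) ^ 2) = zeta (l\<^sup>2) (a * int u ^ 2) * zeta l ((2 * a * int u) * int v)" for v
    proof -
      have "a * int (u + l * v) ^ 2 = a * int u ^ 2 + (int l * ((2 * a * int u) * int v) + int (l\<^sup>2) * (a * int v ^ 2))"
        by (simp add: power2_eq_square algebra_simps)
      moreover have "zeta (l\<^sup>2) (int l * x) = zeta l x" for x
        using l0 by (simp add: zeta_def power2_eq_square mult_ac)
      ultimately show ?thesis using l0 by (simp only: zeta_add zeta_multiple zero_less_power mult_1_right)
    qed
    then show "(\<Sum>v<l. zeta (l\<^sup>2) (a * int (u + l * v) ^ 2)) = zeta (l\<^sup>2) (a * int u ^ 2) * (\<Sum>v<l. zeta l ((2 * a * int u) * int v))"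
      by (simp add: sum_distrib_left)
  qed
  also have "\<dots> = (\<Sum>u<l. if u = 0 then of_nat l else 0)"
  proof (rule sum.cong[OF refl])
    fix u assume u: "u \<in> {..<l}"
    have "int l dvd 2 * a * int u \<longleftrightarrow> u = 0"
    proof
      assume "int l dvd 2 * a * int u"
      then have "int l dvd int u" using a l by (metis prime_dvd_multD prime_nat_int_transfer)
      then show "u = 0" using u by (metis dvd_imp_le int_dvd_int_iff lessThan_iff not_gr_zero not_le)
    qed simp
    then show "zeta (l\<^sup>2) (a * int u ^ 2) * (\<Sum>v<l. zeta l ((2 * a * int u) * int v)) = (if u = 0 then of_nat l else 0)"
      unfolding zeta_sum[OF l0] by simp
  qed
  also have "\<dots> = of_nat l" using l0 by simp
  finally show ?thesis .
qed

text \<open>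
The theta series over \<open>k - \<chi> / 2\<close> instead of \<open>k\<close>, with \<open>x\<close> as elliptic variable.
\<close>

definition theta_shift :: "nat \<Rightarrow> complex \<Rightarrow> complex \<Rightarrow> complex" where
  "theta_shift \<chi> \<tau> x = exp (pi * \<i> * (of_nat \<chi> * \<tau> / 4 - of_nat \<chi> * x)) * jtheta \<tau> (x - of_nat \<chi> * \<tau> / 2)"

text \<open>
Treating \<open>\<chi> = 0\<close> and \<open>\<chi> = 1\<close> together covers both cusps at once. This is \<open>\<theta>\<^sub>3\<close> or
\<open>\<theta>\<^sub>4\<close>, and the next definition is \<open>\<theta>\<^sub>3\<close> or \<open>\<theta>\<^sub>2\<close>; inversion exchanges them, since it turns the
sign \<open>(-1)^(\<chi> n)\<close> into a shift of the summation by \<open>\<chi> / 2\<close>.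
\<close>

definition theta34 :: "nat \<Rightarrow> complex \<Rightarrow> complex" where "theta34 \<chi> \<tau> = jtheta \<tau> (of_nat \<chi> / 2)"
definition theta32 :: "nat \<Rightarrow> complex \<Rightarrow> complex" where "theta32 \<chi> \<tau> = theta_shift \<chi> \<tau> 0"

lemma theta_shift_has_sum:
  assumes "Im \<tau> > 0" "\<chi> = 0 \<or> \<chi> = 1"
  shows "((\<lambda>k. half_term_at \<chi> \<tau> x k) has_sum theta_shift \<chi> \<tau> x) UNIV"
proof -
  have "((\<lambda>k. exp (pi * \<i> * (of_nat \<chi> * \<tau> / 4 - of_nat \<chi> * x)) * theta_term \<tau> (x - of_nat \<chi> * \<tau> / 2) k) has_sum theta_shift \<chi> \<tau> x) UNIV"
    unfolding theta_shift_def by (intro has_sum_cmult_right jtheta_has_sum assms)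
  also have "(\<lambda>k. exp (pi * \<i> * (of_nat \<chi> * \<tau> / 4 - of_nat \<chi> * x)) * theta_term \<tau> (x - of_nat \<chi> * \<tau> / 2) k)
     = (\<lambda>k. half_term_at \<chi> \<tau> x k)"
    using assms(2) unfolding theta_term_def exp_add[symmetric]
    by (intro ext arg_cong[where f = exp]) (elim disjE; simp add: power2_eq_square; simp add: field_simps)
  finally show ?thesis .
qed

text \<open>
Poisson summation for a Gaussian, which is the inversion formula at a general argument \<open>z\<close>.
\<close>

lemma gaussian_poisson:
  assumes \<tau>: "Im \<tau> > 0" and \<chi>: "\<chi> = 0 \<or> \<chi> = 1"
  shows "((\<lambda>m. exp (pi * \<i> * (- ((of_int m + x)\<^sup>2 / \<tau>) + of_nat \<chi> * of_int m))) has_sum inv_factor \<tau> * theta_shift \<chi> \<tau> x) UNIV"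
proof -
  have \<tau>0: "\<tau> \<noteq> 0" using \<tau> by auto
  define z where "z = x - of_nat \<chi> * \<tau> / 2"
  have z: "- z / \<tau> = - x / \<tau> + of_nat \<chi> / 2" using \<tau>0 by (simp add: z_def field_simps)
  have "((\<lambda>m. exp (pi * \<i> * (- (x\<^sup>2 / \<tau>))) * theta_term (- 1 / \<tau>) (- z / \<tau>) m) has_sum
      exp (pi * \<i> * (- (x\<^sup>2 / \<tau>))) * jtheta (- 1 / \<tau>) (- z / \<tau>)) UNIV"
    by (intro has_sum_cmult_right jtheta_has_sum Im_minus_inverse \<tau>)
  also have "(\<lambda>m. exp (pi * \<i> * (- (x\<^sup>2 / \<tau>))) * theta_term (- 1 / \<tau>) (- z / \<tau>) m) =
      (\<lambda>m. exp (pi * \<i> * (- ((of_int m + x)\<^sup>2 / \<tau>) + of_nat \<chi> * of_int m)))"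
  proof
    fix m
    have "- (x\<^sup>2 / \<tau>) + (of_int m ^ 2 * (- 1 / \<tau>) + 2 * of_int m * (- z / \<tau>)) =
        - ((of_int m + x)\<^sup>2 / \<tau>) + of_nat \<chi> * of_int m"
      unfolding z using \<tau>0 by (simp add: power2_eq_square) (simp add: field_simps)
    then show "exp (pi * \<i> * (- (x\<^sup>2 / \<tau>))) * theta_term (- 1 / \<tau>) (- z / \<tau>) m =
       exp (pi * \<i> * (- ((of_int m + x)\<^sup>2 / \<tau>) + of_nat \<chi> * of_int m))"
      unfolding theta_term_def exp_add[symmetric] ring_distribs[symmetric] by (simp only:)
  qed
  also have "exp (pi * \<i> * (- (x\<^sup>2 / \<tau>))) * jtheta (- 1 / \<tau>) (- z / \<tau>) = inv_factor \<tau> * theta_shift \<chi> \<tau> x"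
  proof -
    have "(of_nat \<chi> :: complex) * of_nat \<chi> = of_nat \<chi>" using \<chi> by auto
    then have "pi * \<i> * (- (x\<^sup>2 / \<tau>)) = pi * \<i> * (of_nat \<chi> * \<tau> / 4 - of_nat \<chi> * x) + - (pi * \<i> * z\<^sup>2 / \<tau>)"
      unfolding z_def using \<tau>0 by (simp add: power2_eq_square) (simp add: field_simps)
    then have "exp (pi * \<i> * (- (x\<^sup>2 / \<tau>))) = exp (pi * \<i> * (of_nat \<chi> * \<tau> / 4 - of_nat \<chi> * x)) * exp (- (pi * \<i> * z\<^sup>2 / \<tau>))"
      by (simp only: exp_add)
    then show ?thesis
      using jtheta_inversion[OF \<tau> jtheta_0_nonzero[OF \<tau>], of z]
      by (simp add: theta_shift_def z_def[symmetric])
  qed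
  finally show ?thesis .
qed

lemma has_sum_sum_finite:
  fixes f :: "'b \<Rightarrow> 'a \<Rightarrow> complex"
  assumes "finite I" "\<And>i. i \<in> I \<Longrightarrow> (f i has_sum S i) A"
  shows "((\<lambda>x. \<Sum>i\<in>I. f i x) has_sum (\<Sum>i\<in>I. S i)) A"
  using assms by (induction I rule: finite_induct) (auto intro!: has_sum_add)

lemma Im_cusp_point:
  assumes "Im \<tau> > 0" "N > 0" 
  shows "Im (cusp_point N c \<tau>) > 0"
proof -
  have "Im (of_nat N ^ 2 * \<tau>) > 0"
  proof -
    have "of_nat N ^ 2 * \<tau> = of_real (real N ^ 2) * \<tau>" by simp
    then show ?thesis using assms by (simp del: of_real_power of_real_of_nat_eq)
  qed
  then have "Im (- 1 / (of_nat N ^ 2 * \<tau>)) > 0" by (rule Im_minus_inverse)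
  moreover have "8 * of_int c / of_nat N = complex_of_real (8 * of_int c / of_nat N)" by simp
  ultimately show ?thesis by (simp only: minus_complex.simps Im_complex_of_real) simp
qed

text \<open>
Split the summation variable as \<open>N m + 2 s\<close> with \<open>s\<close> a residue modulo \<open>N\<close>. The translation by
\<open>8 c / N\<close> contributes a root of unity that depends on \<open>s\<close> only, the sign depends on \<open>m\<close> only, and Poisson
summation applies to the sum over \<open>m\<close> in each class.
\<close>

lemma theta34_near_cusp:
  assumes \<tau>: "Im \<tau> > 0" and \<chi>: "\<chi> = 0 \<or> \<chi> = 1" and N: "odd N"
  shows "((\<lambda>k. inv_factor \<tau> * (half_term \<chi> \<tau> k *
            (\<Sum>s<N. zeta N (16 * c * int s ^ 2 + (2 * k - int \<chi>) * int s))))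
     has_sum theta34 \<chi> (cusp_point N c \<tau>)) UNIV"
proof -
  have N0: "N > 0" using N by (simp add: odd_pos)
  have \<tau>0: "\<tau> \<noteq> 0" using \<tau> by auto
  define u where "u = cusp_point N c \<tau>"
  have u: "Im u > 0" unfolding u_def by (rule Im_cusp_point[OF \<tau> N0])
  obtain h where h: "N = 2 * h + 1" using N by (metis oddE)
  define F where "F = (\<lambda>(s, m). zeta N (16 * c * int s ^ 2) * exp (pi * \<i> * (- ((of_int m + 2 * of_nat s / of_nat N)\<^sup>2 / \<tau>) + of_nat \<chi> * of_int m)))"
  have F: "theta_term u (of_nat \<chi> / 2) (int N * m + 2 * int s) = F (s, m)" for s m
  proof -
    \<comment> \<open>The integer whose double collects the parts of the exponent that the exponential does not see.\<close>
    define M where "M = 4 * c * int N * m ^ 2 + 16 * c * m * int s + int \<chi> * int h * m + int \<chi> * int s"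
    have "of_int (int N * m + 2 * int s) ^ 2 * u + 2 * of_int (int N * m + 2 * int s) * (of_nat \<chi> / 2)
      = 2 * of_int M + 2 * (of_int (16 * c * int s ^ 2) / of_nat N) + (- ((of_int m + 2 * of_nat s / of_nat N)\<^sup>2 / \<tau>) + of_nat \<chi> * of_int m)"
    proof -
      have "of_int (int N * m + 2 * int s) ^ 2 * (8 * of_int c / of_nat N) = 
          8 * of_int c * of_nat N * of_int m ^ 2 + 32 * of_int c * of_int m * of_nat s + (32 * of_int c * of_nat s ^ 2 / of_nat N :: complex)"
        using N0 by (simp add: field_simps power2_eq_square)
      moreover have "of_int (int N * m + 2 * int s) ^ 2 * (1 / (of_nat N ^ 2 * \<tau>)) = (of_int m + 2 * of_nat s / of_nat N)\<^sup>2 / \<tau>"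
      proof -
        have "(of_int m + 2 * of_nat s / of_nat N :: complex) = of_int (int N * m + 2 * int s) / of_nat N"
          using N0 by (simp add: field_simps)
        then show ?thesis by (simp add: power_divide)
      qed
      moreover have "(of_nat N :: complex) * of_int m * of_nat \<chi> = of_nat \<chi> * of_int m + 2 * (of_nat \<chi> * of_nat h * of_int m)"
        by (simp add: h algebra_simps)
      moreover have "(of_int m :: complex) * (of_nat N * (of_nat \<chi> * 2)) = of_int m * (of_nat \<chi> * 2) + of_int m * (of_nat \<chi> * (of_nat h * 4))"
        by (simp add: h algebra_simps)
      ultimately show ?thesis unfolding u_def M_def
        by (simp add: ring_distribs right_diff_distrib) (simp add: algebra_simps)
    qed
    then have "theta_term u (of_nat \<chi> / 2) (int N * m + 2 * int s) = 
       exp (pi * \<i> * (2 * of_int M + 2 * (of_int (16 * c * int s ^ 2) / of_nat N) + (- ((of_int m + 2 * of_nat s / of_nat N)\<^sup>2 / \<tau>) + of_nat \<chi> * of_int m)))"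
      unfolding theta_term_def by (simp only:)
    also have "\<dots> = exp (2 * of_real pi * \<i> * of_int M) * F (s, m)"
      unfolding F_def zeta_def prod.case exp_add[symmetric] mult.assoc[symmetric]
      by (rule arg_cong[where f = exp]) (simp add: ring_distribs mult_ac)
    finally show ?thesis by (simp only: exp_2pi_int mult_1_left)
  qed
  have "(theta_term u (of_nat \<chi> / 2) has_sum theta34 \<chi> u) UNIV"
    unfolding theta34_def by (rule jtheta_has_sum[OF u])
  \<comment> \<open>Since \<open>h + 1\<close> is the inverse of 2 modulo \<open>N\<close>, the class of \<open>n = N m + 2 s\<close> is recovered from \<open>s = n (h + 1)\<close> modulo \<open>N\<close>.\<close>
  then have "(F has_sum theta34 \<chi> u) ({..<N} \<times> UNIV)"
  proof (subst (asm) has_sum_reindex_bij_witness[of UNIV "\<lambda>(s, m). int N * m + 2 * int s"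
        "\<lambda>n. (nat ((n * int (h + 1)) mod int N), (n - 2 * ((n * int (h + 1)) mod int N)) div int N)"
        "{..<N} \<times> UNIV" F _ "theta34 \<chi> u"])
    fix n :: int
    define s where "s = (n * int (h + 1)) mod int N"
    have s: "0 \<le> s" "s < int N" using N0 by (auto simp: s_def)
    have "[2 * s = 2 * (n * int (h + 1))] (mod int N)"
      unfolding s_def by (rule cong_scalar_left) (simp add: Cong.cong_def)
    also have "2 * (n * int (h + 1)) = n * (2 * int (h + 1))" by simp
    also have "n * (2 * int (h + 1)) = n + n * int N" by (simp add: h algebra_simps)
    also have "[n + n * int N = n] (mod int N)" by (simp add: Cong.cong_def)
    finally have "int N dvd n - 2 * s" by (metis cong_iff_dvd_diff cong_sym)
    then have d: "int N * ((n - 2 * s) div int N) = n - 2 * s" by simp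
    show n: "(case (nat (n * int (h + 1) mod int N), (n - 2 * (n * int (h + 1) mod int N)) div int N) of
           (s, m) \<Rightarrow> int N * m + 2 * int s) = n"
      unfolding s_def[symmetric] using s d by simp
    show "(nat (n * int (h + 1) mod int N), (n - 2 * (n * int (h + 1) mod int N)) div int N) \<in> {..<N} \<times> UNIV"
      unfolding s_def[symmetric] using s by auto
    show "F (nat (n * int (h + 1) mod int N), (n - 2 * (n * int (h + 1) mod int N)) div int N) =
         theta_term u (of_nat \<chi> / 2) n"
      using F[of "(n - 2 * (n * int (h + 1) mod int N)) div int N" "nat (n * int (h + 1) mod int N)"] n
      by simp
  next
    fix p :: "nat \<times> int" assume "p \<in> {..<N} \<times> UNIV"
    then obtain s m where p: "p = (s, m)" "s < N" by auto
    have "(int N * m + 2 * int s) * int (h + 1) = int s + int N * (m * int (h + 1) + int s)"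
      by (simp add: h algebra_simps)
    then have "(int N * m + 2 * int s) * int (h + 1) mod int N = int s mod int N" by simp
    then have e: "(int N * m + 2 * int s) * int (h + 1) mod int N = int s" using p by simp
    show "(nat ((case p of (s, m) \<Rightarrow> int N * m + 2 * int s) * int (h + 1) mod int N),
          ((case p of (s, m) \<Rightarrow> int N * m + 2 * int s) - 2 * ((case p of (s, m) \<Rightarrow> int N * m + 2 * int s) * int (h + 1) mod int N)) div int N) = p"
      unfolding p(1) prod.case e using N0 by simp
  qed auto
  then have sum: "((\<lambda>s. zeta N (16 * c * int s ^ 2) * (inv_factor \<tau> * theta_shift \<chi> \<tau> (2 * of_nat s / of_nat N))) has_sum theta34 \<chi> u) {..<N}"
  proof (rule has_sum_SigmaD)
    fix s
    show "((\<lambda>m. F (s, m)) has_sum zeta N (16 * c * int s ^ 2) * (inv_factor \<tau> * theta_shift \<chi> \<tau> (2 * of_nat s / of_nat N))) UNIV"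
      unfolding F_def prod.case by (intro has_sum_cmult_right gaussian_poisson \<tau> \<chi>)
  qed
  then have theta34: "theta34 \<chi> u = (\<Sum>s<N. zeta N (16 * c * int s ^ 2) * (inv_factor \<tau> * theta_shift \<chi> \<tau> (2 * of_nat s / of_nat N)))"
    by (rule has_sum_unique[OF _ has_sum_finite[OF finite_lessThan]])
  have "((\<lambda>k. \<Sum>s<N. zeta N (16 * c * int s ^ 2) * (inv_factor \<tau> * half_term_at \<chi> \<tau> (2 * of_nat s / of_nat N) k))
      has_sum theta34 \<chi> u) UNIV"
    unfolding theta34 by (intro has_sum_sum_finite has_sum_cmult_right theta_shift_has_sum \<tau> \<chi>) auto
  also have "(\<lambda>k. \<Sum>s<N. zeta N (16 * c * int s ^ 2) * (inv_factor \<tau> * half_term_at \<chi> \<tau> (2 * of_nat s / of_nat N) k))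
     = (\<lambda>k. inv_factor \<tau> * (half_term \<chi> \<tau> k *
            (\<Sum>s<N. zeta N (16 * c * int s ^ 2 + (2 * k - int \<chi>) * int s))))"
  proof
    fix k
    have "half_term_at \<chi> \<tau> (2 * of_nat s / of_nat N) k
       = half_term \<chi> \<tau> k * zeta N ((2 * k - int \<chi>) * int s)" for s
      unfolding zeta_def exp_add[symmetric]
      by (rule arg_cong[where f = exp]) (simp add: ring_distribs mult_ac)
    then show "(\<Sum>s<N. zeta N (16 * c * int s ^ 2) * (inv_factor \<tau> * half_term_at \<chi> \<tau> (2 * of_nat s / of_nat N) k)) =
         inv_factor \<tau> * (half_term \<chi> \<tau> k *
            (\<Sum>s<N. zeta N (16 * c * int s ^ 2 + (2 * k - int \<chi>) * int s)))"
      by (simp add: sum_distrib_left zeta_add mult_ac)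
  qed
  finally show ?thesis unfolding u_def .
qed

lemma Im_of_nat_mult_pos: "Im \<tau> > 0 \<Longrightarrow> N > 0 \<Longrightarrow> Im (of_nat N * \<tau>) > 0"
  by simp

lemma theta34_0: "theta34 0 \<tau> = jtheta \<tau> 0" by (simp add: theta34_def)
lemma theta32_0: "theta32 0 \<tau> = jtheta \<tau> 0" by (simp add: theta32_def theta_shift_def)

lemma inv_factor_nonzero: "Im \<tau> > 0 \<Longrightarrow> inv_factor \<tau> \<noteq> 0"
  using jtheta_0_nonzero[of \<tau>] jtheta_0_nonzero[OF Im_minus_inverse, of \<tau>] by (simp add: inv_factor_def)

lemma inv_factor_inverse: "Im \<tau> > 0 \<Longrightarrow> inv_factor (- 1 / \<tau>) * inv_factor \<tau> = 1"
  using jtheta_0_nonzero[of \<tau>] jtheta_0_nonzero[OF Im_minus_inverse, of \<tau>] by (simp add: inv_factor_def)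

text \<open>
Apply the previous expansion with \<open>c = 0\<close>: the character sum leaves only the multiples of \<open>N\<close>, which give the
theta series at \<open>N^2 \<tau>\<close>.
\<close>

lemma inv_factor_scale:
  assumes \<tau>: "Im \<tau> > 0" and N: "odd N"
  shows "inv_factor (of_nat N ^ 2 * \<tau>) = of_nat N * inv_factor \<tau>"
proof -
  have N0: "N > 0" using N by (simp add: odd_pos)
  have \<tau>0: "\<tau> \<noteq> 0" using \<tau> by auto
  define \<tau>' where "\<tau>' = of_nat N ^ 2 * \<tau>"
  have \<tau>': "Im \<tau>' > 0" using Im_of_nat_mult_pos[OF \<tau>, of "N ^ 2"] N0 by (simp add: \<tau>'_def)
  have "int N dvd 2 * k \<longleftrightarrow> int N dvd k" for k
    using N by (metis coprime_commute coprime_dvd_mult_right_iff coprime_left_2_iff_odd even_of_nat)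
  then have s: "(\<Sum>s<N. zeta N (16 * 0 * int s ^ 2 + (2 * k - int 0) * int s)) = (if int N dvd k then of_nat N else 0)" for k
    using zeta_sum[OF N0, of "2 * k"] by simp
  have "((\<lambda>k. inv_factor \<tau> * (half_term 0 \<tau> k * (if int N dvd k then of_nat N else 0)))
      has_sum theta34 0 (cusp_point N 0 \<tau>)) UNIV"
    using theta34_near_cusp[OF \<tau> _ N, of 0 0] unfolding s by simp
  also have "theta34 0 (cusp_point N 0 \<tau>) = jtheta (- 1 / \<tau>') 0"
    by (simp add: theta34_def \<tau>'_def)
  also have "((\<lambda>k. inv_factor \<tau> * (half_term 0 \<tau> k * (if int N dvd k then of_nat N else 0)))
      has_sum jtheta (- 1 / \<tau>') 0) UNIV \<longleftrightarrow>
     ((\<lambda>k. inv_factor \<tau> * (half_term 0 \<tau> k * of_nat N))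
      has_sum jtheta (- 1 / \<tau>') 0) (range (\<lambda>k. int N * k))"
    by (rule has_sum_cong_neutral) (auto elim!: dvdE)
  finally have "((\<lambda>k. of_nat N * inv_factor \<tau> * theta_term \<tau>' 0 k) has_sum jtheta (- 1 / \<tau>') 0) UNIV"
    using N0 by (subst (asm) has_sum_reindex)
      (auto simp: inj_def o_def theta_term_def \<tau>'_def power_mult_distrib mult_ac)
  moreover have "((\<lambda>k. of_nat N * inv_factor \<tau> * theta_term \<tau>' 0 k) has_sum of_nat N * inv_factor \<tau> * jtheta \<tau>' 0) UNIV"
    by (intro has_sum_cmult_right jtheta_has_sum \<tau>')
  ultimately have "jtheta (- 1 / \<tau>') 0 = of_nat N * inv_factor \<tau> * jtheta \<tau>' 0"
    by (rule has_sum_unique)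
  then show ?thesis using jtheta_0_nonzero[OF \<tau>'] by (simp add: inv_factor_def \<tau>'_def[symmetric])
qed

text \<open>
By completing the square, the character sum contributes the Gauss sum and exactly the phase of a translation by
\<open>8 b / N\<close>.
\<close>

lemma theta34_cusp_transform:
  assumes \<tau>: "Im \<tau> > 0" and \<chi>: "\<chi> = 0 \<or> \<chi> = 1" and N: "odd N" and b: "int N dvd 64 * c * b + 1"
  shows "theta34 \<chi> (cusp_point N c \<tau>) =
         inv_factor \<tau> * gauss N c * theta32 \<chi> (\<tau> + 8 * of_int b / of_nat N)"
proof -
  have N0: "N > 0" using N by (simp add: odd_pos)
  have b': "Im (\<tau> + 8 * of_int b / of_nat N) > 0"
  proof -
    have "8 * of_int b / of_nat N = complex_of_real (8 * of_int b / of_nat N)" by simp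
    then show ?thesis using \<tau> by (simp only: plus_complex.simps Im_complex_of_real)
  qed
  have "((\<lambda>k. inv_factor \<tau> * gauss N c * half_term_at \<chi> (\<tau> + 8 * of_int b / of_nat N) 0 k) has_sum inv_factor \<tau> * gauss N c * theta32 \<chi> (\<tau> + 8 * of_int b / of_nat N)) UNIV"
    unfolding theta32_def by (intro has_sum_cmult_right theta_shift_has_sum b' \<chi>)
  also have "(\<lambda>k. inv_factor \<tau> * gauss N c * half_term_at \<chi> (\<tau> + 8 * of_int b / of_nat N) 0 k) =
      (\<lambda>k. inv_factor \<tau> * (half_term \<chi> \<tau> k *
            (\<Sum>s<N. zeta N (16 * c * int s ^ 2 + (2 * k - int \<chi>) * int s))))"
  proof
    fix k
    define \<kappa> where "\<kappa> = 2 * k - int \<chi>"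
    have "exp (pi * \<i> * (of_int \<kappa> ^ 2 * (\<tau> + 8 * of_int b / of_nat N) / 4 + of_int \<kappa> * 0))
       = exp (pi * \<i> * (of_int \<kappa> ^ 2 * \<tau> / 4)) * zeta N (b * \<kappa>\<^sup>2)"
      unfolding zeta_def exp_add[symmetric]
      by (simp add: field_simps)
    then show "inv_factor \<tau> * gauss N c * half_term_at \<chi> (\<tau> + 8 * of_int b / of_nat N) 0 k = inv_factor \<tau> * (half_term \<chi> \<tau> k *
            (\<Sum>s<N. zeta N (16 * c * int s ^ 2 + (2 * k - int \<chi>) * int s)))"
      unfolding \<kappa>_def[symmetric] quadratic_sum[OF N0 b] gauss_16[OF N] by simp
  qed
  finally show ?thesis
    using theta34_near_cusp[OF \<tau> \<chi> N, of c] has_sum_unique by blast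
qed

lemma theta34_inversion:
  assumes "Im \<tau> > 0" "\<chi> = 0 \<or> \<chi> = 1"
  shows "theta34 \<chi> (- 1 / \<tau>) = inv_factor \<tau> * theta32 \<chi> \<tau>"
  using theta34_cusp_transform[OF assms, of 1 0 0] by (simp add: gauss_def)

text \<open>
Applying the transformation twice returns to the starting point, so the product of its two factors is 1.
\<close>

lemma gauss_product:
  assumes N: "odd N" and b: "int N dvd 64 * c * b + 1"
  shows "gauss N c * gauss N b = of_nat N"
proof -
  have N0: "N > 0" using N by (simp add: odd_pos)
  define \<tau> where "\<tau> = \<i>"
  have \<tau>: "Im \<tau> > 0" by (simp add: \<tau>_def)
  define \<tau>' where "\<tau>' = - 1 / (of_nat N ^ 2 * \<tau>)"
  have N\<tau>: "Im (of_nat N ^ 2 * \<tau>) > 0" using Im_of_nat_mult_pos[OF \<tau>, of "N ^ 2"] N0 by simp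
  have \<tau>': "Im \<tau>' > 0" unfolding \<tau>'_def by (rule Im_minus_inverse[OF N\<tau>])
  define X where "X = theta34 0 (cusp_point N c \<tau>)"
  have X0: "X \<noteq> 0" unfolding X_def theta34_0 by (intro jtheta_0_nonzero Im_cusp_point \<tau> N0)
  have "X = inv_factor \<tau> * gauss N c * theta34 0 (\<tau> + 8 * of_int b / of_nat N)"
    unfolding X_def using theta34_cusp_transform[OF \<tau> _ N b, of 0] by (simp add: theta34_0 theta32_0)
  also have "\<tau> + 8 * of_int b / of_nat N = 8 * of_int b / of_nat N - 1 / (of_nat N ^ 2 * \<tau>')"
    using N0 by (simp add: \<tau>'_def \<tau>_def field_simps)
  also have "theta34 0 \<dots> = inv_factor \<tau>' * gauss N b * theta32 0 (\<tau>' + 8 * of_int c / of_nat N)"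
    by (rule theta34_cusp_transform[OF \<tau>' _ N]) (use b in \<open>simp_all add: mult_ac\<close>)
  also have "theta32 0 (\<tau>' + 8 * of_int c / of_nat N) = X"
    by (simp add: X_def theta34_0 theta32_0 \<tau>'_def algebra_simps)
  finally have "X = (inv_factor \<tau> * inv_factor \<tau>' * (gauss N c * gauss N b)) * X" by (simp add: mult_ac)
  then have "inv_factor \<tau> * inv_factor \<tau>' * (gauss N c * gauss N b) = 1" using X0 by simp
  moreover have "inv_factor \<tau>' * (of_nat N * inv_factor \<tau>) = 1"
    using inv_factor_inverse[OF N\<tau>] inv_factor_scale[OF \<tau> N] by (simp add: \<tau>'_def)
  ultimately have "gauss N c * gauss N b * 1 = of_nat N * 1" 
    by (metis (no_types, lifting) mult.assoc mult.commute mult.left_commute mult_1_right)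
  then show ?thesis by simp
qed

lemma theta34_nonzero: "Im \<tau> > 0 \<Longrightarrow> \<chi> = 0 \<or> \<chi> = 1 \<Longrightarrow> theta34 \<chi> \<tau> \<noteq> 0"
  using jtheta_0_nonzero jtheta_half_nonzero by (auto simp: theta34_def)

lemma theta32_nonzero: "Im \<tau> > 0 \<Longrightarrow> \<chi> = 0 \<or> \<chi> = 1 \<Longrightarrow> theta32 \<chi> \<tau> \<noteq> 0"
  using theta34_inversion[of \<tau> \<chi>] theta34_nonzero[OF Im_minus_inverse, of \<tau> \<chi>] by auto

section \<open>The Hecke operator in weight \<open>-1/2\<close>\<close>

text \<open>
The operator \<open>T(l^2)\<close> in weight \<open>-1/2\<close>, scaled to be integral. Translations run over multiples of 8 because exponents are quarters of
integers in the nome. The Gauss sums in the middle term produce the Legendre symbol in the coefficients.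
\<close>

definition hecke :: "nat \<Rightarrow> (complex \<Rightarrow> complex) \<Rightarrow> complex \<Rightarrow> complex" where
  "hecke l f \<tau> = of_nat l * (\<Sum>b<l\<^sup>2. f ((\<tau> + 8 * of_nat b) / of_nat (l\<^sup>2)))
     + (\<Sum>b\<in>{1..<l}. gauss l (int b) * f (\<tau> + 8 * of_nat b / of_nat l)) + f (of_nat (l\<^sup>2) * \<tau>)"

text \<open>
A square root \<open>t\<close> of \<open>-n\<close> comes with \<open>l - t\<close>, which differs from it when \<open>l\<close> does not divide
\<open>n\<close>.
\<close>

lemma square_root_count:
  assumes l: "prime l" "odd l"
  shows "int (card {s. s < l \<and> int l dvd int s ^ 2 + n}) = 1 + Legendre (- n) (int l)"
proof -
  have l2: "l > 2" using l prime_ge_2_nat[of l] by (cases "l = 2") auto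
  have dvd: "int l dvd int s ^ 2 + n \<longleftrightarrow> [int s ^ 2 = - n] (mod int l)" for s
    by (simp add: cong_iff_dvd_diff)
  have prim: "prime (int l)" using l by simp
  show ?thesis
  proof (cases "[- n = 0] (mod int l)")
    case True
    have "{s. s < l \<and> int l dvd int s ^ 2 + n} = {0}"
    proof (intro equalityI subsetI)
      fix s assume s: "s \<in> {s. s < l \<and> int l dvd int s ^ 2 + n}"
      have "int l dvd n" using True by (simp add: cong_0_iff)
      then have "int l dvd int s ^ 2" using s by (simp add: dvd_add_left_iff)
      then have "l dvd s" using prim by (metis int_dvd_int_iff prime_dvd_power)
      then show "s \<in> {0}" using s by (auto dest: dvd_imp_le)
    qed (use True l2 in \<open>auto simp: cong_0_iff\<close>)
    then show ?thesis using True by (simp add: Legendre_def)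
  next
    case False
    show ?thesis
    proof (cases "QuadRes (int l) (- n)")
      case True
      then obtain y where y: "[y\<^sup>2 = - n] (mod int l)" by (auto simp: QuadRes_def)
      define t where "t = nat (y mod int l)"
      have t: "int t = y mod int l" "t < l" using l2 by (auto simp: t_def nat_less_iff)
      have ty: "[int t ^ 2 = - n] (mod int l)"
        using y unfolding t(1) by (simp add: Cong.cong_def power_mod)
      have t0: "t \<noteq> 0"
      proof
        assume "t = 0"
        then show False using ty False by (simp add: cong_sym_eq)
      qed
      have "{s. s < l \<and> int l dvd int s ^ 2 + n} = {t, l - t}"
      proof (intro equalityI subsetI)
        fix s assume s: "s \<in> {s. s < l \<and> int l dvd int s ^ 2 + n}"
        then have "[int s ^ 2 = int t ^ 2] (mod int l)" using dvd ty cong_sym cong_trans by blast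
        then have "int l dvd (int s - int t) * (int s + int t)"
          by (simp add: cong_iff_dvd_diff power2_eq_square algebra_simps)
        then have "int l dvd int s - int t \<or> int l dvd int s + int t"
          using prim prime_dvd_mult_iff by blast
        then show "s \<in> {t, l - t}"
        proof
          assume "int l dvd int s - int t"
          then have "[s = t] (mod l)" by (simp add: cong_iff_dvd_diff flip: cong_int_iff)
          then have "s = t" using s t by (simp add: Cong.cong_def)
          then show ?thesis by simp
        next
          assume "int l dvd int s + int t"
          then have "l dvd s + t" by (metis int_dvd_int_iff of_nat_add)
          then obtain k where k: "s + t = l * k" by blast
          have "s + t < 2 * l" "s + t > 0" using s t t0 by auto
          then have "k < 2" "k > 0" using k l2 by auto
          then have "k = 1" by simp
          then show ?thesis using k by auto
        qed
      next
        fix s assume "s \<in> {t, l - t}"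
        moreover have "int l dvd int (l - t) ^ 2 + n"
        proof -
          have "int (l - t) ^ 2 + n = int l * (int l - 2 * int t) + (int t ^ 2 + n)"
            using t by (simp add: of_nat_diff power2_eq_square algebra_simps)
          moreover have "int l dvd int t ^ 2 + n" using dvd ty by blast
          ultimately show ?thesis by (metis dvd_add dvd_triv_left)
        qed
        moreover have "int l dvd int t ^ 2 + n" using dvd ty by blast
        moreover have "t < l" "l - t < l" using t t0 by auto
        ultimately show "s \<in> {s. s < l \<and> int l dvd int s ^ 2 + n}" by blast
      qed
      moreover have "t \<noteq> l - t"
      proof
        assume "t = l - t"
        then have "l = 2 * t" using t by simp
        then show False using l by simp
      qed
      ultimately show ?thesis using True False by (simp add: Legendre_def)
    next
      case F: False
      then have "{s. s < l \<and> int l dvd int s ^ 2 + n} = {}"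
        unfolding dvd QuadRes_def by auto
      then show ?thesis using F False by (simp add: Legendre_def)
    qed
  qed
qed

text \<open>
Exchanging the two sums counts the square roots of \<open>-n\<close> modulo \<open>l\<close>; the term \<open>b = 0\<close> accounts for the
summand 1 in that count.
\<close>

lemma gauss_legendre_sum:
  assumes l: "prime l" "odd l"
  shows "(\<Sum>b\<in>{1..<l}. gauss l (int b) * zeta l (n * int b)) = of_nat l * of_int (Legendre (- n) (int l))"
proof -
  have l0: "l > 0" using l prime_gt_0_nat by blast
  have "(\<Sum>b<l. gauss l (int b) * zeta l (n * int b)) = (\<Sum>b<l. \<Sum>s<l. zeta l ((int s ^ 2 + n) * int b))"
    unfolding gauss_def sum_distrib_right zeta_add[symmetric] by (simp add: algebra_simps)
  also have "\<dots> = (\<Sum>s<l. \<Sum>b<l. zeta l ((int s ^ 2 + n) * int b))"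
    by (rule sum.swap)
  also have "\<dots> = (\<Sum>s<l. if int l dvd int s ^ 2 + n then of_nat l else 0)"
    unfolding zeta_sum[OF l0] ..
  also have "\<dots> = of_nat l * of_nat (card {s. s < l \<and> int l dvd int s ^ 2 + n})"
  proof -
    have "{..<l} \<inter> {s. int l dvd int s ^ 2 + n} = {s. s < l \<and> int l dvd int s ^ 2 + n}" by auto
    then show ?thesis by (simp add: sum.If_cases)
  qed
  also have "of_nat (card {s. s < l \<and> int l dvd int s ^ 2 + n}) = (of_int (1 + Legendre (- n) (int l)) :: complex)"
    unfolding square_root_count[OF l, symmetric] by simp
  finally have "(\<Sum>b<l. gauss l (int b) * zeta l (n * int b)) = of_nat l * (1 + of_int (Legendre (- n) (int l)))" by simp
  moreover have "{..<l} = insert 0 {1..<l}" using l0 by auto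
  moreover have "gauss l 0 = of_nat l" by (simp add: gauss_def)
  ultimately have "of_nat l + (\<Sum>b\<in>{1..<l}. gauss l (int b) * zeta l (n * int b)) =
      of_nat l * (1 + of_int (Legendre (- n) (int l)))" by simp
  then show ?thesis by (simp add: distrib_left)
qed

text \<open>
The power \<open>q^(n/4)\<close>. Quarter exponents give one expansion that covers \<open>\<theta>\<^sub>2\<close> as well as \<open>\<theta>\<^sub>3\<close> and
\<open>\<theta>\<^sub>4\<close>.
\<close>

definition qterm :: "complex \<Rightarrow> int \<Rightarrow> complex" where
  "qterm \<tau> n = exp (pi * \<i> * of_int n * \<tau> / 4)"

text \<open>
The action of \<open>T(l^2)\<close> on coefficients.
\<close>

definition hecke_coeff :: "nat \<Rightarrow> (int \<Rightarrow> 'a::comm_ring_1) \<Rightarrow> int \<Rightarrow> 'a" where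
  "hecke_coeff l a n = of_nat l ^ 3 * a (int l ^ 2 * n) + of_nat l * of_int (Legendre (- n) (int l)) * a n
     + (if int l ^ 2 dvd n then a (n div int l ^ 2) else 0)"

text \<open>
Each of the three parts of the operator acts term by term: averaging over \<open>b\<close> modulo \<open>l^2\<close> selects the exponents divisible by
\<open>l^2\<close>, the Gauss sums combine to the Legendre symbol, and \<open>\<tau> \<mapsto> l^2 \<tau>\<close> multiplies exponents by
\<open>l^2\<close>.
\<close>

lemma hecke_expansion:
  assumes l: "prime l" "odd l"
    and f: "\<And>\<tau>. Im \<tau> > 0 \<Longrightarrow> ((\<lambda>n. a n * qterm \<tau> n) has_sum f \<tau>) UNIV"
    and \<tau>: "Im \<tau> > 0"
  shows "((\<lambda>n. hecke_coeff l a n * qterm \<tau> n) has_sum hecke l f \<tau>) UNIV"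
proof -
  have l0: "l > 0" using l prime_gt_0_nat by blast
  define N where "N = l\<^sup>2"
  have N0: "N > 0" using l0 by (simp add: N_def)
  have N: "int l ^ 2 = int N" by (simp add: N_def)
  have inj: "inj (\<lambda>n. int N * n)" using N0 by (simp add: inj_def)
  have ImN: "Im (of_nat N * \<tau>) > 0" using \<tau> N0 by simp
  have Im1: "Im ((\<tau> + 8 * of_nat b) / of_nat M) > 0" if "M > 0" for b M :: nat
    using \<tau> that by (simp add: Im_divide_of_nat)
  have Im2: "Im (\<tau> + 8 * of_nat b / of_nat M) > 0" if "M > 0" for b M :: nat
  proof -
    have "8 * of_nat b / of_nat M = complex_of_real (8 * of_nat b / of_nat M)" by simp
    then show ?thesis using \<tau> by (simp only: plus_complex.simps Im_complex_of_real)
  qed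
  have third: "((\<lambda>n. (if int N dvd n then a (n div int N) else 0) * qterm \<tau> n) has_sum f (of_nat N * \<tau>)) UNIV"
  proof -
    have "((\<lambda>n. a n * qterm (of_nat N * \<tau>) n) has_sum f (of_nat N * \<tau>)) UNIV"
      by (rule f[OF ImN])
    also have "(\<lambda>n. a n * qterm (of_nat N * \<tau>) n) =
        (\<lambda>n. (if int N dvd n then a (n div int N) else 0) * qterm \<tau> n) \<circ> (\<lambda>n. int N * n)"
      using N0 by (auto simp: qterm_def mult_ac)
    also have "(\<dots> has_sum f (of_nat N * \<tau>)) UNIV \<longleftrightarrow>
        ((\<lambda>n. (if int N dvd n then a (n div int N) else 0) * qterm \<tau> n) has_sum f (of_nat N * \<tau>)) (range (\<lambda>n. int N * n))"
      by (rule has_sum_reindex[OF inj, symmetric])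
    also have "\<dots> \<longleftrightarrow> ((\<lambda>n. (if int N dvd n then a (n div int N) else 0) * qterm \<tau> n) has_sum f (of_nat N * \<tau>)) UNIV"
      by (rule has_sum_cong_neutral) (auto elim!: dvdE)
    finally show ?thesis .
  qed
  have first: "((\<lambda>n. of_nat l ^ 3 * a (int N * n) * qterm \<tau> n) has_sum of_nat l * (\<Sum>b<N. f ((\<tau> + 8 * of_nat b) / of_nat N))) UNIV"
  proof -
    have "((\<lambda>n. of_nat l * (\<Sum>b<N. a n * qterm ((\<tau> + 8 * of_nat b) / of_nat N) n)) has_sum
         of_nat l * (\<Sum>b<N. f ((\<tau> + 8 * of_nat b) / of_nat N))) UNIV"
      by (intro has_sum_cmult_right has_sum_sum_finite f Im1 N0) auto
    also have "(\<lambda>n. of_nat l * (\<Sum>b<N. a n * qterm ((\<tau> + 8 * of_nat b) / of_nat N) n)) =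
       (\<lambda>n. of_nat l * a n * qterm (\<tau> / of_nat N) n * (if int N dvd n then of_nat N else 0))"
    proof
      fix n
      have "qterm ((\<tau> + 8 * of_nat b) / of_nat N) n = qterm (\<tau> / of_nat N) n * zeta N (n * int b)" for b
        unfolding qterm_def zeta_def exp_add[symmetric]
        by (rule arg_cong[where f = exp]) (use N0 in \<open>simp add: field_simps\<close>)
      then show "of_nat l * (\<Sum>b<N. a n * qterm ((\<tau> + 8 * of_nat b) / of_nat N) n) =
         of_nat l * a n * qterm (\<tau> / of_nat N) n * (if int N dvd n then of_nat N else 0)"
        unfolding zeta_sum[OF N0, symmetric] by (simp add: sum_distrib_left mult_ac)
    qed
    also have "((\<lambda>n. of_nat l * a n * qterm (\<tau> / of_nat N) n * (if int N dvd n then of_nat N else 0)) has_sum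
         of_nat l * (\<Sum>b<N. f ((\<tau> + 8 * of_nat b) / of_nat N))) UNIV \<longleftrightarrow>
       ((\<lambda>n. of_nat l * a n * qterm (\<tau> / of_nat N) n * of_nat N) has_sum
         of_nat l * (\<Sum>b<N. f ((\<tau> + 8 * of_nat b) / of_nat N))) (range (\<lambda>n. int N * n))"
      by (rule has_sum_cong_neutral) (auto elim!: dvdE)
    also have "\<dots> \<longleftrightarrow> ((\<lambda>n. of_nat l ^ 3 * a (int N * n) * qterm \<tau> n) has_sum of_nat l * (\<Sum>b<N. f ((\<tau> + 8 * of_nat b) / of_nat N))) UNIV"
    proof -
      have "(\<lambda>n. of_nat l * a n * qterm (\<tau> / of_nat N) n * of_nat N) \<circ> (\<lambda>n. int N * n) =
          (\<lambda>n. of_nat l ^ 3 * a (int N * n) * qterm \<tau> n)"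
        using l0 by (auto simp: fun_eq_iff qterm_def N_def power2_eq_square power3_eq_cube mult_ac)
      then show ?thesis by (simp only: has_sum_reindex[OF inj])
    qed
    finally show ?thesis .
  qed
  have second: "((\<lambda>n. of_nat l * of_int (Legendre (- n) (int l)) * a n * qterm \<tau> n) has_sum
      (\<Sum>b\<in>{1..<l}. gauss l (int b) * f (\<tau> + 8 * of_nat b / of_nat l))) UNIV"
  proof -
    have "((\<lambda>n. \<Sum>b\<in>{1..<l}. gauss l (int b) * (a n * qterm (\<tau> + 8 * of_nat b / of_nat l) n)) has_sum
         (\<Sum>b\<in>{1..<l}. gauss l (int b) * f (\<tau> + 8 * of_nat b / of_nat l))) UNIV"
      by (intro has_sum_sum_finite has_sum_cmult_right f Im2 l0) auto
    also have "(\<lambda>n. \<Sum>b\<in>{1..<l}. gauss l (int b) * (a n * qterm (\<tau> + 8 * of_nat b / of_nat l) n)) =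
       (\<lambda>n. of_nat l * of_int (Legendre (- n) (int l)) * a n * qterm \<tau> n)"
    proof
      fix n
      have "qterm (\<tau> + 8 * of_nat b / of_nat l) n = qterm \<tau> n * zeta l (n * int b)" for b
        unfolding qterm_def zeta_def exp_add[symmetric]
        by (rule arg_cong[where f = exp]) (use l0 in \<open>simp add: field_simps\<close>)
      then show "(\<Sum>b\<in>{1..<l}. gauss l (int b) * (a n * qterm (\<tau> + 8 * of_nat b / of_nat l) n)) =
         of_nat l * of_int (Legendre (- n) (int l)) * a n * qterm \<tau> n"
        unfolding gauss_legendre_sum[OF l, symmetric] by (simp add: sum_distrib_left sum_distrib_right mult_ac)
    qed
    finally show ?thesis .
  qed
  have "((\<lambda>n. of_nat l ^ 3 * a (int N * n) * qterm \<tau> n + of_nat l * of_int (Legendre (- n) (int l)) * a n * qterm \<tau> n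
      + (if int N dvd n then a (n div int N) else 0) * qterm \<tau> n) has_sum hecke l f \<tau>) UNIV"
    unfolding hecke_def N_def[symmetric] by (intro has_sum_add first second third)
  then show ?thesis by (simp only: hecke_coeff_def N ring_distribs)
qed

text \<open>
Inversion near the rational point \<open>8 c / N\<close> leads to a translation by \<open>8 b / N\<close> with this residue \<open>b\<close>.
\<close>

definition dual_residue :: "nat \<Rightarrow> nat \<Rightarrow> nat" where
  "dual_residue N c = (SOME b. b < N \<and> int N dvd 64 * int c * int b + 1)"

lemma dual_residue:
  assumes N: "odd N" "N > 1" and c: "coprime c N"
  shows "dual_residue N c < N" "int N dvd 64 * int c * int (dual_residue N c) + 1"
    "coprime (dual_residue N c) N" "c < N \<Longrightarrow> dual_residue N (dual_residue N c) = c"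
proof -
  have "coprime (2 ^ 6) (int N)" using N by (intro coprime_power_left_iff[THEN iffD2] disjI1) simp
  then have "coprime 64 (int N)" by simp
  moreover have "coprime (int c) (int N)" using c by simp
  ultimately have cop: "coprime (64 * int c) (int N)" by simp
  have ex: "\<exists>b. b < N \<and> int N dvd 64 * int c * int b + 1"
  proof -
    obtain x where x: "[64 * int c * x = 1] (mod int N)" using cop cong_solve_coprime_int by blast
    define b where "b = nat ((- x) mod int N)"
    have b: "int b = (- x) mod int N" "b < N" using N by (auto simp: b_def nat_less_iff)
    have "[64 * int c * int b = 64 * int c * (- x)] (mod int N)"
      unfolding b by (intro cong_scalar_left) (simp add: Cong.cong_def)
    also have "[64 * int c * (- x) = - 1] (mod int N)"
      using cong_minus_minus_iff[of "64 * int c * x" 1 "int N"] x by simp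
    finally show ?thesis using b by (auto simp: cong_iff_dvd_diff)
  qed
  have d: "dual_residue N c < N" "int N dvd 64 * int c * int (dual_residue N c) + 1"
    using someI_ex[OF ex] unfolding dual_residue_def by auto
  show "dual_residue N c < N" "int N dvd 64 * int c * int (dual_residue N c) + 1" by (rule d)+
  show cop': "coprime (dual_residue N c) N"
  proof -
    define b where "b = int (dual_residue N c)"
    obtain k where "64 * int c * b + 1 = int N * k" using d(2) unfolding b_def by blast
    then have "int N * k + b * (- 64 * int c) = 1" by (simp add: algebra_simps)
    then have "coprime b (int N)" by (metis coprime_commute coprime_iff_invertible_int dvd_def coprimeI
        dvd_add dvd_mult2)
    then show ?thesis by (simp add: b_def)
  qed
  assume cN: "c < N"
  have "coprime (int (dual_residue N c)) (int N)" using cop' by simp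
  then have cop2: "coprime (64 * int (dual_residue N c)) (int N)" using \<open>coprime 64 (int N)\<close> by simp
  have "\<exists>b. b < N \<and> int N dvd 64 * int (dual_residue N c) * int b + 1"
    using cN d(2) by (intro exI[of _ c]) (simp add: mult_ac)
  from someI_ex[OF this] have e: "dual_residue N (dual_residue N c) < N"
     "int N dvd 64 * int (dual_residue N c) * int (dual_residue N (dual_residue N c)) + 1"
    unfolding dual_residue_def by auto
  have "int N dvd 64 * int (dual_residue N c) * int (dual_residue N (dual_residue N c)) - 64 * int (dual_residue N c) * int c"
    using dvd_diff[OF e(2) d(2)] by (simp add: mult_ac)
  then have "[64 * int (dual_residue N c) * int (dual_residue N (dual_residue N c)) = 64 * int (dual_residue N c) * int c] (mod int N)"
    by (simp add: cong_iff_dvd_diff)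
  then have "[int (dual_residue N (dual_residue N c)) = int c] (mod int N)"
    using cop2 cong_mult_lcancel by blast
  then show "dual_residue N (dual_residue N c) = c"
    using e(1) cN by (simp add: Cong.cong_def cong_int_iff)
qed

lemma dual_residue_sum:
  assumes N: "odd N" "N > 1"
  shows "(\<Sum>c\<in>{c. c < N \<and> coprime c N}. h (dual_residue N c)) = (\<Sum>c\<in>{c. c < N \<and> coprime c N}. h c)"
  by (rule sum.reindex_bij_witness[of _ "dual_residue N" "dual_residue N"]) (auto simp: dual_residue[OF N])

text \<open>
Inversion permutes the terms of the operator. In the sum over \<open>b\<close> modulo \<open>l^2\<close>, the units are permuted among
themselves, the nonzero multiples of \<open>l\<close> are exchanged with the terms twisted by Gauss sums, and \<open>b = 0\<close> is exchanged with the
last term. The factors agree by the scaling law of the factor of automorphy and by the product formula for Gauss sums.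
\<close>

lemma hecke_inversion:
  assumes l: "prime l" "odd l" and \<tau>: "Im \<tau> > 0" and \<chi>: "\<chi> = 0 \<or> \<chi> = 1"
  shows "hecke l (\<lambda>\<tau>. 1 / theta34 \<chi> \<tau>) (- 1 / \<tau>) = hecke l (\<lambda>\<tau>. 1 / theta32 \<chi> \<tau>) \<tau> / inv_factor \<tau>"
proof -
  have l0: "l > 1" using l prime_gt_1_nat by blast
  define N where "N = l\<^sup>2"
  have N: "odd N" "N > 1" using l l0 one_less_power[of l 2] by (auto simp: N_def)
  have \<tau>0: "\<tau> \<noteq> 0" using \<tau> by auto
  define P where "P = (\<lambda>\<tau>. 1 / theta34 \<chi> \<tau>)"
  define Q where "Q = (\<lambda>\<tau>. 1 / theta32 \<chi> \<tau>)"
  define cf where "cf = inv_factor \<tau>"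
  have cf0: "cf \<noteq> 0" unfolding cf_def by (rule inv_factor_nonzero[OF \<tau>])
  define \<sigma> where "\<sigma> = \<tau> / of_nat N"
  have \<sigma>: "Im \<sigma> > 0" using \<tau> N by (simp add: \<sigma>_def Im_divide_of_nat)
  have cf\<sigma>: "cf = of_nat l * inv_factor \<sigma>"
    using inv_factor_scale[OF \<sigma> l(2)] l0 by (simp add: cf_def \<sigma>_def N_def)
  have copl: "{c. c < l \<and> coprime c l} = {1..<l}"
  proof -
    have "coprime c l \<longleftrightarrow> c \<noteq> 0" if "c < l" for c
      using l that l0 by (metis coprime_0_left_iff coprime_commute dvd_imp_le linorder_not_less neq0_conv prime_imp_coprime_nat less_irrefl nat_dvd_1_iff_1)
    then show ?thesis by auto
  qed
  have copN: "coprime c N \<longleftrightarrow> \<not> l dvd c" for c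
    unfolding N_def using l by (metis coprime_absorb_left coprime_commute coprime_power_right_iff
        not_prime_unit prime_imp_coprime zero_neq_numeral)
  have split: "(\<Sum>b<N. h b) = h 0 + (\<Sum>c\<in>{1..<l}. h (l * c)) + (\<Sum>b\<in>{b. b < N \<and> coprime b N}. h b)"
    for h :: "nat \<Rightarrow> complex"
  proof -
    define A where "A = (\<lambda>c. l * c) ` {1..<l}"
    define C where "C = {b. b < N \<and> coprime b N}"
    have "{..<N} = insert 0 (A \<union> C)"
    proof (intro equalityI subsetI)
      fix b assume b: "b \<in> {..<N}"
      show "b \<in> insert 0 (A \<union> C)"
      proof (cases "l dvd b \<and> b \<noteq> 0")
        case True
        then obtain c where c: "b = l * c" by blast
        then have "c \<in> {1..<l}" using b True by (auto simp: N_def power2_eq_square)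
        then show ?thesis using c by (auto simp: A_def)
      qed (use b in \<open>auto simp: C_def copN\<close>)
    qed (use N l0 in \<open>auto simp: A_def C_def N_def power2_eq_square\<close>)
    moreover have "0 \<notin> A \<union> C" "A \<inter> C = {}" "finite A" "finite C"
      unfolding A_def C_def copN using l0 by auto
    moreover have "(\<Sum>b\<in>A. h b) = (\<Sum>c\<in>{1..<l}. h (l * c))"
      unfolding A_def using l0 by (subst sum.reindex) (auto simp: inj_on_def)
    ultimately show ?thesis
      by (simp add: sum.union_disjoint C_def[symmetric] add.assoc)
  qed
  have NC: "(of_nat N :: complex) = of_nat l ^ 2" by (simp add: N_def)
  have Nnz: "(of_nat N :: complex) \<noteq> 0" "(of_nat l :: complex) \<noteq> 0" using N l0 by auto
  have last: "P (of_nat N * (- 1 / \<tau>)) = of_nat l * Q ((\<tau> + 8 * of_nat 0) / of_nat N) / cf"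
  proof -
    have "of_nat N * (- 1 / \<tau>) = - 1 / \<sigma>" using Nnz \<tau>0 by (simp add: \<sigma>_def)
    then show ?thesis
      using theta34_inversion[OF \<sigma> \<chi>] Nnz by (simp add: P_def Q_def cf\<sigma> \<sigma>_def)
  qed
  have zero: "of_nat l * P ((- 1 / \<tau> + 8 * of_nat 0) / of_nat N) = Q (of_nat N * \<tau>) / cf"
  proof -
    have N\<tau>: "Im (of_nat N * \<tau>) > 0" using \<tau> N by simp
    have c: "inv_factor (of_nat N * \<tau>) = of_nat l * cf"
      using inv_factor_scale[OF \<tau> l(2)] by (simp add: cf_def N_def)
    have "(- 1 / \<tau> + 8 * of_nat 0) / of_nat N = - 1 / (of_nat N * \<tau>)" by (simp add: field_simps)
    then have "theta34 \<chi> ((- 1 / \<tau> + 8 * of_nat 0) / of_nat N) = of_nat l * cf * theta32 \<chi> (of_nat N * \<tau>)"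
      using theta34_inversion[OF N\<tau> \<chi>] by (simp only: c)
    then show ?thesis
      using Nnz unfolding P_def Q_def by (simp only:) simp
  qed
  have multiples: "of_nat l * P ((- 1 / \<tau> + 8 * of_nat (l * c)) / of_nat N) =
      gauss l (int (dual_residue l c)) * Q (\<tau> + 8 * of_nat (dual_residue l c) / of_nat l) / cf"
    if "c \<in> {1..<l}" for c
  proof -
    have c: "coprime c l" using that copl by blast
    note d = dual_residue[OF l(2) l0 c]
    have "(- 1 / \<tau> + 8 * of_nat (l * c)) / of_nat N = 8 * of_int (int c) / of_nat l - 1 / (of_nat l ^ 2 * \<tau>)"
      using Nnz \<tau>0 unfolding NC by (simp add: field_simps power2_eq_square)
    then have "theta34 \<chi> ((- 1 / \<tau> + 8 * of_nat (l * c)) / of_nat N) =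
        cf * gauss l (int c) * theta32 \<chi> (\<tau> + 8 * of_nat (dual_residue l c) / of_nat l)"
      using theta34_cusp_transform[OF \<tau> \<chi> l(2) d(2)] by (simp add: cf_def)
    moreover have g: "gauss l (int c) * gauss l (int (dual_residue l c)) = of_nat l"
      by (rule gauss_product[OF l(2) d(2)])
    moreover have "gauss l (int c) \<noteq> 0" using g Nnz by force
    ultimately show ?thesis
      unfolding P_def Q_def g[symmetric] by simp
  qed
  have units: "of_nat l * P ((- 1 / \<tau> + 8 * of_nat b) / of_nat N) =
      of_nat l * Q ((\<tau> + 8 * of_nat (dual_residue N b)) / of_nat N) / cf"
    if b: "coprime b N" for b
  proof -
    note d = dual_residue[OF N b]
    have "(- 1 / \<tau> + 8 * of_nat b) / of_nat N = 8 * of_int (int b) / of_nat N - 1 / (of_nat N ^ 2 * \<sigma>)"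
      using Nnz \<tau>0 unfolding \<sigma>_def by (simp add: field_simps power2_eq_square)
    moreover have "\<sigma> + 8 * of_int (int (dual_residue N b)) / of_nat N = (\<tau> + 8 * of_nat (dual_residue N b)) / of_nat N"
      by (simp add: \<sigma>_def add_divide_distrib)
    moreover have "gauss N (int b) = of_nat l"
    proof -
      have "\<not> l dvd 2 * b"
        using b l copN by (metis coprime_dvd_mult_right_iff coprime_right_2_iff_odd)
      then have "\<not> int l dvd 2 * int b" by (metis int_dvd_int_iff of_nat_mult of_nat_numeral)
      then show ?thesis unfolding N_def by (rule gauss_prime_square[OF l(1)])
    qed
    ultimately have "theta34 \<chi> ((- 1 / \<tau> + 8 * of_nat b) / of_nat N) =
        cf * theta32 \<chi> ((\<tau> + 8 * of_nat (dual_residue N b)) / of_nat N)"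
      using theta34_cusp_transform[OF \<sigma> \<chi> N(1) d(2)] by (simp add: cf\<sigma> mult_ac)
    then show ?thesis by (simp add: P_def Q_def)
  qed
  have middle: "gauss l (int b) * P (- 1 / \<tau> + 8 * of_nat b / of_nat l) =
      of_nat l * Q ((\<tau> + 8 * of_nat (l * dual_residue l b)) / of_nat N) / cf"
    if "b \<in> {1..<l}" for b
  proof -
    have b: "coprime b l" using that copl by blast
    note d = dual_residue[OF l(2) l0 b]
    have "- 1 / \<tau> + 8 * of_nat b / of_nat l = 8 * of_int (int b) / of_nat l - 1 / (of_nat l ^ 2 * \<sigma>)"
      using Nnz \<tau>0 unfolding \<sigma>_def NC by (simp add: field_simps power2_eq_square)
    moreover have "\<sigma> + 8 * of_int (int (dual_residue l b)) / of_nat l = (\<tau> + 8 * of_nat (l * dual_residue l b)) / of_nat N"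
      using Nnz unfolding \<sigma>_def NC by (simp add: field_simps power2_eq_square)
    ultimately have "theta34 \<chi> (- 1 / \<tau> + 8 * of_nat b / of_nat l) =
        inv_factor \<sigma> * gauss l (int b) * theta32 \<chi> ((\<tau> + 8 * of_nat (l * dual_residue l b)) / of_nat N)"
      using theta34_cusp_transform[OF \<sigma> \<chi> l(2) d(2)] by simp
    moreover have "gauss l (int b) \<noteq> 0" using gauss_product[OF l(2) d(2)] Nnz by force
    ultimately show ?thesis
      using Nnz by (simp add: P_def Q_def cf\<sigma>)
  qed
  have "hecke l P (- 1 / \<tau>) = of_nat l * P ((- 1 / \<tau> + 8 * of_nat 0) / of_nat N)
      + (\<Sum>c\<in>{1..<l}. of_nat l * P ((- 1 / \<tau> + 8 * of_nat (l * c)) / of_nat N))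
      + (\<Sum>b\<in>{b. b < N \<and> coprime b N}. of_nat l * P ((- 1 / \<tau> + 8 * of_nat b) / of_nat N))
      + (\<Sum>b\<in>{1..<l}. gauss l (int b) * P (- 1 / \<tau> + 8 * of_nat b / of_nat l)) + P (of_nat N * (- 1 / \<tau>))"
    unfolding hecke_def N_def[symmetric] split by (simp add: distrib_left sum_distrib_left)
  also have "\<dots> = Q (of_nat N * \<tau>) / cf
      + (\<Sum>c\<in>{1..<l}. gauss l (int (dual_residue l c)) * Q (\<tau> + 8 * of_nat (dual_residue l c) / of_nat l) / cf)
      + (\<Sum>b\<in>{b. b < N \<and> coprime b N}. of_nat l * Q ((\<tau> + 8 * of_nat (dual_residue N b)) / of_nat N) / cf)
      + (\<Sum>b\<in>{1..<l}. of_nat l * Q ((\<tau> + 8 * of_nat (l * dual_residue l b)) / of_nat N) / cf)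
      + of_nat l * Q ((\<tau> + 8 * of_nat 0) / of_nat N) / cf"
    unfolding zero last by (intro arg_cong2[where f = "(+)"] sum.cong refl multiples units middle) auto
  also have "\<dots> = Q (of_nat N * \<tau>) / cf
      + (\<Sum>c\<in>{1..<l}. gauss l (int c) * Q (\<tau> + 8 * of_nat c / of_nat l) / cf)
      + (\<Sum>b\<in>{b. b < N \<and> coprime b N}. of_nat l * Q ((\<tau> + 8 * of_nat b) / of_nat N) / cf)
      + (\<Sum>b\<in>{1..<l}. of_nat l * Q ((\<tau> + 8 * of_nat (l * b)) / of_nat N) / cf)
      + of_nat l * Q ((\<tau> + 8 * of_nat 0) / of_nat N) / cf"
    using dual_residue_sum[OF N, of "\<lambda>b. of_nat l * Q ((\<tau> + 8 * of_nat b) / of_nat N) / cf"]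
      dual_residue_sum[OF l(2) l0, of "\<lambda>c. gauss l (int c) * Q (\<tau> + 8 * of_nat c / of_nat l) / cf"]
      dual_residue_sum[OF l(2) l0, of "\<lambda>b. of_nat l * Q ((\<tau> + 8 * of_nat (l * b)) / of_nat N) / cf"]
    unfolding copl by (simp only:)
  also have "\<dots> = hecke l Q \<tau> / cf"
    unfolding hecke_def N_def[symmetric] split
    by (simp add: distrib_left sum_distrib_left add_divide_distrib sum_divide_distrib)
  finally show ?thesis unfolding P_def Q_def cf_def .
qed

section \<open>Invariant functions vanishing at a cusp\<close>

lemma Im_neg_inverse: "Im (- 1 / x) = Im x / norm x ^ 2"
  by (simp add: Im_divide cmod_power2)

text \<open>
The orbit under the theta group.
\<close>

inductive_set theta_orbit :: "complex \<Rightarrow> complex set" for \<tau> where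
  orbit_base: "\<tau> \<in> theta_orbit \<tau>"
| orbit_shift: "x \<in> theta_orbit \<tau> \<Longrightarrow> x + 2 * of_int k \<in> theta_orbit \<tau>"
| orbit_inv: "x \<in> theta_orbit \<tau> \<Longrightarrow> - 1 / x \<in> theta_orbit \<tau>"

lemma theta_orbit_form:
  assumes "x \<in> theta_orbit \<tau>" "Im \<tau> > 0"
  shows "Im x > 0 \<and> (\<exists>a b c d::int. of_int c * \<tau> + of_int d \<noteq> 0 \<and>
     x = (of_int a * \<tau> + of_int b) / (of_int c * \<tau> + of_int d) \<and>
     Im x = Im \<tau> / norm (of_int c * \<tau> + of_int d) ^ 2)"
  using assms(1)
proof induction
  case orbit_base
  show ?case using assms(2)
    by (intro conjI exI[of _ "1::int"] exI[of _ "0::int"] exI[of _ "0::int"] exI[of _ "1::int"]) auto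
next
  case (orbit_shift x k)
  then obtain a b c d :: int where *: "of_int c * \<tau> + of_int d \<noteq> 0" "x = (of_int a * \<tau> + of_int b) / (of_int c * \<tau> + of_int d)"
     "Im x = Im \<tau> / norm (of_int c * \<tau> + of_int d) ^ 2" by blast
  have "x + 2 * of_int k = (of_int (a + 2 * k * c) * \<tau> + of_int (b + 2 * k * d)) / (of_int c * \<tau> + of_int d)"
    unfolding *(2) using *(1) by (simp add: divide_simps) (simp add: algebra_simps)
  moreover have "Im (x + 2 * of_int k) = Im x" by simp
  ultimately show ?case using *(1,3) orbit_shift.IH by metis
next
  case (orbit_inv x)
  then obtain a b c d :: int where *: "of_int c * \<tau> + of_int d \<noteq> 0" "x = (of_int a * \<tau> + of_int b) / (of_int c * \<tau> + of_int d)"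
     "Im x = Im \<tau> / norm (of_int c * \<tau> + of_int d) ^ 2" and pos: "Im x > 0" by blast
  have x0: "x \<noteq> 0" using pos by auto
  then have ab: "of_int a * \<tau> + of_int b \<noteq> 0" using * by auto
  have "- 1 / x = (of_int (- c) * \<tau> + of_int (- d)) / (of_int a * \<tau> + of_int b)"
    unfolding *(2) using *(1) ab by (simp add: divide_simps)
  moreover have "Im (- 1 / x) = Im \<tau> / norm (of_int a * \<tau> + of_int b) ^ 2"
  proof -
    have "Im (- 1 / x) = (Im \<tau> / norm (of_int c * \<tau> + of_int d) ^ 2) / norm x ^ 2"
      unfolding Im_neg_inverse *(3) ..
    also have "norm x = norm (of_int a * \<tau> + of_int b) / norm (of_int c * \<tau> + of_int d)"
      unfolding *(2) norm_divide ..
    finally show ?thesis using *(1) by (simp add: power_divide)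
  qed
  moreover have "Im (- 1 / x) > 0" unfolding Im_neg_inverse using pos x0 by simp
  ultimately show ?case using ab by metis
qed

lemma finite_small_denominators:
  assumes "Im \<tau> > 0"
  shows "finite {(c::int, d::int). norm (of_int c * \<tau> + of_int d) \<le> 1}"
proof (rule finite_subset)
  define A where "A = \<lceil>1 / Im \<tau>\<rceil>"
  define B where "B = \<lceil>1 + of_int A * norm \<tau>\<rceil>"
  show "{(c::int, d::int). norm (of_int c * \<tau> + of_int d) \<le> 1} \<subseteq> {- A..A} \<times> {- B..B}"
  proof clarify
    fix c d :: int assume le: "norm (of_int c * \<tau> + of_int d) \<le> 1"
    have "\<bar>of_int c * Im \<tau>\<bar> \<le> 1" using abs_Im_le_cmod[of "of_int c * \<tau> + of_int d"] le by simp
    then have "\<bar>of_int c\<bar> \<le> 1 / Im \<tau>" using assms by (simp add: abs_mult field_simps)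
    then have c: "\<bar>c\<bar> \<le> A" unfolding A_def by linarith
    have "norm (of_int d :: complex) \<le> norm (of_int c * \<tau> + of_int d) + norm (of_int c * \<tau>)"
      by (metis add_diff_cancel_left' norm_triangle_ineq4)
    also have "norm (of_int c * \<tau>) \<le> of_int A * norm \<tau>"
      using c by (simp add: norm_mult mult_right_mono flip: of_int_abs)
    finally have "\<bar>of_int d :: real\<bar> \<le> 1 + of_int A * norm \<tau>" using le by simp
    then have "\<bar>d\<bar> \<le> B" unfolding B_def by linarith
    then show "c \<in> {- A..A} \<and> d \<in> {- B..B}" using c by auto
  qed
qed auto

text \<open>
Imaginary parts in an orbit are \<open>Im \<tau> / |c \<tau> + d|^2\<close>, and only finitely many of them reach \<open>Im \<tau>\<close>. A point of
maximal imaginary part, translated into the strip, lies outside the unit disc, since otherwise inversion would raise it.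
\<close>

lemma theta_fundamental_domain:
  assumes "Im \<tau> > 0"
  obtains x where "x \<in> theta_orbit \<tau>" "Im x > 0" "\<bar>Re x\<bar> \<le> 1" "norm x \<ge> 1"
proof -
  define S where "S = {Im x |x. x \<in> theta_orbit \<tau> \<and> Im x \<ge> Im \<tau>}"
  have "S \<subseteq> (\<lambda>(c, d). Im \<tau> / norm (of_int c * \<tau> + of_int d) ^ 2) ` {(c::int, d::int). norm (of_int c * \<tau> + of_int d) \<le> 1}"
  proof
    fix y assume "y \<in> S"
    then obtain x where x: "x \<in> theta_orbit \<tau>" "Im x \<ge> Im \<tau>" "y = Im x" by (auto simp: S_def)
    then obtain c d :: int where cd: "of_int c * \<tau> + of_int d \<noteq> 0" "Im x = Im \<tau> / norm (of_int c * \<tau> + of_int d) ^ 2"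
      using theta_orbit_form[OF x(1) assms] by blast
    define X where "X = norm (of_int c * \<tau> + of_int d) ^ 2"
    have X: "X > 0" using cd(1) by (simp add: X_def)
    have "Im \<tau> \<le> Im \<tau> / X" using x(2) cd(2) by (simp add: X_def)
    then have "Im \<tau> * X \<le> Im \<tau> * 1" using X by (simp add: pos_le_divide_eq)
    then have X1: "X \<le> 1" using mult_le_cancel_left_pos[OF assms, of X 1] by blast
    have "norm (of_int c * \<tau> + of_int d) \<le> 1"
      by (rule power2_le_imp_le) (use X1 in \<open>simp_all add: X_def\<close>)
    then show "y \<in> (\<lambda>(c, d). Im \<tau> / norm (of_int c * \<tau> + of_int d) ^ 2) ` {(c::int, d::int). norm (of_int c * \<tau> + of_int d) \<le> 1}"
      using cd x by force
  qed
  then have fin: "finite S" using finite_small_denominators[OF assms] finite_surj by blast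
  have ne: "S \<noteq> {}" using orbit_base[of \<tau>] by (auto simp: S_def)
  obtain x where x: "x \<in> theta_orbit \<tau>" "Im x \<ge> Im \<tau>" "Im x = Max S"
    using Max_in[OF fin ne] by (auto simp: S_def)
  define k where "k = - round (Re x / 2)"
  define y where "y = x + 2 * of_int k"
  have y: "y \<in> theta_orbit \<tau>" unfolding y_def by (intro theta_orbit.intros x)
  have Imy: "Im y = Im x" by (simp add: y_def)
  have "\<bar>Re x / 2 + of_int k\<bar> \<le> 1 / 2"
    using of_int_round_abs_le[of "Re x / 2"] by (simp add: k_def abs_minus_commute)
  moreover have "Re y = Re x + 2 * of_int k" by (simp add: y_def)
  ultimately have Re: "\<bar>Re y\<bar> \<le> 1" by linarith
  have pos: "Im y > 0" using Imy x assms by simp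
  have "norm y \<ge> 1"
  proof (rule ccontr)
    assume "\<not> norm y \<ge> 1"
    then have "norm y ^ 2 < 1" by (simp add: power_less_one_iff)
    moreover have "norm y ^ 2 > 0" using pos by auto
    ultimately have "Im (- 1 / y) > Im y"
      unfolding Im_neg_inverse using pos by (simp add: field_simps)
    moreover have "Im (- 1 / y) \<in> S"
      unfolding S_def using calculation Imy x y theta_orbit.orbit_inv by fastforce
    then have "Im (- 1 / y) \<le> Max S" using fin by simp
    ultimately show False using Imy x by simp
  qed
  then show thesis using that y pos Re by blast
qed

text \<open>
If \<open>h\<close> is not zero, then its supremum over the disc equals its supremum over the fundamental domain. The domain has
two cusps. Near the second one \<open>h\<close> is small by assumption, and the first one is the centre of the disc, so the supremum is attained
inside the disc. By the maximum principle \<open>h\<close> is constant, and it is small at the second cusp.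
\<close>

lemma modular_vanishing:
  fixes h :: "complex \<Rightarrow> complex"
  assumes hol: "h holomorphic_on ball 0 1"
    and inv: "\<And>\<tau>. Im \<tau> > 0 \<Longrightarrow> h (- nome (- 1 / \<tau>)) = h (- nome \<tau>)"
    and cusp: "\<And>\<epsilon>. \<epsilon> > 0 \<Longrightarrow> \<exists>B. \<forall>\<tau>. Im \<tau> > B \<longrightarrow> norm (h (nome (- 1 / \<tau>))) < \<epsilon>"
    and z: "z \<in> ball 0 1"
  shows "h z = 0"
proof (rule ccontr)
  assume nz: "h z \<noteq> 0"
  define f where "f = (\<lambda>\<tau>. h (- nome \<tau>))"
  define \<epsilon> where "\<epsilon> = norm (h z)"
  have \<epsilon>: "\<epsilon> > 0" using nz by (simp add: \<epsilon>_def)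
  obtain B0 where B0: "\<And>\<tau>. Im \<tau> > B0 \<Longrightarrow> norm (h (nome (- 1 / \<tau>))) < \<epsilon>"
    using cusp[OF \<epsilon>] by blast
  define B where "B = max B0 1"
  have B: "B > 0" "\<And>\<tau>. Im \<tau> > B \<Longrightarrow> norm (h (nome (- 1 / \<tau>))) < \<epsilon>"
    using B0 by (auto simp: B_def)
  have orbit: "f x = f \<tau> \<and> Im x > 0" if "x \<in> theta_orbit \<tau>" "Im \<tau> > 0" for x \<tau>
    using that(1)
  proof induction
    case (orbit_shift x k)
    have "pi * \<i> * (x + 2 * of_int k) = pi * \<i> * x + 2 * of_real pi * \<i> * of_int k"
      by (simp add: algebra_simps)
    then have "exp (pi * \<i> * (x + 2 * of_int k)) = nome x"
      by (simp only: exp_add) (simp add: exp_eq_1 mult_ac)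
    then show ?case using orbit_shift by (simp add: f_def)
  next
    case (orbit_inv x)
    moreover have "x \<noteq> 0" using orbit_inv by auto
    then have "Im (- 1 / x) > 0" unfolding Im_neg_inverse using orbit_inv by simp
    ultimately show ?case using inv[of x] unfolding f_def by simp
  qed (use that in auto)
  have shift1: "f (1 - 1 / \<sigma>) = h (nome (- 1 / \<sigma>))" for \<sigma>
    by (simp add: f_def ring_distribs exp_diff right_diff_distrib exp_minus divide_inverse)
  have shift2: "f (- 1 - 1 / \<sigma>) = h (nome (- 1 / \<sigma>))" for \<sigma>
    by (simp add: f_def ring_distribs exp_diff right_diff_distrib exp_minus divide_inverse)
  define \<delta> where "\<delta> = 1 / (2 * B)"
  have \<delta>: "\<delta> > 0" using B by (simp add: \<delta>_def)
  \<comment> \<open>A point of the fundamental domain of small imaginary part is close to \<open>1\<close> or \<open>-1\<close>; \<open>s\<close> is the closer of the two, and \<open>\<sigma>\<close> is high in the half-plane.\<close>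
  have near: "norm (f \<tau>) < \<epsilon>" if \<tau>: "Im \<tau> > 0" "\<bar>Re \<tau>\<bar> \<le> 1" "norm \<tau> \<ge> 1" "Im \<tau> < \<delta>" for \<tau>
  proof -
    define s :: real where "s = (if Re \<tau> \<ge> 0 then 1 else - 1)"
    define \<sigma> where "\<sigma> = - 1 / (\<tau> - of_real s)"
    have ne: "\<tau> - of_real s \<noteq> 0" using \<tau> by (auto simp: complex_eq_iff)
    have \<tau>s: "\<tau> = of_real s - 1 / \<sigma>" using ne by (simp add: \<sigma>_def)
    define x where "x = 1 - \<bar>Re \<tau>\<bar>"
    define y where "y = Im \<tau>"
    have x: "0 \<le> x" "x \<le> 1" using \<tau> by (auto simp: x_def)
    have "(1 - x)\<^sup>2 + y\<^sup>2 = norm \<tau> ^ 2" by (simp add: x_def y_def cmod_power2)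
    also have "\<dots> \<ge> 1" using \<tau> by simp
    finally have "2 * x - x\<^sup>2 \<le> y\<^sup>2" by (simp add: power2_eq_square algebra_simps)
    moreover have "x\<^sup>2 \<le> x" using x by (simp add: power2_eq_square mult_left_le)
    ultimately have xy: "x\<^sup>2 \<le> y\<^sup>2" by linarith
    have "norm (\<tau> - of_real s) ^ 2 = x\<^sup>2 + y\<^sup>2"
      unfolding cmod_power2 by (simp add: s_def x_def y_def power2_eq_square algebra_simps)
    also have "\<dots> \<le> 2 * y\<^sup>2" using xy by simp
    finally have le: "norm (\<tau> - of_real s) ^ 2 \<le> 2 * y\<^sup>2" .
    have y0: "y > 0" using \<tau> by (simp add: y_def)
    have "Im \<sigma> = y / norm (\<tau> - of_real s) ^ 2"
      unfolding \<sigma>_def Im_neg_inverse by (simp add: y_def)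
    also have "\<dots> \<ge> y / (2 * y\<^sup>2)"
      using le y0 ne by (intro divide_left_mono) auto
    also have "y / (2 * y\<^sup>2) = 1 / (2 * y)" using y0 by (simp add: power2_eq_square)
    finally have "Im \<sigma> \<ge> 1 / (2 * y)" .
    moreover have "1 / (2 * y) > B"
      using \<tau>(4) y0 B(1) unfolding \<delta>_def y_def[symmetric] by (simp add: field_simps)
    ultimately have "norm (h (nome (- 1 / \<sigma>))) < \<epsilon>" using B(2)[of \<sigma>] by simp
    moreover have "f \<tau> = h (nome (- 1 / \<sigma>))"
      using \<tau>s shift1[of \<sigma>] shift2[of \<sigma>] by (auto simp: s_def split: if_splits)
    ultimately show ?thesis by simp
  qed
  \<comment> \<open>Every point of the disc has an equivalent point with \<open>|w| \<le> \<rho>\<close>, or one near the second cusp.\<close>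
  define \<rho> where "\<rho> = max (exp (- pi * \<delta>)) (norm z)"
  have \<rho>: "0 < \<rho>" "\<rho> < 1" using \<delta> z by (auto simp: \<rho>_def less_max_iff_disj)
  have sub: "cball 0 \<rho> \<subseteq> ball (0::complex) 1" using \<rho> by auto
  have "continuous_on (cball 0 \<rho>) (\<lambda>w. norm (h w))"
    by (intro continuous_intros holomorphic_on_imp_continuous_on holomorphic_on_subset[OF hol sub])
  then obtain z0 where z0: "z0 \<in> cball 0 \<rho>" "\<And>w. w \<in> cball 0 \<rho> \<Longrightarrow> norm (h w) \<le> norm (h z0)"
    using continuous_attains_sup[of "cball 0 \<rho>" "\<lambda>w. norm (h w)"] \<rho> by auto
  have \<epsilon>z0: "\<epsilon> \<le> norm (h z0)" unfolding \<epsilon>_def using z0(2)[of z] by (simp add: \<rho>_def)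
  have max: "norm (h w) \<le> norm (h z0)" if w: "w \<in> ball 0 1" for w
  proof (cases "w = 0")
    case True
    then show ?thesis using z0(2)[of 0] \<rho> by simp
  next
    case False
    define \<tau> where "\<tau> = Ln (- w) / (pi * \<i>)"
    have "pi * \<i> * \<tau> = Ln (- w)" by (simp add: \<tau>_def)
    then have e: "nome \<tau> = - w" using False by (metis exp_Ln neg_equal_0_iff_equal)
    have "Im \<tau> = - ln (norm w) / pi" using False by (simp add: \<tau>_def Im_divide power2_eq_square Re_Ln)
    moreover have "ln (norm w) < 0" using False w by simp
    ultimately have \<tau>: "Im \<tau> > 0" by (simp add: divide_neg_pos)
    obtain x where x: "x \<in> theta_orbit \<tau>" "Im x > 0" "\<bar>Re x\<bar> \<le> 1" "norm x \<ge> 1"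
      by (rule theta_fundamental_domain[OF \<tau>])
    have hw: "h w = f x" using orbit[OF x(1) \<tau>] e by (simp add: f_def)
    show ?thesis
    proof (cases "Im x < \<delta>")
      case True
      then show ?thesis using near[OF x(2,3,4)] hw \<epsilon>z0 by simp
    next
      case False
      then have "norm (- nome x) \<le> \<rho>" by (simp add: \<rho>_def le_max_iff_disj)
      then show ?thesis unfolding hw f_def by (intro z0(2)) (simp add: dist_norm)
    qed
  qed
  have "h constant_on ball 0 1"
    by (rule maximum_modulus_principle[OF hol, of "ball 0 1" z0]) (use z0 sub max in auto)
  then obtain c where c: "\<And>w. w \<in> ball 0 1 \<Longrightarrow> h w = c" by (auto simp: constant_on_def)
  define \<sigma> where "\<sigma> = \<i> * of_real (B + 1)"
  have "norm (h (nome (- 1 / \<sigma>))) < \<epsilon>" by (rule B(2)) (simp add: \<sigma>_def)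
  moreover have "norm (nome (- 1 / \<sigma>)) < 1"
    using B(1) by (auto simp: \<sigma>_def Re_divide Im_divide field_simps intro!: add_pos_pos mult_pos_pos)
  then have "h (nome (- 1 / \<sigma>)) = c" by (intro c) simp
  moreover have "norm c = \<epsilon>" using c[OF z] by (simp add: \<epsilon>_def)
  ultimately show False by simp
qed

section \<open>Expansions at the two cusps\<close>

lemma nome_sq_eq: "nome_sq \<tau> = nome \<tau> ^ 2"
  by (simp add: exp_double[symmetric] mult_ac power2_eq_square flip: exp_add)

lemma qterm_4: "qterm \<tau> 4 = nome \<tau>" by (simp add: qterm_def mult_ac)
lemma qterm_8: "qterm \<tau> 8 = nome_sq \<tau>" by (simp add: qterm_def mult_ac)
lemma qterm_add: "qterm \<tau> (a + b) = qterm \<tau> a * qterm \<tau> b"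
  by (simp add: qterm_def exp_add[symmetric] ring_distribs add_divide_distrib)
lemma qterm_mult_nat: "qterm \<tau> (a * int k) = qterm \<tau> a ^ k"
  by (simp add: qterm_def exp_of_nat_mult[symmetric] mult_ac)

lemma exp_half_plane_surj:
  assumes "0 < norm x" "norm x < 1" "r > 0"
  obtains \<tau> where "Im \<tau> > 0" "exp (of_real r * pi * \<i> * \<tau>) = x"
proof
  define \<tau> where "\<tau> = Ln x / (of_real r * pi * \<i>)"
  have "Im \<tau> = - ln (norm x) / (r * pi)"
    using assms by (simp add: \<tau>_def Im_divide Re_Ln power2_eq_square field_simps)
  moreover have "ln (norm x) < 0" using assms by simp
  ultimately show "Im \<tau> > 0" using assms by (simp add: divide_neg_pos)
  have "of_real r * pi * \<i> * \<tau> = Ln x" using assms by (simp add: \<tau>_def)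
  then show "exp (of_real r * pi * \<i> * \<tau>) = x" using assms by (metis exp_Ln norm_zero less_irrefl)
qed

text \<open>
The classical formula \<open>\<theta>\<^sub>2(q) = 2 q^(1/4) \<psi>(q^2)\<close>.
\<close>

lemma theta32_1_eq:
  assumes "Im \<tau> > 0"
  shows "theta32 1 \<tau> = 2 * qterm \<tau> 1 * evl psi (nome_sq \<tau>)"
proof -
  define y where "y = exp (pi * \<i> * \<tau> / 2)"
  have y1: "norm y < 1" using assms by (simp add: y_def)
  have y4: "y ^ 4 = nome_sq \<tau>"
    by (simp add: y_def exp_of_nat_mult[symmetric] mult_ac)
  have nonneg: "0 \<le> 2 * a * (a + 1)" for a :: int
    by (cases "a \<ge> 0") (auto intro: mult_nonpos_nonpos)
  have "((\<lambda>k. half_term_at 1 \<tau> 0 k) has_sum theta32 1 \<tau>) UNIV"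
    unfolding theta32_def by (rule theta_shift_has_sum[OF assms]) simp
  then have "((\<lambda>a. qterm \<tau> 1 * y ^ nat (2 * a * (a + 1))) has_sum theta32 1 \<tau>) UNIV"
  proof (subst (asm) has_sum_reindex_bij_witness[of UNIV "\<lambda>a. a + 1" "\<lambda>k. k - 1" UNIV
        "\<lambda>a. qterm \<tau> 1 * y ^ nat (2 * a * (a + 1))" _ "theta32 1 \<tau>"])
    fix k :: int
    have e: "of_nat (nat (2 * (k - 1) * (k - 1 + 1))) = (of_int (2 * (k - 1) * (k - 1 + 1)) :: complex)"
      using nonneg[of "k - 1"] by (metis of_int_of_nat_eq int_nat_eq)
    show "qterm \<tau> 1 * y ^ nat (2 * (k - 1) * (k - 1 + 1)) =
        half_term_at 1 \<tau> 0 k"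
      unfolding qterm_def y_def exp_of_nat_mult[symmetric] exp_add[symmetric] e
      by (intro arg_cong[where f = exp]) (simp add: power2_eq_square field_simps)
  qed auto
  then have "((\<lambda>a. inverse (qterm \<tau> 1) * (qterm \<tau> 1 * y ^ nat (2 * a * (a + 1)))) has_sum inverse (qterm \<tau> 1) * theta32 1 \<tau>) UNIV"
    by (rule has_sum_cmult_right)
  moreover have q0: "qterm \<tau> 1 \<noteq> 0" by (simp add: qterm_def)
  ultimately have "((\<lambda>a. y ^ nat (2 * a * (a + 1))) has_sum inverse (qterm \<tau> 1) * theta32 1 \<tau>) UNIV"
    by (simp add: mult.assoc[symmetric])
  then have "evl (2 * dil 4 psi) y = inverse (qterm \<tau> 1) * theta32 1 \<tau>"
    unfolding double_psi_eq_rep by (rule rep_fps_has_sum) (rule finite_pronic_fibre)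
  moreover have "evl (2 * dil 4 psi) y = 2 * evl psi (nome_sq \<tau>)"
  proof -
    have d: "disc_fps (dil 4 psi)"
      by (rule disc_fps_bounded[of _ 1]) (auto simp: fps_nth_compose_X_power psi_def)
    show ?thesis
      unfolding fps_numeral_fps_const using y1 by (simp add: evl_mult d evl_dil y4)
  qed
  ultimately show ?thesis using q0 by (simp add: field_simps)
qed

lemma evl_psi_nonzero: assumes "norm x < 1" shows "evl psi x \<noteq> 0"
proof (cases "x = 0")
  case True
  then show ?thesis by (auto simp: evl_at_0 psi_def)
next
  case False
  then obtain \<tau> where \<tau>: "Im \<tau> > 0" "exp (of_real 2 * pi * \<i> * \<tau>) = x"
    using exp_half_plane_surj[of x 2] assms by auto
  then show ?thesis using theta32_nonzero[OF \<tau>(1), of 1] theta32_1_eq[OF \<tau>(1)] by auto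
qed

definition psi_inv :: "int fps" where "psi_inv = fps_right_inverse psi 1"

lemma psi_mult_inv: "psi * psi_inv = 1"
  unfolding psi_inv_def by (rule fps_right_inverse) (auto simp: psi_def)

text \<open>
\<open>\<psi>\<close> has no zeros in the disc, because \<open>\<theta>\<^sub>2\<close> has none in the upper half-plane. Hence \<open>1 / \<psi>\<close> is
holomorphic there, and its Taylor series is the formal inverse.
\<close>

lemma disc_psi_inv [simp]: "disc_fps psi_inv"
proof -
  define h where "h = (\<lambda>z. 1 / evl psi z)"
  have hol: "h holomorphic_on eball 0 1"
  proof -
    have "h holomorphic_on ball 0 1" unfolding h_def
      by (intro holomorphic_intros evl_holomorphic) (auto simp: evl_psi_nonzero)
    moreover have "eball (0::complex) 1 = ball 0 1" by (auto simp: eball_def one_ereal_def)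
    ultimately show ?thesis by simp
  qed
  define A where "A = fps_expansion h 0"
  have A: "fps_conv_radius A \<ge> 1" unfolding A_def by (rule conv_radius_fps_expansion[OF hol])
  have ev: "eval_fps A z = h z" if "norm z < 1" for z
    using eval_fps_expansion[OF hol, of z] that by (auto simp: A_def eball_def one_ereal_def)
  have r: "ereal (norm z) < fps_conv_radius A" if "norm z < 1" for z :: complex
  proof -
    have "ereal (norm z) < 1" using that by (simp add: one_ereal_def)
    then show ?thesis using A by (rule less_le_trans)
  qed
  have "cfps psi * A = 1"
  proof (rule eval_fps_eqD)
    have "1 \<le> min (fps_conv_radius (cfps psi)) (fps_conv_radius A)"
      using A disc_psi unfolding disc_fps_def by simp
    then have "1 \<le> fps_conv_radius (cfps psi * A)" using fps_conv_radius_mult order_trans by blast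
    then show "fps_conv_radius (cfps psi * A) > 0" by (rule order.strict_trans2[rotated]) simp
    have "eventually (\<lambda>z. z \<in> ball (0::complex) 1) (nhds 0)"
      by (rule eventually_nhds_in_open) auto
    then show "eventually (\<lambda>z. eval_fps (cfps psi * A) z = eval_fps 1 z) (nhds 0)"
    proof eventually_elim
      case (elim z)
      then have z: "norm z < 1" by simp
      then have "eval_fps (cfps psi * A) z = evl psi z * h z"
        using disc_fps_less[OF disc_psi z] r[OF z] by (simp add: eval_fps_mult evl_def ev)
      then show ?case using evl_psi_nonzero[OF z] by (simp add: h_def)
    qed
  qed simp
  moreover have "cfps psi * cfps psi_inv = 1" by (simp add: cfps_mult[symmetric] psi_mult_inv)
  ultimately have "cfps psi * A = cfps psi * cfps psi_inv" by simp
  moreover have "cfps psi \<noteq> 0" using \<open>cfps psi * A = 1\<close> by force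
  ultimately have "A = cfps psi_inv" by simp
  then show ?thesis using A by (simp add: disc_fps_def)
qed

lemma has_sum_progression:
  assumes m: "m > 0" and supp: "\<And>n. a n \<noteq> 0 \<Longrightarrow> \<exists>k::nat. n = int m * int k + c"
  shows "((\<lambda>n. a n * qterm \<tau> n) has_sum S) UNIV \<longleftrightarrow>
    ((\<lambda>k::nat. a (int m * int k + c) * (qterm \<tau> (int m) ^ k * qterm \<tau> c)) has_sum S) UNIV"
proof -
  have "((\<lambda>n. a n * qterm \<tau> n) has_sum S) UNIV \<longleftrightarrow> ((\<lambda>n. a n * qterm \<tau> n) has_sum S) (range (\<lambda>k::nat. int m * int k + c))"
    by (rule has_sum_cong_neutral) (use supp in fastforce)+
  also have "\<dots> \<longleftrightarrow> (((\<lambda>n. a n * qterm \<tau> n) \<circ> (\<lambda>k::nat. int m * int k + c)) has_sum S) UNIV"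
    using m by (intro has_sum_reindex) (auto simp: inj_def)
  finally show ?thesis by (simp add: o_def qterm_add qterm_mult_nat)
qed

text \<open>
Every positive number below 1 is a value of \<open>exp (r \<pi> i \<tau>)\<close>, and unconditional summability is absolute.
\<close>

lemma disc_fps_from_half_plane:
  assumes r: "r > 0" and S: "\<And>\<tau>. Im \<tau> > 0 \<Longrightarrow> (\<lambda>k. of_int (f $ k) * exp (of_real r * pi * \<i> * \<tau>) ^ k) summable_on UNIV"
  shows "disc_fps f"
proof (rule disc_fpsI)
  fix x :: real assume x: "0 < x" "x < 1"
  obtain \<tau> where \<tau>: "Im \<tau> > 0" "exp (of_real r * pi * \<i> * \<tau>) = of_real x"
    using exp_half_plane_surj[of "of_real x" r] x r by auto
  have "(\<lambda>k. of_int (f $ k) * of_real x ^ k :: complex) summable_on UNIV"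
    using S[OF \<tau>(1)] unfolding \<tau>(2) .
  then have "(\<lambda>k. norm (of_int (f $ k) * of_real x ^ k :: complex)) summable_on UNIV"
    by (simp only: summable_on_iff_abs_summable_on_complex)
  then have "summable (\<lambda>k. norm (of_int (f $ k) * of_real x ^ k :: complex))"
    by (rule summable_on_imp_summable)
  then show "summable (\<lambda>n. \<bar>real_of_int (f $ n)\<bar> * x ^ n)"
    using x by (simp add: norm_mult norm_power)
qed

text \<open>
Substituting \<open>2 s\<close> for \<open>s\<close> matches the square roots that the two symbols count. The factor 4 enters because a
power \<open>q^n\<close> has index \<open>4 n\<close> in a series of quarter powers.
\<close>

lemma Legendre_mult_4:
  assumes l: "prime l" "odd l"
  shows "Legendre (- (4 * n)) (int l) = Legendre (- n) (int l)"
proof -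
  have l0: "l > 0" using l prime_gt_0_nat by blast
  have cop2: "coprime 2 (int l)" using l by simp
  then have cop4: "coprime (int l) (2 ^ 2)" by (simp only: coprime_power_right_iff coprime_commute) simp
  define f where "f = (\<lambda>m x. if int l dvd x ^ 2 + m then 1 else 0 :: int)"
  have count: "(\<Sum>s<l. f m (int s)) = 1 + Legendre (- m) (int l)" for m
  proof -
    have "{..<l} \<inter> {s. int l dvd int s ^ 2 + m} = {s. s < l \<and> int l dvd int s ^ 2 + m}" by auto
    then show ?thesis unfolding square_root_count[OF l, symmetric] f_def by (simp add: sum.If_cases)
  qed
  have cong: "f m x = f m y" if "[x = y] (mod int l)" for m x y
    unfolding f_def using cong_dvd_iff[OF cong_add[OF cong_pow[OF that, of 2] cong_refl[of m]]] by simp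
  have "f (4 * n) (2 * x) = f n x" for x
  proof -
    have "(2 * x)\<^sup>2 + 4 * n = 2 ^ 2 * (x\<^sup>2 + n)" by (simp add: power_mult_distrib)
    then show ?thesis unfolding f_def using coprime_dvd_mult_right_iff[OF cop4, of "x\<^sup>2 + n"] by simp
  qed
  then have "(\<Sum>s<l. f (4 * n) (int s)) = (\<Sum>s<l. f n (int s))"
    using residue_sum_unit[of l "f (4 * n)" 2, OF l0 cong cop2] by simp
  then show ?thesis unfolding count by simp
qed

definition pbar_int :: "int \<Rightarrow> int" where
  "pbar_int n = (if n \<ge> 0 then int (pbar_nat (nat n)) else 0)"

text \<open>
The series \<open>T F\<close>.
\<close>

definition hecke_pbar :: "nat \<Rightarrow> int fps" where
  "hecke_pbar l = Abs_fps (\<lambda>k. hecke_coeff l pbar_int (int k))"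

text \<open>
The reciprocal of \<open>\<theta>\<^sub>3\<close> is \<open>F(-q)\<close> and that of \<open>\<theta>\<^sub>4\<close> is \<open>F(q)\<close>.
\<close>

definition cusp_sign :: "nat \<Rightarrow> int" where "cusp_sign \<chi> = (if \<chi> = 0 then - 1 else 1)"

lemma norm_nome: "Im \<tau> > 0 \<Longrightarrow> norm (nome \<tau>) < 1" by simp

lemma norm_signed_nome: "Im \<tau> > 0 \<Longrightarrow> norm (of_int (cusp_sign \<chi>) * nome \<tau>) < 1"
  by (simp add: cusp_sign_def)

lemma theta34_eq_phim:
  assumes "Im \<tau> > 0" "\<chi> = 0 \<or> \<chi> = 1"
  shows "theta34 \<chi> \<tau> = evl phim (of_int (cusp_sign \<chi>) * nome \<tau>)"
  using assms evl_phim[OF assms(1)] evl_phi[OF assms(1)] evl_phim_minus[of "- nome \<tau>"]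
  by (auto simp: theta34_def cusp_sign_def)

lemma inverse_theta34:
  assumes "Im \<tau> > 0" "\<chi> = 0 \<or> \<chi> = 1"
  shows "1 / theta34 \<chi> \<tau> = evl pbar_fps (of_int (cusp_sign \<chi>) * nome \<tau>)"
  using evl_pbar_phim[OF norm_signed_nome[OF assms(1)], of \<chi>] theta34_nonzero[OF assms]
  unfolding theta34_eq_phim[OF assms] by (simp add: field_simps)

lemma cusp_sign_power: "odd k \<Longrightarrow> cusp_sign \<chi> ^ (k * n) = cusp_sign \<chi> ^ n"
  by (simp add: cusp_sign_def power_mult)

lemma nonneg_multiple:
  assumes "m > 0" "int m dvd n" "n \<ge> 0" shows "\<exists>k::nat. n = int m * int k"
proof -
  obtain j where "n = int m * j" using assms(2) by blast
  moreover from this have "j \<ge> 0" using assms by (simp add: zero_le_mult_iff)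
  ultimately show ?thesis by (intro exI[of _ "nat j"]) simp
qed

lemma hecke_coeff_support:
  assumes "hecke_coeff l a n \<noteq> 0"
  shows "a (int l ^ 2 * n) \<noteq> 0 \<or> a n \<noteq> 0 \<or> (int l ^ 2 dvd n \<and> a (n div int l ^ 2) \<noteq> 0)"
proof (rule ccontr)
  assume "\<not> ?thesis"
  then have "hecke_coeff l a n = 0" by (simp add: hecke_coeff_def)
  then show False using assms by contradiction
qed

text \<open>
The sign \<open>(-1)^n\<close> is compatible with the operator because \<open>l^2\<close> is odd.
\<close>

lemma hecke_pbar_has_sum:
  assumes l: "prime l" "odd l" and \<tau>: "Im \<tau> > 0" and \<chi>: "\<chi> = 0 \<or> \<chi> = 1"
  shows "((\<lambda>k. of_int (hecke_pbar l $ k) * (of_int (cusp_sign \<chi>) * nome \<tau>) ^ k)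
     has_sum hecke l (\<lambda>\<tau>. 1 / theta34 \<chi> \<tau>) \<tau>) UNIV"
proof -
  have l0: "l > 0" using l prime_gt_0_nat by blast
  define s where "s = cusp_sign \<chi>"
  \<comment> \<open>The index \<open>k\<close> of \<open>F\<close> becomes the index \<open>4 k\<close> of quarter powers.\<close>
  define a :: "int \<Rightarrow> complex" where "a = (\<lambda>n. if 4 dvd n then of_int (s ^ nat (n div 4) * pbar_int (n div 4)) else 0)"
  have a: "((\<lambda>n. a n * qterm \<tau> n) has_sum 1 / theta34 \<chi> \<tau>) UNIV" if \<tau>: "Im \<tau> > 0" for \<tau>
  proof (rule has_sum_progression[where m = 4 and c = 0, THEN iffD2])
    have "((\<lambda>k. of_int (pbar_fps $ k) * (of_int s * nome \<tau>) ^ k) has_sum 1 / theta34 \<chi> \<tau>) UNIV"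
      unfolding inverse_theta34[OF \<tau> \<chi>] s_def by (intro evl_has_sum norm_signed_nome \<tau>) simp
    then show "((\<lambda>k::nat. a (int 4 * int k + 0) * (qterm \<tau> (int 4) ^ k * qterm \<tau> 0)) has_sum 1 / theta34 \<chi> \<tau>) UNIV"
      by (simp add: a_def qterm_4 pbar_int_def pbar_fps_def power_mult_distrib mult_ac) (simp add: qterm_def)
    fix n assume "a n \<noteq> 0"
    then have "4 dvd n" "n div 4 \<ge> 0" by (auto simp: a_def pbar_int_def split: if_splits)
    then show "\<exists>k::nat. n = int 4 * int k + 0" by (intro exI[of _ "nat (n div 4)"]) simp
  qed simp
  have odd: "odd (l\<^sup>2)" using l by simp
  have cop: "coprime (int l ^ 2) 4"
  proof -
    have "coprime (int l) (2 ^ 2)" using l by (intro coprime_power_right_iff[THEN iffD2] disjI1) simp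
    then show ?thesis by simp
  qed
  have T: "hecke_coeff l a (int 4 * int k + 0) = of_int (hecke_pbar l $ k) * of_int s ^ k" for k
  proof -
    have 1: "a (int l ^ 2 * (4 * int k)) = of_int (s ^ k * pbar_int (int l ^ 2 * int k))"
    proof -
      have "int l ^ 2 * (4 * int k) div 4 = int l ^ 2 * int k" by simp
      moreover have "nat (int l ^ 2 * int k) = l\<^sup>2 * k" by (metis nat_int of_nat_mult of_nat_power)
      ultimately show ?thesis unfolding a_def using cusp_sign_power[OF odd, of \<chi> k] by (simp add: s_def)
    qed
    have 2: "a (4 * int k) = of_int (s ^ k * pbar_int (int k))" by (simp add: a_def)
    have dvd: "int l ^ 2 dvd 4 * int k \<longleftrightarrow> int l ^ 2 dvd int k"
      by (rule coprime_dvd_mult_right_iff[OF cop])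
    have 3: "a (4 * int k div int l ^ 2) = of_int (s ^ k * pbar_int (int k div int l ^ 2))" if "int l ^ 2 dvd int k"
    proof -
      have "int (l\<^sup>2) dvd int k" using that by simp
      then have "l\<^sup>2 dvd k" by (simp only: of_nat_dvd_iff)
      then obtain j where j: "k = l\<^sup>2 * j" by (rule dvdE)
      have "4 * int k div int l ^ 2 = 4 * int j" "int k div int l ^ 2 = int j"
        using l0 by (simp_all add: j)
      then show ?thesis using cusp_sign_power[OF odd, of \<chi> j] by (simp add: a_def s_def j)
    qed
    have "hecke_coeff l a (4 * int k) = of_int (s ^ k * hecke_coeff l pbar_int (int k))"
      unfolding hecke_coeff_def 1 2 dvd Legendre_mult_4[OF l] using 3
      by (auto simp: algebra_simps)
    then show ?thesis by (simp add: hecke_pbar_def mult.commute)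
  qed
  have "((\<lambda>k::nat. hecke_coeff l a (int 4 * int k + 0) * (qterm \<tau> (int 4) ^ k * qterm \<tau> 0)) has_sum hecke l (\<lambda>\<tau>. 1 / theta34 \<chi> \<tau>) \<tau>) UNIV"
  proof (rule has_sum_progression[THEN iffD1, OF _ _ hecke_expansion[OF l a \<tau>]])
    fix n assume n: "hecke_coeff l a n \<noteq> 0"
    have an: "4 dvd n \<and> n \<ge> 0" if "a n \<noteq> 0" for n
      using that by (auto simp: a_def pbar_int_def split: if_splits)
    have "4 dvd n \<and> n \<ge> 0"
    proof -
      consider "a (int l ^ 2 * n) \<noteq> 0" | "a n \<noteq> 0" | "int l ^ 2 dvd n" "a (n div int l ^ 2) \<noteq> 0"
        using hecke_coeff_support[OF n] by blast
      then show ?thesis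
      proof cases
        case 1
        then have *: "4 dvd int l ^ 2 * n" "int l ^ 2 * n \<ge> 0" using an by auto
        have "4 dvd n" using *(1) cop coprime_commute coprime_dvd_mult_right_iff by blast
        moreover have "n \<ge> 0" using *(2) l0 by (simp add: zero_le_mult_iff)
        ultimately show ?thesis by simp
      next
        case 3
        then obtain j where j: "n = int l ^ 2 * j" by blast
        then have "4 dvd j \<and> j \<ge> 0" using 3 an l0 by simp
        then show ?thesis using j by simp
      qed (use an in auto)
    qed
    then show "\<exists>k::nat. n = int 4 * int k + 0" using nonneg_multiple[of 4 n] by simp
  qed simp_all
  then show ?thesis unfolding T by (simp add: qterm_4 s_def power_mult_distrib mult_ac) (simp add: qterm_def)
qed

lemma disc_hecke_pbar: assumes l: "prime l" "odd l" shows "disc_fps (hecke_pbar l)"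
proof (rule disc_fps_from_half_plane[of 1])
  fix \<tau> :: complex assume "Im \<tau> > 0"
  from hecke_pbar_has_sum[OF l this, of 1]
  show "(\<lambda>k. of_int (hecke_pbar l $ k) * exp (of_real 1 * pi * \<i> * \<tau>) ^ k) summable_on UNIV"
    by (auto simp: cusp_sign_def summable_on_def)
qed simp

lemma evl_hecke_pbar:
  assumes l: "prime l" "odd l" and \<tau>: "Im \<tau> > 0" and \<chi>: "\<chi> = 0 \<or> \<chi> = 1"
  shows "evl (hecke_pbar l) (of_int (cusp_sign \<chi>) * nome \<tau>) = hecke l (\<lambda>\<tau>. 1 / theta34 \<chi> \<tau>) \<tau>"
  by (rule evl_eqI[OF hecke_pbar_has_sum[OF assms]])

lemma odd_square_mod_8: assumes "odd l" shows "\<exists>m. l\<^sup>2 = 8 * m + (1::nat)"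
proof -
  obtain h where h: "l = 2 * h + 1" using assms by (metis oddE)
  have "even (h * (h + 1))" by simp
  then obtain m where "h * (h + 1) = 2 * m" by blast
  then have "l\<^sup>2 = 8 * m + 1" unfolding h by (simp add: power2_eq_square algebra_simps)
  then show ?thesis ..
qed

text \<open>
The coefficients of \<open>2 / \<theta>\<^sub>2 = q^(-1/4) / \<psi>(q^2)\<close> at \<open>q^(n/4)\<close>.
\<close>

definition inv_theta_coeff :: "int \<Rightarrow> int" where
  "inv_theta_coeff n = (if 8 dvd n + 1 \<and> n \<ge> - 1 then psi_inv $ nat ((n + 1) div 8) else 0)"

lemma inv_theta_coeff_support:
  "inv_theta_coeff n \<noteq> 0 \<Longrightarrow> 8 dvd n + 1 \<and> n \<ge> - 1"
  by (auto simp: inv_theta_coeff_def split: if_splits)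

lemma inverse_theta32_has_sum:
  assumes \<tau>: "Im \<tau> > 0"
  shows "((\<lambda>n. (of_int (inv_theta_coeff n) / 2) * qterm \<tau> n) has_sum 1 / theta32 1 \<tau>) UNIV"
proof (rule has_sum_progression[where m = 8 and c = "-1", THEN iffD2])
  define x where "x = nome_sq \<tau>"
  have x: "norm x < 1" using \<tau> by (simp add: x_def)
  have "evl psi x * evl psi_inv x = 1"
    using x by (metis disc_psi disc_psi_inv evl_1 evl_mult psi_mult_inv)
  moreover have "qterm \<tau> 1 * qterm \<tau> (- 1) = 1" by (simp add: qterm_def exp_add[symmetric])
  ultimately have "(2 * qterm \<tau> 1 * evl psi x) * (evl psi_inv x * (qterm \<tau> (- 1) / 2)) = 1"
    by (simp add: mult_ac)
  then have inv: "1 / theta32 1 \<tau> = evl psi_inv x * (qterm \<tau> (- 1) / 2)"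
    unfolding theta32_1_eq[OF \<tau>] x_def[symmetric] by (metis eq_divide_imp mult.commute mult_zero_left zero_neq_one)
  have "((\<lambda>k. of_int (psi_inv $ k) * x ^ k * (qterm \<tau> (- 1) / 2)) has_sum 1 / theta32 1 \<tau>) UNIV"
    unfolding inv by (intro has_sum_cmult_left evl_has_sum x) simp
  then show "((\<lambda>k::nat. (of_int (inv_theta_coeff (int 8 * int k + - 1)) / 2) * (qterm \<tau> (int 8) ^ k * qterm \<tau> (- 1))) has_sum 1 / theta32 1 \<tau>) UNIV"
    using qterm_8[of \<tau>] unfolding x_def[symmetric] by (simp add: inv_theta_coeff_def mult_ac)
  fix n assume "(of_int (inv_theta_coeff n) / 2 :: complex) \<noteq> 0"
  then have "8 dvd n + 1 \<and> n \<ge> - 1" using inv_theta_coeff_support by simp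
  then obtain k :: nat where "n + 1 = int 8 * int k"
    using nonneg_multiple[of 8 "n + 1"] by auto
  then show "\<exists>k::nat. n = int 8 * int k + - 1" by (intro exI[of _ k]) simp
qed simp

text \<open>
The series \<open>T (2 / \<theta>\<^sub>2)\<close> multiplied by \<open>q^(l^2/4)\<close>, in the variable \<open>q^2\<close>. The operator turns the leading
exponent \<open>-1/4\<close> into \<open>-l^2/4\<close>, and all exponents stay in one class modulo 2 because \<open>l^2 \<equiv> 1\<close> modulo 8.
\<close>

definition hecke_cusp_fps :: "nat \<Rightarrow> int fps" where
  "hecke_cusp_fps l = Abs_fps (\<lambda>k. hecke_coeff l inv_theta_coeff (8 * int k - int l ^ 2))"

lemma hecke_cusp_fps_has_sum:
  assumes l: "prime l" "odd l" and \<tau>: "Im \<tau> > 0"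
  shows "((\<lambda>k. of_int (hecke_cusp_fps l $ k) * nome_sq \<tau> ^ k * (qterm \<tau> (- (int l ^ 2)) / 2))
     has_sum hecke l (\<lambda>\<tau>. 1 / theta32 1 \<tau>) \<tau>) UNIV"
proof -
  have l0: "l > 0" using l prime_gt_0_nat by blast
  define a :: "int \<Rightarrow> complex" where "a = (\<lambda>n. of_int (inv_theta_coeff n) / 2)"
  have T: "hecke_coeff l a n = of_int (hecke_coeff l inv_theta_coeff n) / 2" for n
    by (simp add: hecke_coeff_def a_def add_divide_distrib)
  obtain m where "l\<^sup>2 = 8 * m + 1" using odd_square_mod_8[OF l(2)] ..
  then have m: "int l ^ 2 = 8 * int m + 1" by (metis of_nat_1 of_nat_add of_nat_mult of_nat_numeral of_nat_power)
  have "((\<lambda>k::nat. hecke_coeff l a (int 8 * int k + - (int l ^ 2)) * (qterm \<tau> (int 8) ^ k * qterm \<tau> (- (int l ^ 2)))) has_sum hecke l (\<lambda>\<tau>. 1 / theta32 1 \<tau>) \<tau>) UNIV"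
  proof (rule has_sum_progression[THEN iffD1, OF _ _ hecke_expansion[OF l _ \<tau>]])
    show "((\<lambda>n. a n * qterm \<tau> n) has_sum 1 / theta32 1 \<tau>) UNIV" if "Im \<tau> > 0" for \<tau>
      unfolding a_def by (rule inverse_theta32_has_sum[OF that])
    fix n assume n: "hecke_coeff l a n \<noteq> 0"
    have an: "8 dvd n + 1 \<and> n \<ge> - 1" if "a n \<noteq> 0" for n
      using that inv_theta_coeff_support[of n] by (simp add: a_def)
    have *: "8 dvd n + 1 \<and> n \<ge> - (int l ^ 2)"
    proof -
      consider "a (int l ^ 2 * n) \<noteq> 0" | "a n \<noteq> 0" | "int l ^ 2 dvd n" "a (n div int l ^ 2) \<noteq> 0"
        using hecke_coeff_support[OF n] by blast
      then show ?thesis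
      proof cases
        case 1
        then have *: "8 dvd int l ^ 2 * n + 1" "int l ^ 2 * n \<ge> - 1" using an by auto
        have "int l ^ 2 * n + 1 = 8 * (int m * n) + (n + 1)" unfolding m by (simp add: algebra_simps)
        then have "8 dvd n + 1" using *(1) by (metis dvd_add_right_iff dvd_triv_left)
        moreover have "n \<ge> - 1"
        proof (rule ccontr)
          assume "\<not> n \<ge> - 1"
          then have "n \<le> - 2" by simp
          then have "int l ^ 2 * n \<le> int l ^ 2 * (- 2)" by (intro mult_left_mono) auto
          also have "\<dots> \<le> - 2" unfolding m by simp
          finally show False using *(2) by simp
        qed
        ultimately show ?thesis unfolding m by simp
      next
        case 2
        then show ?thesis using an[of n] unfolding m by auto
      next
        case 3
        then obtain j where j: "n = int l ^ 2 * j" by blast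
        then have *: "8 dvd j + 1" "j \<ge> - 1" using 3 an[of j] l0 by auto
        have "n + 1 = 8 * (int m * j) + (j + 1)" unfolding j m by (simp add: algebra_simps)
        then have "8 dvd n + 1" using *(1) by (metis dvd_add dvd_triv_left)
        moreover have "int l ^ 2 * (- 1) \<le> int l ^ 2 * j" using *(2) by (intro mult_left_mono) auto
        ultimately show ?thesis unfolding j by simp
      qed
    qed
    have "n + int l ^ 2 = (n + 1) + 8 * int m" unfolding m by simp
    also have "8 dvd (n + 1) + 8 * int m" using * by simp
    finally have "int 8 dvd n + int l ^ 2" by simp
    moreover have "n + int l ^ 2 \<ge> 0" using * by linarith
    ultimately obtain k :: nat where "n + int l ^ 2 = int 8 * int k"
      using nonneg_multiple[of 8 "n + int l ^ 2"] by auto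
    then show "\<exists>k::nat. n = int 8 * int k + - (int l ^ 2)" by (intro exI[of _ k]) simp
  qed simp_all
  then show ?thesis unfolding T
    by (simp add: hecke_cusp_fps_def qterm_8 mult_ac)
qed

lemma disc_hecke_cusp_fps: assumes l: "prime l" "odd l" shows "disc_fps (hecke_cusp_fps l)"
proof (rule disc_fps_from_half_plane[of 2])
  fix \<tau> :: complex assume \<tau>: "Im \<tau> > 0"
  have "((\<lambda>k. of_int (hecke_cusp_fps l $ k) * nome_sq \<tau> ^ k * (qterm \<tau> (- (int l ^ 2)) / 2) * (2 * qterm \<tau> (int l ^ 2)))
     has_sum hecke l (\<lambda>\<tau>. 1 / theta32 1 \<tau>) \<tau> * (2 * qterm \<tau> (int l ^ 2))) UNIV"
    by (intro has_sum_cmult_left hecke_cusp_fps_has_sum l \<tau>)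
  moreover have "qterm \<tau> (- (int l ^ 2)) * qterm \<tau> (int l ^ 2) = 1"
    by (simp add: qterm_def exp_add[symmetric])
  then have "z * (qterm \<tau> (- (int l ^ 2)) / 2) * (2 * qterm \<tau> (int l ^ 2)) = z" for z
    by (simp add: mult.assoc)
  ultimately have "((\<lambda>k. of_int (hecke_cusp_fps l $ k) * nome_sq \<tau> ^ k)
     has_sum hecke l (\<lambda>\<tau>. 1 / theta32 1 \<tau>) \<tau> * (2 * qterm \<tau> (int l ^ 2))) UNIV"
    by (simp only:)
  then show "(\<lambda>k. of_int (hecke_cusp_fps l $ k) * exp (of_real 2 * pi * \<i> * \<tau>) ^ k) summable_on UNIV"
    by (auto simp: summable_on_def)
qed simp

lemma evl_hecke_cusp_fps:
  assumes l: "prime l" "odd l" and \<tau>: "Im \<tau> > 0"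
  shows "hecke l (\<lambda>\<tau>. 1 / theta32 1 \<tau>) \<tau> = evl (hecke_cusp_fps l) (nome_sq \<tau>) * (qterm \<tau> (- (int l ^ 2)) / 2)"
proof -
  have "((\<lambda>k. of_int (hecke_cusp_fps l $ k) * nome_sq \<tau> ^ k * (qterm \<tau> (- (int l ^ 2)) / 2))
     has_sum evl (hecke_cusp_fps l) (nome_sq \<tau>) * (qterm \<tau> (- (int l ^ 2)) / 2)) UNIV"
    by (intro has_sum_cmult_left evl_has_sum disc_hecke_cusp_fps l) (use \<tau> in simp)
  then show ?thesis using hecke_cusp_fps_has_sum[OF assms] has_sum_unique by blast
qed

text \<open>
The modular function \<open>\<theta>\<^sub>2^4 \<theta>\<^sub>3^4 / (16 \<theta>\<^sub>4^8)\<close>. The next series is \<open>2^12 x\<close> times its expansion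
at the second cusp, with \<open>x = q^2\<close>.
\<close>

definition theta_unit :: "int fps" where "theta_unit = theta2_fourth * phi ^ 4 * pbar_fps ^ 8"
definition theta_unit_cusp :: "int fps" where "theta_unit_cusp = phim ^ 8 * psi_inv ^ 8"

lemma disc_dil_psi: "disc_fps (dil 2 psi)"
  by (rule disc_fps_bounded[of _ 1]) (auto simp: fps_nth_compose_X_power psi_def)

lemma disc_dil_phim: "disc_fps (dil 2 phim)"
  by (rule disc_fps_bounded[of _ 2]) (auto simp: fps_nth_compose_X_power phim_def phi_def abs_mult)

lemma disc_theta2_fourth [simp]: "disc_fps theta2_fourth" unfolding theta2_fourth_def by (intro disc_fps_mult disc_fps_power disc_dil_psi) simp
lemma disc_theta_unit [simp]: "disc_fps theta_unit" unfolding theta_unit_def by (intro disc_fps_mult disc_fps_power) simp_all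
lemma disc_theta_unit_cusp [simp]: "disc_fps theta_unit_cusp" unfolding theta_unit_cusp_def by (intro disc_fps_mult disc_fps_power) simp_all

lemma evl_theta2_fourth: "norm z < 1 \<Longrightarrow> evl theta2_fourth z = z * evl psi (z\<^sup>2) ^ 4"
  unfolding theta2_fourth_def by (simp add: evl_mult evl_power disc_fps_power disc_dil_psi evl_dil)

lemma theta32_1_power4:
  assumes "Im \<tau> > 0"
  shows "theta32 1 \<tau> ^ 4 = 16 * evl theta2_fourth (nome \<tau>)"
proof -
  have "qterm \<tau> 1 ^ 4 = nome \<tau>" using qterm_mult_nat[of \<tau> 1 4] by (simp add: qterm_4)
  then show ?thesis
    unfolding theta32_1_eq[OF assms] evl_theta2_fourth[OF norm_nome[OF assms]] nome_sq_eq by (simp add: power_mult_distrib)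
qed

lemma evl_theta_unit:
  assumes "Im \<tau> > 0"
  shows "evl theta_unit (nome \<tau>) = theta32 1 \<tau> ^ 4 * theta34 0 \<tau> ^ 4 / (16 * theta34 1 \<tau> ^ 8)"
proof -
  have "evl theta_unit z = evl theta2_fourth z * evl phi z ^ 4 * evl pbar_fps z ^ 8" if "norm z < 1" for z
    unfolding theta_unit_def using that by (simp add: evl_mult evl_power disc_fps_power disc_fps_mult)
  then have "evl theta_unit (nome \<tau>) = evl theta2_fourth (nome \<tau>) * evl phi (nome \<tau>) ^ 4 * evl pbar_fps (nome \<tau>) ^ 8"
    using norm_nome[OF assms] by blast
  also have "evl theta2_fourth (nome \<tau>) = theta32 1 \<tau> ^ 4 / 16" using theta32_1_power4[OF assms] by simp
  also have "evl phi (nome \<tau>) = theta34 0 \<tau>" using evl_phi[OF assms] by (simp add: theta34_0)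
  also have "evl pbar_fps (nome \<tau>) = 1 / theta34 1 \<tau>" using inverse_theta34[OF assms, of 1] by (simp add: cusp_sign_def)
  finally show ?thesis by (simp add: power_divide)
qed

lemma evl_theta_unit_minus:
  assumes "Im \<tau> > 0"
  shows "evl theta_unit (- nome \<tau>) = - (theta32 1 \<tau> ^ 4 * theta34 1 \<tau> ^ 4 / (16 * theta34 0 \<tau> ^ 8))"
proof -
  define q where "q = nome \<tau>"
  have n: "norm q < 1" "norm (- q) < 1" using norm_nome[OF assms] by (simp_all add: q_def)
  have "evl theta_unit (- q) = evl theta2_fourth (- q) * evl phi (- q) ^ 4 * evl pbar_fps (- q) ^ 8"
    unfolding theta_unit_def by (simp add: evl_mult evl_power disc_fps_power disc_fps_mult n)
  also have "evl theta2_fourth (- q) = - evl theta2_fourth q" using n by (simp add: evl_theta2_fourth)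
  also have "evl theta2_fourth q = theta32 1 \<tau> ^ 4 / 16" using theta32_1_power4[OF assms] by (simp add: q_def)
  also have "evl phi (- q) = theta34 1 \<tau>"
    using theta34_eq_phim[OF assms, of 1] evl_phim_minus[OF n(1)] by (simp add: cusp_sign_def q_def)
  also have "evl pbar_fps (- q) = 1 / theta34 0 \<tau>" using inverse_theta34[OF assms, of 0] by (simp add: cusp_sign_def q_def)
  finally show ?thesis unfolding q_def by (simp add: power_divide)
qed

lemma theta32_1_inversion:
  assumes "Im \<tau> > 0" shows "theta32 1 (- 1 / \<tau>) = inv_factor \<tau> * theta34 1 \<tau>"
proof -
  have \<tau>0: "\<tau> \<noteq> 0" using assms by auto
  have "theta34 1 (- 1 / (- 1 / \<tau>)) = inv_factor (- 1 / \<tau>) * theta32 1 (- 1 / \<tau>)"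
    by (rule theta34_inversion[OF Im_minus_inverse[OF assms]]) simp
  also have "- 1 / (- 1 / \<tau>) = \<tau>" using \<tau>0 by simp
  finally have "inv_factor \<tau> * theta34 1 \<tau> = (inv_factor (- 1 / \<tau>) * inv_factor \<tau>) * theta32 1 (- 1 / \<tau>)" by simp
  then show ?thesis unfolding inv_factor_inverse[OF assms] by simp
qed

text \<open>
After \<open>q \<mapsto> -q\<close> the function is \<open>- \<theta>\<^sub>2^4 \<theta>\<^sub>4^4 / (16 \<theta>\<^sub>3^8)\<close>. Inversion exchanges \<open>\<theta>\<^sub>2\<close> and
\<open>\<theta>\<^sub>4\<close> and fixes \<open>\<theta>\<^sub>3\<close> up to a common factor.
\<close>

lemma evl_theta_unit_minus_inversion:
  assumes "Im \<tau> > 0"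
  shows "evl theta_unit (- nome (- 1 / \<tau>)) = evl theta_unit (- nome \<tau>)"
  unfolding evl_theta_unit_minus[OF assms] evl_theta_unit_minus[OF Im_minus_inverse[OF assms]]
    theta32_1_inversion[OF assms] theta34_inversion[OF assms disjI1[OF refl]] theta34_inversion[OF assms disjI2[OF refl]]
  using inv_factor_nonzero[OF assms] by (simp add: theta32_0 theta34_0[symmetric] power_mult_distrib field_simps)

text \<open>
Inversion leads to \<open>\<theta>\<^sub>3^4 \<theta>\<^sub>4^4 / (16 \<theta>\<^sub>2^8)\<close>. The leading coefficient of \<open>\<theta>\<^sub>2^8\<close> is \<open>2^8\<close>, so
that \<open>16 \<sqdot> 2^8 = 4096 = 2^12\<close>; this is the source of \<open>2^12\<close> in the congruence.
\<close>

lemma evl_theta_unit_cusp: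
  assumes \<tau>: "Im \<tau> > 0"
  defines "x \<equiv> nome_sq \<tau>"
  shows "x * (4096 * evl theta_unit (nome (- 1 / \<tau>))) = evl theta_unit_cusp x"
proof -
  have x: "norm x < 1" "x \<noteq> 0" using \<tau> by (simp_all add: x_def)
  define q where "q = nome \<tau>"
  have q: "norm q < 1" unfolding q_def by (rule norm_nome[OF \<tau>])
  have xq: "x = q\<^sup>2" unfolding q_def x_def by (rule nome_sq_eq)
  have "evl theta_unit (nome (- 1 / \<tau>)) = (theta34 0 \<tau> * theta34 1 \<tau>) ^ 4 / (16 * theta32 1 \<tau> ^ 8)"
    unfolding evl_theta_unit[OF Im_minus_inverse[OF \<tau>]] theta32_1_inversion[OF \<tau>]
      theta34_inversion[OF \<tau> disjI1[OF refl]] theta34_inversion[OF \<tau> disjI2[OF refl]]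
    using inv_factor_nonzero[OF \<tau>] by (simp add: theta32_0 theta34_0[symmetric] power_mult_distrib field_simps)
  also have "theta34 0 \<tau> * theta34 1 \<tau> = evl (phi * phim) q"
    using evl_phi[OF \<tau>] evl_phim[OF \<tau>] q by (simp add: evl_mult theta34_def q_def)
  also have "\<dots> = evl phim x ^ 2"
    unfolding phi_mult_phim using q by (simp add: evl_power disc_dil_phim evl_dil xq)
  also have "theta32 1 \<tau> ^ 8 = 256 * x * evl psi x ^ 8"
  proof -
    have "qterm \<tau> 1 ^ 8 = x" using qterm_mult_nat[of \<tau> 1 8] by (simp add: qterm_8 x_def)
    then show ?thesis unfolding theta32_1_eq[OF \<tau>] x_def[symmetric] by (simp add: power_mult_distrib)
  qed
  finally have v: "evl theta_unit (nome (- 1 / \<tau>)) = evl phim x ^ 8 / (4096 * x * evl psi x ^ 8)"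
    by (simp add: power_mult[symmetric] mult_ac)
  have inv: "evl psi x * evl psi_inv x = 1"
    using x by (metis disc_psi disc_psi_inv evl_1 evl_mult psi_mult_inv)
  have "evl theta_unit_cusp x = evl phim x ^ 8 * evl psi_inv x ^ 8"
    unfolding theta_unit_cusp_def using x by (simp add: evl_mult evl_power disc_fps_power)
  also have "evl psi_inv x = 1 / evl psi x" using inv by (metis eq_divide_imp mult.commute mult_zero_left zero_neq_one)
  finally show ?thesis unfolding v using x by (simp add: power_divide)
qed

text \<open>
The series \<open>X^i K^(m-i)\<close> start with \<open>X^i\<close>, so the coefficients can be matched one after the other over the
integers.
\<close>

lemma triangular_expansion:
  fixes Z K :: "int fps"
  assumes K: "K $ 0 = 1" 
  shows "k \<le> Suc m \<Longrightarrow> \<exists>e W. Z = (\<Sum>i<k. fps_const (e i) * (fps_X ^ i * K ^ (m - i))) + fps_X ^ k * W"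
proof (induction k)
  case 0
  then show ?case by (intro exI[of _ "\<lambda>_. 0"] exI[of _ Z]) simp
next
  case (Suc k)
  then obtain e W where eW: "Z = (\<Sum>i<k. fps_const (e i) * (fps_X ^ i * K ^ (m - i))) + fps_X ^ k * W" by auto
  define W' where "W' = fps_shift 1 (W - fps_const (W $ 0) * K ^ (m - k))"
  have "(W - fps_const (W $ 0) * K ^ (m - k)) $ 0 = 0" using K by (simp add: fps_nth_power_0)
  then have "W - fps_const (W $ 0) * K ^ (m - k) = fps_X * W'"
    unfolding W'_def by (intro fps_ext) (auto simp: fps_X_mult_nth)
  then have W: "W = fps_const (W $ 0) * K ^ (m - k) + fps_X * W'" by (simp add: algebra_simps)
  define e' where "e' = e(k := W $ 0)"
  have "(\<Sum>i<k. fps_const (e' i) * (fps_X ^ i * K ^ (m - i))) = (\<Sum>i<k. fps_const (e i) * (fps_X ^ i * K ^ (m - i)))"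
    by (intro sum.cong) (auto simp: e'_def)
  then have "Z = (\<Sum>i<Suc k. fps_const (e' i) * (fps_X ^ i * K ^ (m - i))) + fps_X ^ Suc k * W'"
    unfolding eW by (subst W) (simp add: e'_def algebra_simps)
  then show ?case by blast
qed

lemma evl_sum: 
  assumes "\<And>i. i \<in> I \<Longrightarrow> disc_fps (f i)" "norm z < 1"
  shows "disc_fps (\<Sum>i\<in>I. f i)" "evl (\<Sum>i\<in>I. f i) z = (\<Sum>i\<in>I. evl (f i) z)"
proof -
  have 0: "disc_fps 0" "evl 0 z = 0" by (simp_all add: disc_fps_def evl_def)
  have "disc_fps (\<Sum>i\<in>I. f i) \<and> evl (\<Sum>i\<in>I. f i) z = (\<Sum>i\<in>I. evl (f i) z)"
    using assms by (induction I rule: infinite_finite_induct) (auto simp: 0 evl_add)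
  then show "disc_fps (\<Sum>i\<in>I. f i)" "evl (\<Sum>i\<in>I. f i) z = (\<Sum>i\<in>I. evl (f i) z)" by auto
qed

text \<open>
Divide the error by \<open>F\<close>. At the second cusp the quotient times \<open>x^m\<close> is integral, so triangularity yields a
polynomial in \<open>2^12 v\<close>, \<open>v\<close> being the modular function above, that matches it up to terms vanishing at this cusp. The difference is invariant under
the theta group and therefore zero.
\<close>

theorem hecke_pbar_polynomial:
  assumes l: "prime l" "odd l"
  shows "\<exists>m e. hecke_pbar l - fps_const (int l ^ 3 + 1) * pbar_fps =
     (\<Sum>j\<in>{1..m}. fps_const (e j * 2 ^ (12 * j)) * (pbar_fps * theta_unit ^ j))"
proof -
  obtain m where m: "l\<^sup>2 = 8 * m + 1" using odd_square_mod_8[OF l(2)] ..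
  then have ml: "int l ^ 2 = 8 * int m + 1" by (metis of_nat_1 of_nat_add of_nat_mult of_nat_numeral of_nat_power)
  define T where "T = hecke_pbar l"
  define Y where "Y = hecke_cusp_fps l"
  define c where "c = int l ^ 3 + 1"
  have dT [simp]: "disc_fps T" unfolding T_def by (rule disc_hecke_pbar[OF l])
  have dY [simp]: "disc_fps Y" unfolding Y_def by (rule disc_hecke_cusp_fps[OF l])
  \<comment> \<open>The expansion of \<open>x^m D / F\<close> at the second cusp.\<close>
  define Z where "Z = Y * psi - fps_const c * fps_X ^ m"
  have K0: "theta_unit_cusp $ 0 = 1"
  proof -
    have "psi $ 0 * psi_inv $ 0 = 1" using psi_mult_inv by (metis fps_mult_nth_0 fps_one_nth)
    moreover have "psi $ 0 = 1" by (auto simp: psi_def)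
    ultimately show ?thesis by (simp add: theta_unit_cusp_def fps_nth_power_0 phim_def phi_def)
  qed
  obtain e W where eW: "Z = (\<Sum>i<Suc m. fps_const (e i) * (fps_X ^ i * theta_unit_cusp ^ (m - i))) + fps_X ^ Suc m * W"
    using triangular_expansion[OF K0, of "Suc m" m Z] by blast
  have dterm: "disc_fps (fps_const (e i) * (fps_X ^ i * theta_unit_cusp ^ (m - i)))" for i
    by (intro disc_fps_mult disc_fps_power) simp_all
  have dZ: "disc_fps Z" unfolding Z_def by (intro disc_fps_diff disc_fps_mult disc_fps_power) simp_all
  have dW: "disc_fps W"
  proof -
    have "fps_X ^ Suc m * W = Z - (\<Sum>i<Suc m. fps_const (e i) * (fps_X ^ i * theta_unit_cusp ^ (m - i)))"
      unfolding eW by simp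
    moreover have "disc_fps (Z - (\<Sum>i<Suc m. fps_const (e i) * (fps_X ^ i * theta_unit_cusp ^ (m - i))))"
      by (intro disc_fps_diff dZ evl_sum(1)[where z = 0] dterm) simp
    ultimately have "fps_conv_radius (cfps (fps_X ^ Suc m * W)) \<ge> 1" by (simp add: disc_fps_def)
    moreover have "cfps W = fps_shift (Suc m) (cfps (fps_X ^ Suc m * W))"
      by (rule fps_ext) (simp add: fps_X_power_mult_nth del: power_Suc)
    ultimately show ?thesis unfolding disc_fps_def by (metis fps_conv_radius_shift)
  qed
  \<comment> \<open>A summand \<open>e i x^i K^(m-i)\<close> of \<open>Z\<close>, where \<open>K\<close> expands \<open>2^12 x v\<close>, is \<open>x^m\<close> times \<open>e i (2^12 v)^(m-i)\<close>.\<close>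
  define Hs where "Hs = (\<Sum>i<Suc m. fps_const (e i * 4096 ^ (m - i)) * theta_unit ^ (m - i))"
  define H where "H = (T * phim - fps_const c) - Hs"
  have dHt: "disc_fps (fps_const (e i * 4096 ^ (m - i)) * theta_unit ^ (m - i))" for i
    by (intro disc_fps_mult disc_fps_power) simp_all
  have dHs: "disc_fps Hs" unfolding Hs_def by (intro evl_sum(1)[where z = 0] dHt) simp
  have dH: "disc_fps H" unfolding H_def by (intro disc_fps_diff disc_fps_mult dHs) simp_all
  have evH: "evl H z = evl T z * evl phim z - of_int c - (\<Sum>i<Suc m. of_int (e i) * (4096 * evl theta_unit z) ^ (m - i))"
    if z: "norm z < 1" for z
  proof -
    have "evl Hs z = (\<Sum>i<Suc m. evl (fps_const (e i * 4096 ^ (m - i)) * theta_unit ^ (m - i)) z)"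
      unfolding Hs_def by (rule evl_sum(2)[OF dHt z])
    also have "\<dots> = (\<Sum>i<Suc m. of_int (e i) * (4096 * evl theta_unit z) ^ (m - i))"
      using z by (intro sum.cong refl) (simp add: evl_mult evl_power disc_fps_power power_mult_distrib)
    finally show ?thesis
      using z dHs by (simp add: H_def evl_diff evl_mult disc_fps_diff disc_fps_mult del: sum.lessThan_Suc)
  qed
  have vanish: "evl H z = 0" if "z \<in> ball 0 1" for z
  proof (rule modular_vanishing[OF evl_holomorphic[OF dH] _ _ that])
    fix \<tau> :: complex assume \<tau>: "Im \<tau> > 0"
    note \<tau>' = Im_minus_inverse[OF \<tau>]
    have f: "evl T (- nome \<sigma>) = hecke l (\<lambda>\<tau>. 1 / theta34 0 \<tau>) \<sigma>" "evl phim (- nome \<sigma>) = theta34 0 \<sigma>"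
      if "Im \<sigma> > 0" for \<sigma>
      using evl_hecke_pbar[OF l that, of 0] theta34_eq_phim[OF that, of 0] by (simp_all add: T_def cusp_sign_def)
    have "theta32 0 = theta34 0" by (auto simp: theta32_0 theta34_0)
    then have "evl T (- nome (- 1 / \<tau>)) * evl phim (- nome (- 1 / \<tau>)) =
        evl T (- nome \<tau>) * evl phim (- nome \<tau>)"
      unfolding f[OF \<tau>] f[OF \<tau>'] theta34_inversion[OF \<tau> disjI1[OF refl]] hecke_inversion[OF l \<tau> disjI1[OF refl]]
      using inv_factor_nonzero[OF \<tau>] by simp
    moreover have n: "norm (- nome (- 1 / \<tau>)) < 1" "norm (- nome \<tau>) < 1"
      using norm_nome[OF \<tau>] norm_nome[OF \<tau>'] by simp_all
    ultimately show "evl H (- nome (- 1 / \<tau>)) = evl H (- nome \<tau>)"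
      unfolding evH[OF n(1)] evH[OF n(2)] evl_theta_unit_minus_inversion[OF \<tau>] by simp
  next
    fix \<epsilon> :: real assume \<epsilon>: "\<epsilon> > 0"
    have cusp: "evl H (nome (- 1 / \<tau>)) = nome_sq \<tau> * evl W (nome_sq \<tau>)"
      if \<tau>: "Im \<tau> > 0" for \<tau>
    proof -
      note \<tau>' = Im_minus_inverse[OF \<tau>]
      define x where "x = nome_sq \<tau>"
      define q' where "q' = nome (- 1 / \<tau>)"
      have x: "norm x < 1" "x \<noteq> 0" using \<tau> by (simp_all add: x_def)
      have q': "norm q' < 1" unfolding q'_def by (rule norm_nome[OF \<tau>'])
      have "evl T q' * evl phim q' = hecke l (\<lambda>\<tau>. 1 / theta34 1 \<tau>) (- 1 / \<tau>) * theta34 1 (- 1 / \<tau>)"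
        using evl_hecke_pbar[OF l \<tau>', of 1] theta34_eq_phim[OF \<tau>', of 1] by (simp add: T_def q'_def cusp_sign_def)
      also have "\<dots> = hecke l (\<lambda>\<tau>. 1 / theta32 1 \<tau>) \<tau> * theta32 1 \<tau>"
        unfolding theta34_inversion[OF \<tau> disjI2[OF refl]] hecke_inversion[OF l \<tau> disjI2[OF refl]]
        using inv_factor_nonzero[OF \<tau>] by simp
      also have "\<dots> = evl Y x * evl psi x * (qterm \<tau> (- (int l ^ 2)) * qterm \<tau> 1)"
        unfolding evl_hecke_cusp_fps[OF l \<tau>] theta32_1_eq[OF \<tau>] by (simp add: Y_def x_def)
      finally have "x ^ m * (evl T q' * evl phim q') = evl Y x * evl psi x * (x ^ m * (qterm \<tau> (- (int l ^ 2)) * qterm \<tau> 1))"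
        by (simp add: mult_ac)
      also have "x ^ m * (qterm \<tau> (- (int l ^ 2)) * qterm \<tau> 1) = 1"
      proof -
        have "x ^ m = qterm \<tau> (8 * int m)" unfolding qterm_mult_nat qterm_8 x_def ..
        then show ?thesis by (simp add: ml qterm_add[symmetric]) (simp add: qterm_def)
      qed
      finally have Tq: "x ^ m * (evl T q' * evl phim q') = evl (Y * psi) x"
        using x by (simp add: evl_mult)
      have "x ^ m * evl H q' = evl (Y * psi) x - of_int c * x ^ m - (\<Sum>i<Suc m. x ^ m * (of_int (e i) * (4096 * evl theta_unit q') ^ (m - i)))"
        unfolding evH[OF q'] right_diff_distrib Tq by (simp add: sum_distrib_left mult.commute del: sum.lessThan_Suc)
      also have "(\<Sum>i<Suc m. x ^ m * (of_int (e i) * (4096 * evl theta_unit q') ^ (m - i))) =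
          (\<Sum>i<Suc m. evl (fps_const (e i) * (fps_X ^ i * theta_unit_cusp ^ (m - i))) x)"
      proof (rule sum.cong[OF refl])
        fix i assume "i \<in> {..<Suc m}"
        then have "m = i + (m - i)" by simp
        then have "x ^ m = x ^ i * x ^ (m - i)" by (metis power_add)
        then have "x ^ m * (of_int (e i) * (4096 * evl theta_unit q') ^ (m - i)) = of_int (e i) * (x ^ i * (x * (4096 * evl theta_unit q')) ^ (m - i))"
          by (simp only: power_mult_distrib mult_ac)
        also have "x * (4096 * evl theta_unit q') = evl theta_unit_cusp x"
          unfolding x_def q'_def by (rule evl_theta_unit_cusp[OF \<tau>])
        finally show "x ^ m * (of_int (e i) * (4096 * evl theta_unit q') ^ (m - i)) = evl (fps_const (e i) * (fps_X ^ i * theta_unit_cusp ^ (m - i))) x"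
          using x by (simp add: evl_mult evl_power disc_fps_power disc_fps_mult)
      qed
      also have "\<dots> = evl (\<Sum>i<Suc m. fps_const (e i) * (fps_X ^ i * theta_unit_cusp ^ (m - i))) x"
        by (rule evl_sum(2)[symmetric, OF dterm x(1)])
      also have "evl (Y * psi) x - of_int c * x ^ m = evl Z x"
        using x by (simp add: Z_def evl_diff evl_mult evl_power disc_fps_mult disc_fps_power)
      also have "evl Z x = evl (\<Sum>i<Suc m. fps_const (e i) * (fps_X ^ i * theta_unit_cusp ^ (m - i))) x + evl (fps_X ^ Suc m * W) x"
        unfolding eW by (intro evl_add evl_sum(1)[where z = 0] dterm disc_fps_mult disc_fps_power dW x) simp_all
      finally have "x ^ m * evl H q' = evl (fps_X ^ Suc m * W) x" by simp
      also have "\<dots> = x ^ m * (x * evl W x)"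
        using x dW by (simp add: evl_mult evl_power disc_fps_power disc_fps_mult del: power_Suc) (simp add: mult_ac)
      finally show ?thesis using x by (simp add: x_def q'_def)
    qed
    have "continuous (at 0) (\<lambda>x. x * evl W x)"
      by (intro continuous_intros continuous_on_interior[OF holomorphic_on_imp_continuous_on[OF evl_holomorphic[OF dW]]]) simp
    then obtain \<delta> where \<delta>: "\<delta> > 0" "\<And>x. norm x < \<delta> \<Longrightarrow> norm (x * evl W x) < \<epsilon>"
      using \<epsilon> unfolding continuous_at_eps_delta by (auto simp: dist_norm)
    show "\<exists>B. \<forall>\<tau>. Im \<tau> > B \<longrightarrow> norm (evl H (nome (- 1 / \<tau>))) < \<epsilon>"
    proof (intro exI[of _ "max 0 (- ln \<delta> / (2 * pi))"] allI impI)
      fix \<tau> :: complex assume B: "Im \<tau> > max 0 (- ln \<delta> / (2 * pi))"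
      then have "- (2 * pi * Im \<tau>) < ln \<delta>" by (simp add: field_simps)
      then have "exp (- (2 * pi * Im \<tau>)) < \<delta>" using \<delta>(1) by (metis exp_less_mono exp_ln)
      then have "norm (nome_sq \<tau>) < \<delta>" by simp
      then show "norm (evl H (nome (- 1 / \<tau>))) < \<epsilon>"
        using cusp[of \<tau>] B \<delta>(2) by simp
    qed
  qed
  have "H = 0"
  proof (rule cfps_inject, rule eval_fps_eqD)
    have "1 \<le> fps_conv_radius (cfps H)" using dH by (simp add: disc_fps_def)
    then show "fps_conv_radius (cfps H) > 0" by (rule order.strict_trans2[rotated]) simp
    have "eventually (\<lambda>z. z \<in> ball (0::complex) 1) (nhds 0)"
      by (rule eventually_nhds_in_open) auto
    then show "eventually (\<lambda>z. eval_fps (cfps H) z = eval_fps (cfps 0) z) (nhds 0)"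
      by eventually_elim (use vanish in \<open>simp add: evl_def\<close>)
  qed simp_all
  then have eq: "T * phim - fps_const c = Hs" by (simp add: H_def)
  have theta_unit_0: "theta_unit $ 0 = 0" by (simp add: theta_unit_def theta2_fourth_def)
  \<comment> \<open>The summand with \<open>i = m\<close> is the constant term, and \<open>T F\<close> and \<open>(l^3 + 1) F\<close> agree at \<open>q = 0\<close>.\<close>
  have "e m = 0"
  proof -
    have "Hs $ 0 = (\<Sum>i<Suc m. if i = m then e i else 0)"
      unfolding Hs_def fps_sum_nth
      by (intro sum.cong refl) (auto simp: fps_nth_power_0 theta_unit_0 power_0_left)
    moreover have "(T * phim - fps_const c) $ 0 = 0"
    proof -
      have "overpartitions 0 = {({#}, {})}"
        using overpartitions_upto_eq[of 0 0] by (simp add: overpartitions_upto_0)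
      then have "pbar_nat 0 = 1" by (simp add: pbar_nat_def)
      then have "T $ 0 = c"
        by (simp add: T_def hecke_pbar_def hecke_coeff_def pbar_int_def c_def Legendre_def)
      then show ?thesis by (simp add: phim_def phi_def)
    qed
    ultimately show ?thesis using eq by simp
  qed
  then have Hs: "Hs = (\<Sum>i<m. fps_const (e i * 4096 ^ (m - i)) * theta_unit ^ (m - i))"
    by (simp add: Hs_def)
  have "hecke_pbar l - fps_const (int l ^ 3 + 1) * pbar_fps = (T * phim - fps_const c) * pbar_fps"
  proof -
    have "T * phim * pbar_fps = T" using pbar_fps_mult_phim by (metis mult.assoc mult.commute mult_1_right)
    then show ?thesis by (simp add: left_diff_distrib T_def c_def)
  qed
  also have "\<dots> = (\<Sum>i<m. fps_const (e i * 4096 ^ (m - i)) * (pbar_fps * theta_unit ^ (m - i)))"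
    unfolding eq Hs sum_distrib_right by (intro sum.cong refl) (simp add: mult_ac)
  also have "\<dots> = (\<Sum>j\<in>{1..m}. fps_const (e (m - j) * 2 ^ (12 * j)) * (pbar_fps * theta_unit ^ j))"
    by (rule sum.reindex_bij_witness[of _ "\<lambda>j. m - j" "\<lambda>i. m - i"]) (auto simp: power_mult)
  finally show ?thesis by (intro exI[of _ m] exI[of _ "\<lambda>j. e (m - j)"])
qed

lemma zspan_sum: "(\<And>i. i \<in> I \<Longrightarrow> f i \<in> zspan G) \<Longrightarrow> (\<Sum>i\<in>I. f i) \<in> zspan G"
  by (induction I rule: infinite_finite_induct) (auto intro: zspan_0 zspan_plus)

theorem theorem3p1:
  fixes \<alpha> l n :: nat
  assumes "\<alpha> \<ge> 1" and "prime l" and "odd l"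
  shows "[int l ^ 3 * int (pbar (2 ^ \<alpha> * of_nat l ^ 2 * of_nat n))
            + int l * Legendre (- (2 ^ \<alpha> * int n)) (int l) * int (pbar (2 ^ \<alpha> * of_nat n))
            + int (pbar (2 ^ \<alpha> * of_nat n / of_nat l ^ 2))
          = (int l ^ 3 + 1) * int (pbar (2 ^ \<alpha> * of_nat n))] (mod 2 ^ (\<alpha> + 12))"
proof -
  have l0: "l > 0" using assms prime_gt_0_nat by blast
  define N where "N = 2 ^ \<alpha> * n"
  define D where "D = hecke_pbar l - fps_const (int l ^ 3 + 1) * pbar_fps"
  obtain m e where D: "D = (\<Sum>j\<in>{1..m}. fps_const (e j * 2 ^ (12 * j)) * (pbar_fps * theta_unit ^ j))"
    unfolding D_def using hecke_pbar_polynomial[OF assms(2,3)] by blast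
  have "\<exists>X\<in>theta_span. D = fps_const (2 ^ 12) * X"
  proof
    define X where "X = (\<Sum>j\<in>{1..m}. fps_const (e j * 2 ^ (11 * (j - 1))) * (2 ^ (j - 1) * theta2_fourth ^ j * phi ^ (4 * j) * pbar_fps ^ (8 * j + 1)))"
    show "X \<in> theta_span"
      unfolding X_def theta_span_def
    proof (rule zspan_sum)
      fix j assume "j \<in> {1..m}"
      then have "1 \<le> j" by simp
      then have "2 ^ (j - 1) * theta2_fourth ^ j * phi ^ (4 * j) * pbar_fps ^ (8 * j + 1) \<in>
         {2 ^ (j - 1) * theta2_fourth ^ j * phi ^ a * pbar_fps ^ b |j a b. j \<ge> 1}" by blast
      then show "fps_const (e j * 2 ^ (11 * (j - 1))) * (2 ^ (j - 1) * theta2_fourth ^ j * phi ^ (4 * j) * pbar_fps ^ (8 * j + 1))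
          \<in> zspan {2 ^ (j - 1) * theta2_fourth ^ j * phi ^ a * pbar_fps ^ b |j a b. j \<ge> 1}"
        by (intro zspan_scale zspan_base)
    qed
    show "D = fps_const (2 ^ 12) * X"
      unfolding D X_def sum_distrib_left
    proof (rule sum.cong[OF refl])
      fix j assume "j \<in> {1..m}"
      \<comment> \<open>Of the \<open>12 j\<close> factors 2, twelve are split off and \<open>j - 1\<close> are the weight of the generator.\<close>
      then have j: "12 + 11 * (j - 1) + (j - 1) = 12 * j" by (cases j) auto
      have "fps_const (2 ^ 12) * (fps_const (e j * P) * (fps_const R * g * p * q)) =
          fps_const (e j * (2 ^ 12 * P * R)) * (g * p * q)" for P R g p q
        by (simp add: mult_ac flip: fps_const_mult)
      then have "fps_const (2 ^ 12) * (fps_const (e j * 2 ^ (11 * (j - 1))) * (2 ^ (j - 1) * theta2_fourth ^ j * phi ^ (4 * j) * pbar_fps ^ (8 * j + 1)))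
         = fps_const (e j * 2 ^ (12 + 11 * (j - 1) + (j - 1))) * (theta2_fourth ^ j * phi ^ (4 * j) * pbar_fps ^ (8 * j + 1))"
        unfolding two_power_fps power_add[of _ "12 + 11 * (j - 1)"] power_add[of _ 12] by blast
      moreover have "pbar_fps * theta_unit ^ j = theta2_fourth ^ j * phi ^ (4 * j) * pbar_fps ^ (8 * j + 1)"
        by (simp only: theta_unit_def power_mult_distrib power_mult[symmetric] power_add power_one_right mult_ac)
      ultimately show "fps_const (e j * 2 ^ (12 * j)) * (pbar_fps * theta_unit ^ j) =
         fps_const (2 ^ 12) * (fps_const (e j * 2 ^ (11 * (j - 1))) * (2 ^ (j - 1) * theta2_fourth ^ j * phi ^ (4 * j) * pbar_fps ^ (8 * j + 1)))"
        by (simp only: j)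
    qed
  qed
  then obtain X where X: "X \<in> theta_span" "D = fps_const (2 ^ 12) * X" by blast
  have "2 ^ \<alpha> dvd X $ N" unfolding N_def by (rule theta_span_coeff_divisible[OF X(1)])
  then have "2 ^ (\<alpha> + 12) dvd D $ N"
    unfolding X(2) power_add by (simp add: mult.commute mult_dvd_mono)
  moreover have "D $ N = (int l ^ 3 * int (pbar_nat (l\<^sup>2 * N)) + int l * Legendre (- int N) (int l) * int (pbar_nat N)
      + (if l\<^sup>2 dvd N then int (pbar_nat (N div l\<^sup>2)) else 0)) - (int l ^ 3 + 1) * int (pbar_nat N)"
  proof -
    have "int l ^ 2 * int N = int (l\<^sup>2 * N)" "int N div int l ^ 2 = int (N div l\<^sup>2)" "int l ^ 2 dvd int N \<longleftrightarrow> l\<^sup>2 dvd N"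
      by (simp_all add: zdiv_int flip: of_nat_power)
    then show ?thesis
      by (simp add: D_def hecke_pbar_def hecke_coeff_def pbar_int_def pbar_fps_def del: of_nat_mult of_nat_power)
  qed
  moreover have "pbar (2 ^ \<alpha> * of_nat l ^ 2 * of_nat n) = pbar_nat (l\<^sup>2 * N)"
  proof -
    have "(2 ^ \<alpha> * of_nat l ^ 2 * of_nat n :: rat) = of_nat (l\<^sup>2 * N)" by (simp add: N_def)
    then show ?thesis by (simp only: pbar_of_nat)
  qed
  moreover have pN: "pbar (2 ^ \<alpha> * of_nat n) = pbar_nat N"
  proof -
    have "(2 ^ \<alpha> * of_nat n :: rat) = of_nat N" by (simp add: N_def)
    then show ?thesis by (simp only: pbar_of_nat)
  qed
  moreover have "pbar (2 ^ \<alpha> * of_nat n / of_nat l ^ 2) = (if l\<^sup>2 dvd N then pbar_nat (N div l\<^sup>2) else 0)"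
  proof -
    have e: "(2 ^ \<alpha> * of_nat n / of_nat l ^ 2 :: rat) = of_nat N / of_nat (l\<^sup>2)" by (simp add: N_def)
    show ?thesis
    proof (cases "l\<^sup>2 dvd N")
      case True
      then obtain k where "N = l\<^sup>2 * k" by blast
      then have "(of_nat N / of_nat (l\<^sup>2) :: rat) = of_nat (N div l\<^sup>2)" using l0 by simp
      then show ?thesis unfolding e using True by (simp only: pbar_of_nat if_True)
    next
      case False
      have "(of_nat N / of_nat (l\<^sup>2) :: rat) \<notin> \<nat>"
      proof
        assume "(of_nat N / of_nat (l\<^sup>2) :: rat) \<in> \<nat>"
        then obtain k where "(of_nat N / of_nat (l\<^sup>2) :: rat) = of_nat k" by (auto elim: Nats_cases)
        then have "(of_nat N :: rat) = of_nat (l\<^sup>2 * k)" using l0 by (simp add: field_simps)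
        then have "N = l\<^sup>2 * k" by (simp only: of_nat_eq_iff)
        then show False using False by simp
      qed
      then show ?thesis unfolding e pbar_def using False by simp
    qed
  qed
  moreover have "- (2 ^ \<alpha> * int n) = - int N" by (simp add: N_def)
  ultimately show ?thesis by (cases "l\<^sup>2 dvd N") (simp_all add: cong_iff_dvd_diff)
qed

end
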